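(* For each $n$ let $n_1=n_1(n)\ge n$ and $n_2=n_2(n)\ge n$ be integers, let $X_n\in\mathbb R^{n\times n_1}$ and $Y_n\in\mathbb R^{n\times n_2}$ be random matrices whose entries are independent standard normal random variables (all defined on a common probability space), let $F_n=(\frac1{n_1}X_nX_n^T)(\frac1{n_2}Y_nY_n^T)^{-1}$, and let $\lambda_1^F\le\dots\le\lambda_n^F$ be its eigenvalues. Suppose $$\lim_{n\to\infty}\frac n{n_1}=0,\qquad\lim_{n\to\infty}\frac n{n_2}=0,\qquad\lim_{n\to\infty}\frac{n_1}{n_2}=\gamma>0,$$ and $n_1=O(n^{1+\nu})$ for some $\nu\in(0,1)$. Then the empirical distribution function of the transformed eigenvalues $$\mu_i=2\sqrt{\frac{n_1}{n}-1}\,\Big\{\frac{n_2-n}{n_1+n_2-2n}-\frac{n_2}{n_1\lambda_i^F+n_2}\Big\},\qquad i=1,\dots,n,$$ converges almost surely to the distribution function with density $f_\gamma(x)=\frac2{\pi\sigma^2}\sqrt{\sigma^2-x^2}\,I\{-\sigma<x<\sigma\}$, where $\sigma=4\gamma/(1+\gamma)^{3/2}$.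
   Context: The empirical distribution function of real numbers $\mu_1,\dots,\mu_n$ is $\xi\mapsto\frac1n\sum_{i=1}^nI\{\mu_i\le\xi\}$. *)

theory Defs
  imports "HOL-Probability.Probability" "HOL-Library.Landau_Symbols"
    "Jordan_Normal_Form.Char_Poly" "Jordan_Normal_Form.Gauss_Jordan_Elimination"
begin

definition ecdf :: "nat \<Rightarrow> (nat \<Rightarrow> real) \<Rightarrow> real \<Rightarrow> real" where
  "ecdf n mu xi = (\<Sum>i<n. if mu i \<le> xi then 1 else 0) / real n"

definition mat_of :: "nat \<Rightarrow> nat \<Rightarrow> (nat \<Rightarrow> nat \<Rightarrow> real) \<Rightarrow> real mat" where
  "mat_of n m A = mat n m (\<lambda>(i, j). A i j)"

definition fisher_mat :: "nat \<Rightarrow> nat \<Rightarrow> nat \<Rightarrow> (nat \<Rightarrow> nat \<Rightarrow> real) \<Rightarrow> (nat \<Rightarrow> nat \<Rightarrow> real) \<Rightarrow> real mat" where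
  "fisher_mat n n1 n2 X Y =
     ((1 / real n1) \<cdot>\<^sub>m (mat_of n n1 X * transpose_mat (mat_of n n1 X))) *
     the (mat_inverse ((1 / real n2) \<cdot>\<^sub>m (mat_of n n2 Y * transpose_mat (mat_of n n2 Y))))"

text \<open>Eigenvalues (with multiplicity, real roots of the characteristic polynomial),
  in increasing order: entry i of this list is lambda_(i+1).\<close>
definition sorted_eigenvalues :: "real mat \<Rightarrow> real list" where
  "sorted_eigenvalues A = sorted_list_of_multiset (proots (char_poly A))"

definition f_gamma :: "real \<Rightarrow> real \<Rightarrow> real" where
  "f_gamma \<gamma> x = (let \<sigma> = 4 * \<gamma> / (1 + \<gamma>) powr (3/2) in
     2 / (pi * \<sigma>\<^sup>2) * sqrt (\<sigma>\<^sup>2 - x\<^sup>2) * indicator {-\<sigma><..<\<sigma>} x)"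

end

theory Submission
  imports Defs "Jordan_Normal_Form.Schur_Decomposition" "Jordan_Normal_Form.Spectral_Radius"
begin

text \<open>
  Let \<open>Z = [X Y]\<close>. An eigenvalue satisfies \<open>\<mu> \<le> \<xi>\<close> iff the corresponding \<open>\<lambda>\<close> is at most \<open>(n2/n1) r\<close>
  for an explicit \<open>r = r(n, \<xi>) \<rightarrow> \<gamma>\<close>, and by simultaneous diagonalization and Sylvester's law of inertia
  the number of these \<open>\<lambda>\<close> is the number of nonpositive eigenvalues of \<open>X X\<^sup>T - r Y Y\<^sup>T = Z D Z\<^sup>T\<close> with
  \<open>D = diag(1, \<dots>, 1, -r, \<dots>, -r)\<close>. This removes the inverse: it remains to show that the spectral
  distribution of \<open>K = (Z D Z\<^sup>T - tr(D) I) / sqrt(n (n1 + n2))\<close> tends to a semicircle law.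

  For words \<open>w\<close> in the matrices \<open>K\<^sub>m = (Z D\<^sup>m Z\<^sup>T - tr(D\<^sup>m) I) / sqrt(n (n1 + n2))\<close>, Gaussian integration by parts
  expresses the expectation of a product of normalized traces of words through such expectations with fewer
  letters. Since \<open>n / (n1 + n2) \<rightarrow> 0\<close>, induction on the number of letters gives the limits (a weighted
  Catalan recursion) and shows that covariances are \<open>O(1/n\<^sup>2)\<close>, hence summable: the moments of \<open>K\<close>
  converge almost surely, and the method of moments applies. The Catalan recursion for the semicircle
  moments is the first-passage decomposition of the lattice paths generated by
  \<open>2 cos \<theta> sin ((j + 1) \<theta>) = sin ((j + 2) \<theta>) + sin (j \<theta>)\<close>.
\<close>

section \<open>Polynomials in independent Gaussian variables\<close>

text \<open>All exponents \<open>m\<close> are carried along because pairing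
  \<open>K\<^sub>m\<close> with \<open>K\<^sub>l\<close> leaves
  \<open>Z D\<^sup>m\<^sup>+\<^sup>l Z\<^sup>T\<close>: words in \<open>K\<close> alone are not
  closed under integration by parts. Divided by \<open>|J| = n1 + n2\<close>, this matrix is a
  deterministic multiple of the identity plus \<open>sqrt (n / |J|)\<close> times a letter. The
  letter disappears in the limit, so only averages of powers of \<open>D\<close> and noncrossing
  pairings remain. For words in \<open>K\<close> just the average of \<open>D\<^sup>2\<close>
  enters; it tends to \<gamma>, so \<open>K\<close> has limiting radius
  \<open>2 * sqrt \<gamma>\<close>, and solving for the threshold rescales this to \<sigma>. The
  price for removing the inverse is that \<open>r\<close>, hence \<open>D\<close> and
  \<open>K\<close>, depend on \<xi>. Almost sure convergence is therefore obtained for one \<xi> at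
  a time, with its own null set; rational \<xi> are collected, and monotonicity together with
  continuity of the limit gives all \<xi> at once. Matrices for different \<open>n\<close> may
  depend on each other in any way, so the almost sure statements rest on summable bounds.\<close>

definition gauss_moment :: "nat \<Rightarrow> real" where
  "gauss_moment k = (\<integral>x. std_normal_density x * x ^ k \<partial>lborel)"

text \<open>Stein's identity for the monomial \<open>x ^ k\<close>, read off from the known values
  of the Gaussian moments. For \<open>k = 0\<close> the factor \<open>real k\<close> absorbs the
  truncated \<open>k - 1\<close>.\<close>

lemma gauss_moment_Suc: "gauss_moment (Suc k) = real k * gauss_moment (k - 1)"
proof (cases "even k")
  case True
  then obtain l where l: "k = 2 * l" by (auto elim: evenE)
  have "gauss_moment (Suc k) = 0"
    using integral_std_normal_moment_odd[of l] l by (simp add: gauss_moment_def)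
  moreover have "real k * gauss_moment (k - 1) = 0"
  proof (cases l)
    case (Suc l')
    have "k - 1 = 2 * l' + 1" using l Suc by simp
    then show ?thesis using integral_std_normal_moment_odd[of l'] by (simp add: gauss_moment_def)
  qed (use l in simp)
  ultimately show ?thesis by simp
next
  case False
  then obtain l where l: "k = 2 * l + 1" by (auto elim: oddE)
  have 1: "gauss_moment (Suc k) = fact (2 * (l + 1)) / (2 ^ (l + 1) * fact (l + 1))"
    using integral_std_normal_moment_even[of "l + 1"] l by (simp add: gauss_moment_def)
  have 2: "gauss_moment (k - 1) = fact (2 * l) / (2 ^ l * fact l)"
    using integral_std_normal_moment_even[of l] l by (simp add: gauss_moment_def)
  have "fact (2 * (l + 1)) = real (2 * l + 2) * real (2 * l + 1) * fact (2 * l)"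
    by (simp add: algebra_simps)
  moreover have "real k = real (2 * l + 1)" using l by simp
  moreover have "fact (l + 1) = real (l + 1) * fact l" by simp
  ultimately show ?thesis unfolding 1 2
    by (simp add: divide_simps del: fact_Suc of_nat_Suc) (simp add: algebra_simps)
qed

locale gaussian_family = prob_space M for M :: "'w measure" +
  fixes I :: "'i set" and z :: "'i \<Rightarrow> 'w \<Rightarrow> real"
  assumes finite_I: "finite I"
    and indep: "indep_vars (\<lambda>_. borel) z I"
    and std_normal: "\<And>i. i \<in> I \<Longrightarrow> distributed M lborel (z i) std_normal_density"
begin

definition monom_fn :: "('i \<Rightarrow> nat) \<Rightarrow> 'w \<Rightarrow> real" where
  "monom_fn k \<omega> = (\<Prod>b\<in>I. z b \<omega> ^ k b)"

lemma integrable_power_z: "i \<in> I \<Longrightarrow> integrable M (\<lambda>\<omega>. z i \<omega> ^ k)"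
  using distributed_integrable[OF std_normal, of i "\<lambda>x. x ^ k"] integrable_std_normal_moment[of k]
  by simp

lemma expectation_power_z: "i \<in> I \<Longrightarrow> expectation (\<lambda>\<omega>. z i \<omega> ^ k) = gauss_moment k"
  using distributed_integral[OF std_normal, of i "\<lambda>x. x ^ k"] by (simp add: gauss_moment_def)

lemma indep_powers: "indep_vars (\<lambda>_. borel) (\<lambda>b \<omega>. z b \<omega> ^ k b) I"
  by (rule indep_vars_compose2[OF indep]) simp

lemma integrable_monom_fn: "integrable M (monom_fn k)"
  unfolding monom_fn_def[abs_def]
  using finite_I indep_powers integrable_power_z by (rule indep_vars_integrable)

lemma expectation_monom_fn: "expectation (monom_fn k) = (\<Prod>b\<in>I. gauss_moment (k b))"
  unfolding monom_fn_def[abs_def]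
  using indep_vars_lebesgue_integral[OF finite_I indep_powers integrable_power_z]
  by (simp add: expectation_power_z)

lemma monom_fn_remove: "a \<in> I \<Longrightarrow> monom_fn k \<omega> = z a \<omega> ^ k a * (\<Prod>b\<in>I - {a}. z b \<omega> ^ k b)"
  unfolding monom_fn_def using finite_I by (simp add: prod.remove)

lemma z_mult_monom_fn: "a \<in> I \<Longrightarrow> z a \<omega> * monom_fn k \<omega> = monom_fn (k(a := Suc (k a))) \<omega>"
  by (simp add: monom_fn_remove)

lemma monom_fn_mult: "monom_fn k \<omega> * monom_fn l \<omega> = monom_fn (\<lambda>b. k b + l b) \<omega>"
  unfolding monom_fn_def by (simp add: power_add prod.distrib)

text \<open>The formal partial derivative of a monomial. If \<open>k a = 0\<close>, the leading
  factor is 0, so the truncated exponent does no harm.\<close>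

definition dmonom_fn :: "'i \<Rightarrow> ('i \<Rightarrow> nat) \<Rightarrow> 'w \<Rightarrow> real" where
  "dmonom_fn a k \<omega> = real (k a) * monom_fn (k(a := k a - 1)) \<omega>"

lemma integrable_dmonom_fn: "integrable M (dmonom_fn a k)"
  unfolding dmonom_fn_def[abs_def] using integrable_monom_fn by simp

lemma expectation_z_mult_monom_fn:
  assumes a: "a \<in> I"
  shows "expectation (\<lambda>\<omega>. z a \<omega> * monom_fn k \<omega>) = expectation (dmonom_fn a k)"
proof -
  have "expectation (\<lambda>\<omega>. z a \<omega> * monom_fn k \<omega>) = (\<Prod>b\<in>I. gauss_moment ((k(a := Suc (k a))) b))"
    using z_mult_monom_fn[OF a] expectation_monom_fn by simp
  also have "\<dots> = gauss_moment (Suc (k a)) * (\<Prod>b\<in>I - {a}. gauss_moment (k b))"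
    using a finite_I by (simp add: prod.remove)
  also have "\<dots> = real (k a) * (\<Prod>b\<in>I. gauss_moment ((k(a := k a - 1)) b))"
    using a finite_I by (simp add: prod.remove gauss_moment_Suc)
  finally show ?thesis by (simp add: expectation_monom_fn dmonom_fn_def[abs_def] del: fun_upd_apply)
qed

text \<open>
  \<open>f\<close> is a polynomial in the variables \<open>z\<close> and \<open>g\<close> the formal derivative of some representation of \<open>f\<close>
  with respect to \<open>z a\<close>.
\<close>
definition has_pd :: "'i \<Rightarrow> ('w \<Rightarrow> real) \<Rightarrow> ('w \<Rightarrow> real) \<Rightarrow> bool" where
  "has_pd a f g \<longleftrightarrow> (\<exists>L. f = (\<lambda>\<omega>. \<Sum>(c, k)\<leftarrow>L. c * monom_fn k \<omega>) \<and>
     g = (\<lambda>\<omega>. \<Sum>(c, k)\<leftarrow>L. c * dmonom_fn a k \<omega>))"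

lemma has_pd_const: "has_pd a (\<lambda>_. c) (\<lambda>_. 0)"
  unfolding has_pd_def by (rule exI[of _ "[(c, \<lambda>_. 0)]"]) (simp add: monom_fn_def dmonom_fn_def)

lemma has_pd_var:
  assumes "b \<in> I" shows "has_pd a (z b) (\<lambda>_. if a = b then 1 else 0)"
proof -
  have "z b = monom_fn ((\<lambda>_. 0)(b := 1))"
    using assms finite_I by (auto simp: fun_eq_iff monom_fn_remove)
  moreover have "monom_fn (\<lambda>_. 0) = (\<lambda>_. 1)" by (simp add: monom_fn_def fun_eq_iff)
  moreover have "((\<lambda>_. 0)(b := 0)) = (\<lambda>_. 0::nat)" by auto
  ultimately show ?thesis unfolding has_pd_def
    by (intro exI[of _ "[(1, (\<lambda>_. 0)(b := 1))]"]) (auto simp: dmonom_fn_def)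
qed

lemma has_pd_add: "has_pd a f f' \<Longrightarrow> has_pd a g g' \<Longrightarrow> has_pd a (\<lambda>\<omega>. f \<omega> + g \<omega>) (\<lambda>\<omega>. f' \<omega> + g' \<omega>)"
  unfolding has_pd_def
proof (elim exE conjE)
  fix L L' assume h: "f = (\<lambda>\<omega>. \<Sum>(c, k)\<leftarrow>L. c * monom_fn k \<omega>)"
   "g = (\<lambda>\<omega>. \<Sum>(c, k)\<leftarrow>L'. c * monom_fn k \<omega>)"
   "f' = (\<lambda>\<omega>. \<Sum>(c, k)\<leftarrow>L. c * dmonom_fn a k \<omega>)"
   "g' = (\<lambda>\<omega>. \<Sum>(c, k)\<leftarrow>L'. c * dmonom_fn a k \<omega>)"
  show "\<exists>L. (\<lambda>\<omega>. f \<omega> + g \<omega>) = (\<lambda>\<omega>. \<Sum>(c, k)\<leftarrow>L. c * monom_fn k \<omega>) \<and>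
     (\<lambda>\<omega>. f' \<omega> + g' \<omega>) = (\<lambda>\<omega>. \<Sum>(c, k)\<leftarrow>L. c * dmonom_fn a k \<omega>)"
    by (rule exI[of _ "L @ L'"]) (simp add: h)
qed

lemma monom_fn_leibniz:
  assumes a: "a \<in> I"
  shows "dmonom_fn a (\<lambda>b. k b + l b) \<omega> = dmonom_fn a k \<omega> * monom_fn l \<omega> +
    monom_fn k \<omega> * dmonom_fn a l \<omega>"
proof -
  let ?k = "\<Prod>b\<in>I - {a}. z b \<omega> ^ k b" and ?l = "\<Prod>b\<in>I - {a}. z b \<omega> ^ l b"
  have s: "(\<Prod>b\<in>I - {a}. z b \<omega> ^ (k b + l b)) = ?k * ?l"
    by (simp add: power_add prod.distrib)
  have "real (p + q) * x ^ (p + q - 1) = real p * x ^ (p - 1) * x ^ q + x ^ p * (real q * x ^ (q - 1))" for p q x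
    by (cases p; cases q) (auto simp: algebra_simps power_add)
  note e = this[of "k a" "l a" "z a \<omega>"]
  have gen: "c * x = p * x1 * x2 + y1 * (q * y2) \<Longrightarrow>
    c * (x * (K * L)) = p * (x1 * K) * (x2 * L) + (y1 * K) * (q * (y2 * L))" for c x p q x1 x2 y1 y2 K L :: real
  proof -
    assume h: "c * x = p * x1 * x2 + y1 * (q * y2)"
    have "c * (x * (K * L)) = (c * x) * (K * L)" by simp
    then show ?thesis unfolding h by (simp add: algebra_simps)
  qed
  have "monom_fn ((\<lambda>b. k b + l b)(a := k a + l a - 1)) \<omega> = z a \<omega> ^ (k a + l a - 1) * (?k * ?l)"
    "monom_fn (k(a := k a - 1)) \<omega> = z a \<omega> ^ (k a - 1) * ?k"
    "monom_fn (l(a := l a - 1)) \<omega> = z a \<omega> ^ (l a - 1) * ?l"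
    "monom_fn k \<omega> = z a \<omega> ^ k a * ?k" "monom_fn l \<omega> = z a \<omega> ^ l a * ?l"
    by (simp_all add: monom_fn_remove[OF a] s)
  then show ?thesis by (simp only: gen[OF e] dmonom_fn_def)
qed

text \<open>All pairwise products of terms represent the product of the two polynomials, and the
  Leibniz rule for monomials, summed over the pairs, gives the product rule for this
  representation.\<close>

lemma has_pd_mult:
  assumes a: "a \<in> I" and f: "has_pd a f f'" and g: "has_pd a g g'"
  shows "has_pd a (\<lambda>\<omega>. f \<omega> * g \<omega>) (\<lambda>\<omega>. f' \<omega> * g \<omega> + f \<omega> * g' \<omega>)"
proof -
  obtain L where L: "f = (\<lambda>\<omega>. \<Sum>(c, k)\<leftarrow>L. c * monom_fn k \<omega>)"
    "f' = (\<lambda>\<omega>. \<Sum>(c, k)\<leftarrow>L. c * dmonom_fn a k \<omega>)"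
    using f unfolding has_pd_def by blast
  obtain L' where L': "g = (\<lambda>\<omega>. \<Sum>(c, k)\<leftarrow>L'. c * monom_fn k \<omega>)"
    "g' = (\<lambda>\<omega>. \<Sum>(c, k)\<leftarrow>L'. c * dmonom_fn a k \<omega>)"
    using g unfolding has_pd_def by blast
  define P where "P = concat (map (\<lambda>(c, k). map (\<lambda>(c', k'). (c * c', \<lambda>b. k b + k' b)) L') L)"
  have 1: "(\<Sum>(c, k)\<leftarrow>L. c * monom_fn k \<omega>) * (\<Sum>(c, k)\<leftarrow>L'. c * monom_fn k \<omega>) =
      (\<Sum>(c, k)\<leftarrow>P. c * monom_fn k \<omega>)" for \<omega>
    unfolding P_def
  proof (induction L)
    case (Cons p L)
    obtain c k where p: "p = (c, k)" by force
    have "c * monom_fn k \<omega> * (\<Sum>(c, k)\<leftarrow>L'. c * monom_fn k \<omega>) =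
      (\<Sum>(c, k)\<leftarrow>map (\<lambda>(c', k'). (c * c', \<lambda>b. k b + k' b)) L'. c * monom_fn k \<omega>)"
      by (induction L') (auto simp: algebra_simps monom_fn_mult[symmetric])
    then show ?case using Cons by (simp add: p algebra_simps)
  qed simp
  have 2: "(\<Sum>(c, k)\<leftarrow>L. c * dmonom_fn a k \<omega>) * (\<Sum>(c, k)\<leftarrow>L'. c * monom_fn k \<omega>) +
      (\<Sum>(c, k)\<leftarrow>L. c * monom_fn k \<omega>) * (\<Sum>(c, k)\<leftarrow>L'. c * dmonom_fn a k \<omega>) =
      (\<Sum>(c, k)\<leftarrow>P. c * dmonom_fn a k \<omega>)" for \<omega>
    unfolding P_def
  proof (induction L)
    case (Cons p L)
    obtain c k where p: "p = (c, k)" by force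
    have "c * dmonom_fn a k \<omega> * (\<Sum>(c, k)\<leftarrow>L'. c * monom_fn k \<omega>) +
      c * monom_fn k \<omega> * (\<Sum>(c, k)\<leftarrow>L'. c * dmonom_fn a k \<omega>) =
      (\<Sum>(c, k)\<leftarrow>map (\<lambda>(c', k'). (c * c', \<lambda>b. k b + k' b)) L'. c * dmonom_fn a k \<omega>)"
    proof (induction L')
      case (Cons q L')
      obtain c' l where q: "q = (c', l)" by force
      show ?case using Cons by (simp add: q monom_fn_leibniz[OF a] algebra_simps)
    qed simp
    then show ?case using Cons by (simp add: p algebra_simps)
  qed simp
  show ?thesis unfolding has_pd_def L L'
    by (rule exI[of _ P]) (simp only: 1 2 simp_thms)
qed

lemma has_pd_cmult: "has_pd a f f' \<Longrightarrow> has_pd a (\<lambda>\<omega>. c * f \<omega>) (\<lambda>\<omega>. c * f' \<omega>)"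
  unfolding has_pd_def
proof (elim exE conjE)
  fix L assume h: "f = (\<lambda>\<omega>. \<Sum>(c, k)\<leftarrow>L. c * monom_fn k \<omega>)"
   "f' = (\<lambda>\<omega>. \<Sum>(c, k)\<leftarrow>L. c * dmonom_fn a k \<omega>)"
  show "\<exists>L. (\<lambda>\<omega>. c * f \<omega>) = (\<lambda>\<omega>. \<Sum>(c, k)\<leftarrow>L. c * monom_fn k \<omega>) \<and>
     (\<lambda>\<omega>. c * f' \<omega>) = (\<lambda>\<omega>. \<Sum>(c, k)\<leftarrow>L. c * dmonom_fn a k \<omega>)"
    unfolding h
    by (rule exI[of _ "map (\<lambda>(c', k). (c * c', k)) L"], induction L)
      (auto simp: fun_eq_iff algebra_simps)
qed

lemma has_pd_sum:
  "(\<And>s. s \<in> S \<Longrightarrow> has_pd a (f s) (f' s)) \<Longrightarrow> has_pd a (\<lambda>\<omega>. \<Sum>s\<in>S. f s \<omega>) (\<lambda>\<omega>. \<Sum>s\<in>S. f' s \<omega>)"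
  by (induction S rule: infinite_finite_induct) (auto intro: has_pd_const has_pd_add)

lemma has_pd_cong: "has_pd a f f' \<Longrightarrow> (\<And>\<omega>. f \<omega> = g \<omega>) \<Longrightarrow> (\<And>\<omega>. f' \<omega> = g' \<omega>) \<Longrightarrow> has_pd a g g'"
  by (metis ext)

lemma integrable_sum_list_monom:
  "(\<And>c k. integrable M (F c k)) \<Longrightarrow> integrable M (\<lambda>\<omega>. \<Sum>(c, k)\<leftarrow>L. F c k \<omega>)"
  by (induction L) auto

lemma has_pd_integrable: "has_pd a f f' \<Longrightarrow> integrable M f" "has_pd a f f' \<Longrightarrow> integrable M f'"
  unfolding has_pd_def using integrable_monom_fn integrable_dmonom_fn
  by (auto intro!: integrable_sum_list_monom)

text \<open>By linearity it suffices to treat a monomial. There independence factors the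
  expectation, and only the factor of the variable \<open>z a\<close> changes, by
  \<open>gauss_moment_Suc\<close>.\<close>

lemma gaussian_ibp:
  assumes a: "a \<in> I" and "has_pd a f f'"
  shows "integrable M (\<lambda>\<omega>. z a \<omega> * f \<omega>)" "expectation (\<lambda>\<omega>. z a \<omega> * f \<omega>) = expectation f'"
proof -
  obtain L where L: "f = (\<lambda>\<omega>. \<Sum>(c, k)\<leftarrow>L. c * monom_fn k \<omega>)"
    "f' = (\<lambda>\<omega>. \<Sum>(c, k)\<leftarrow>L. c * dmonom_fn a k \<omega>)"
    using assms unfolding has_pd_def by blast
  have i: "integrable M (\<lambda>\<omega>. z a \<omega> * monom_fn k \<omega>)" for k
    unfolding z_mult_monom_fn[OF a] by (rule integrable_monom_fn)
  have eq: "z a \<omega> * f \<omega> = (\<Sum>(c, k)\<leftarrow>L. c * (z a \<omega> * monom_fn k \<omega>))" for \<omega>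
    unfolding L by (induction L) (auto simp: algebra_simps)
  show 1: "integrable M (\<lambda>\<omega>. z a \<omega> * f \<omega>)" unfolding eq
    by (intro integrable_sum_list_monom) (auto intro: i)
  show "expectation (\<lambda>\<omega>. z a \<omega> * f \<omega>) = expectation f'" unfolding eq L(2)
  proof (induction L)
    case (Cons p L)
    obtain c k where p: "p = (c, k)" by force
    have "integrable M (\<lambda>\<omega>. \<Sum>(c, k)\<leftarrow>L. c * (z a \<omega> * monom_fn k \<omega>))"
      "integrable M (\<lambda>\<omega>. \<Sum>(c, k)\<leftarrow>L. c * dmonom_fn a k \<omega>)"
      using i integrable_dmonom_fn by (auto intro!: integrable_sum_list_monom)
    with Cons show ?case
      using i[of k] integrable_dmonom_fn expectation_z_mult_monom_fn[OF a, of k] by (simp add: p)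
  qed simp
qed

end

section \<open>Words in centered Gram matrices\<close>

text \<open>
  The letter \<open>m\<close> of a word stands for the matrix \<open>(Z D\<^sup>m Z\<^sup>T - tr(D\<^sup>m) I) / sqrt(n |J|)\<close>, where \<open>Z\<close> has
  rows \<open>{..<n}\<close> and columns \<open>J\<close>, and \<open>D = diag(d)\<close>.
\<close>
definition letter_ent :: "nat \<Rightarrow> 'c set \<Rightarrow> ('c \<Rightarrow> real) \<Rightarrow> (nat \<Rightarrow> 'c \<Rightarrow> real) \<Rightarrow> nat \<Rightarrow> nat \<Rightarrow> nat \<Rightarrow> real" where
  "letter_ent n J d Z m p l = ((\<Sum>j\<in>J. d j ^ m * (Z p j * Z l j)) - (if p = l then \<Sum>j\<in>J. d j ^ m else 0)) /
     sqrt (real n * real (card J))"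

fun word_ent :: "nat \<Rightarrow> 'c set \<Rightarrow> ('c \<Rightarrow> real) \<Rightarrow> (nat \<Rightarrow> 'c \<Rightarrow> real) \<Rightarrow> nat list \<Rightarrow> nat \<Rightarrow> nat \<Rightarrow> real" where
  "word_ent n J d Z [] p l = (if p = l then 1 else 0)"
| "word_ent n J d Z (m # w) p l = (\<Sum>q<n. letter_ent n J d Z m p q * word_ent n J d Z w q l)"

definition word_tr :: "nat \<Rightarrow> 'c set \<Rightarrow> ('c \<Rightarrow> real) \<Rightarrow> (nat \<Rightarrow> 'c \<Rightarrow> real) \<Rightarrow> nat list \<Rightarrow> real" where
  "word_tr n J d Z w = (\<Sum>p<n. word_ent n J d Z w p p) / real n"

text \<open>This is the row \<open>z\<^sub>j\<^sup>T W\<close>, with \<open>z\<^sub>j\<close> the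
  column \<open>j\<close> of \<open>Z\<close> and \<open>W\<close> the product of the word.
  Differentiating a letter in an entry of column \<open>j\<close> replaces it by a matrix built from
  \<open>z\<^sub>j\<close> and a unit vector, so derivatives of words are made of word entries and
  such rows.\<close>

definition col_word :: "nat \<Rightarrow> 'c set \<Rightarrow> ('c \<Rightarrow> real) \<Rightarrow> (nat \<Rightarrow> 'c \<Rightarrow> real) \<Rightarrow> nat list \<Rightarrow> 'c \<Rightarrow> nat \<Rightarrow> real" where
  "col_word n J d Z w j p = (\<Sum>q<n. Z q j * word_ent n J d Z w q p)"

lemma sum_rotate:
  "(\<Sum>i\<in>A. \<Sum>j\<in>B. \<Sum>k\<in>C. f i j k) = (\<Sum>k\<in>C. \<Sum>i\<in>A. \<Sum>j\<in>B. f i j k)"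
  by (subst sum.swap[of _ C B]) (rule sum.swap)

lemma letter_ent_sym: "letter_ent n J d Z m p l = letter_ent n J d Z m l p"
  unfolding letter_ent_def by (simp add: mult.commute)

lemma sum_delta_lessThan:
  fixes f :: "nat \<Rightarrow> real"
  assumes "p < n"
  shows "(\<Sum>q<n. (if p = q then 1 else 0) * f q) = f p" "(\<Sum>q<n. f q * (if q = p then 1 else 0)) = f p"
    "(\<Sum>q<n. (if q = p then 1 else 0) * f q) = f p" "(\<Sum>q<n. f q * (if p = q then 1 else 0)) = f p"
  using assms by (simp_all add: if_distrib[of "\<lambda>x. _ * x"] if_distrib[of "\<lambda>x. x * _"] cong: if_cong)

context
  fixes n :: nat and J :: "'c set" and d :: "'c \<Rightarrow> real" and Z :: "nat \<Rightarrow> 'c \<Rightarrow> real"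
begin

private abbreviation "W \<equiv> word_ent n J d Z"
private abbreviation "cw \<equiv> col_word n J d Z"

lemma word_ent_append:
  "p < n \<Longrightarrow> l < n \<Longrightarrow> W (u @ v) p l = (\<Sum>q<n. W u p q * W v q l)"
proof (induction u arbitrary: p)
  case Nil
  then show ?case by (simp add: sum_delta_lessThan)
next
  case (Cons m u)
  have "W ((m # u) @ v) p l = (\<Sum>q<n. letter_ent n J d Z m p q * (\<Sum>r<n. W u q r * W v r l))"
    using Cons by simp
  also have "\<dots> = (\<Sum>r<n. \<Sum>q<n. letter_ent n J d Z m p q * W u q r * W v r l)"
    unfolding sum_distrib_left by (subst sum.swap) (simp add: mult.assoc)
  finally show ?case by (simp add: sum_distrib_right)
qed

text \<open>Letters are symmetric matrices, so transposing a product reverses the word.\<close>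

lemma word_ent_rev: "p < n \<Longrightarrow> l < n \<Longrightarrow> W (rev w) p l = W w l p"
proof (induction w arbitrary: p l)
  case (Cons m w)
  have "W (rev (m # w)) p l = (\<Sum>q<n. W (rev w) p q * W [m] q l)"
    using Cons.prems by (simp add: word_ent_append del: word_ent.simps(2))
  also have "\<dots> = (\<Sum>q<n. W w q p * letter_ent n J d Z m l q)"
    using Cons by (intro sum.cong) (auto simp: sum_delta_lessThan letter_ent_sym)
  finally show ?case by (simp add: mult.commute)
qed simp

lemma sum_word_ent_word_ent:
  assumes "p < n" "l < n"
  shows "(\<Sum>q<n. W u p q * W v l q) = W (u @ rev v) p l"
  using assms by (simp add: word_ent_append word_ent_rev)

lemma col_word_Nil: "p < n \<Longrightarrow> cw [] j p = Z p j"
  unfolding col_word_def by (simp add: sum_delta_lessThan)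

lemma sum_col_word_word_ent:
  assumes "p < n"
  shows "(\<Sum>q<n. cw v j q * W u q p) = cw (v @ u) j p"
proof -
  have "(\<Sum>q<n. cw v j q * W u q p) = (\<Sum>q<n. \<Sum>r<n. Z r j * W v r q * W u q p)"
    unfolding col_word_def sum_distrib_right ..
  also have "\<dots> = (\<Sum>r<n. \<Sum>q<n. Z r j * W v r q * W u q p)" by (rule sum.swap)
  also have "\<dots> = cw (v @ u) j p"
    unfolding col_word_def using assms
    by (intro sum.cong) (auto simp: word_ent_append sum_distrib_left mult.assoc)
  finally show ?thesis .
qed

lemma sum_gram:
  assumes "finite J" "J \<noteq> {}" "n > 0"
  shows "(\<Sum>j\<in>J. d j ^ m * (Z p j * Z l j)) =
    sqrt (real n * real (card J)) * letter_ent n J d Z m p l + (if p = l then \<Sum>j\<in>J. d j ^ m else 0)"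
proof -
  have "card J > 0" using assms by (simp add: card_gt_0_iff)
  then have "sqrt (real n * real (card J)) \<noteq> 0" using assms by simp
  then show ?thesis unfolding letter_ent_def by simp
qed

text \<open>The weighted sum over columns rebuilds \<open>Z D\<^sup>m Z\<^sup>T\<close>, which is a
  scaled letter plus a multiple of the identity. Thus the products of two rows that integration by
  parts leaves behind become traces of words again.\<close>

lemma sum_col_word_col_word:
  assumes "finite J" "J \<noteq> {}" "n > 0"
  shows "(\<Sum>j\<in>J. d j ^ m * (\<Sum>p<n. cw w j p * cw y j p)) =
    real n * (sqrt (real n * real (card J)) * word_tr n J d Z (m # w @ rev y) +
      (\<Sum>j\<in>J. d j ^ m) * word_tr n J d Z (w @ rev y))"
proof -
  let ?x = "w @ rev y" and ?s = "sqrt (real n * real (card J))" and ?t = "\<Sum>j\<in>J. d j ^ m"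
  have "(\<Sum>p<n. cw w j p * cw y j p) = (\<Sum>q<n. \<Sum>r<n. Z q j * Z r j * W ?x q r)" for j
  proof -
    have "(\<Sum>p<n. cw w j p * cw y j p) = (\<Sum>p<n. \<Sum>q<n. \<Sum>r<n. Z q j * Z r j * (W w q p * W y r p))"
      unfolding col_word_def sum_product by (intro sum.cong) (auto simp: algebra_simps)
    also have "\<dots> = (\<Sum>q<n. \<Sum>r<n. \<Sum>p<n. Z q j * Z r j * (W w q p * W y r p))"
      by (rule sum_rotate[symmetric])
    also have "\<dots> = (\<Sum>q<n. \<Sum>r<n. Z q j * Z r j * W ?x q r)"
      by (intro sum.cong) (auto simp: sum_word_ent_word_ent simp flip: sum_distrib_left)
    finally show ?thesis .
  qed
  then have "(\<Sum>j\<in>J. d j ^ m * (\<Sum>p<n. cw w j p * cw y j p)) =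
      (\<Sum>j\<in>J. \<Sum>q<n. \<Sum>r<n. d j ^ m * (Z q j * Z r j) * W ?x q r)"
    by (simp add: sum_distrib_left mult.assoc)
  also have "\<dots> = (\<Sum>q<n. \<Sum>r<n. \<Sum>j\<in>J. d j ^ m * (Z q j * Z r j) * W ?x q r)"
    by (rule sum_rotate[symmetric])
  also have "\<dots> = (\<Sum>q<n. \<Sum>r<n. (?s * letter_ent n J d Z m q r + (if q = r then ?t else 0)) * W ?x q r)"
    by (simp add: sum_gram[OF assms] flip: sum_distrib_right)
  also have "\<dots> = (\<Sum>q<n. ?s * (\<Sum>r<n. letter_ent n J d Z m r q * W ?x q r)) + ?t * (\<Sum>q<n. W ?x q q)"
    by (simp add: distrib_right sum.distrib sum_distrib_left letter_ent_sym[of n J d Z m] mult.assoc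
        if_distrib[of "\<lambda>x. x * _"] cong: if_cong)
  also have "(\<Sum>q<n. ?s * (\<Sum>r<n. letter_ent n J d Z m r q * W ?x q r)) = ?s * (\<Sum>r<n. W (m # ?x) r r)"
    by (simp add: sum_distrib_left) (rule sum.swap)
  finally show ?thesis using assms by (simp add: word_tr_def algebra_simps)
qed

end

section \<open>Moments of traces by Gaussian integration by parts\<close>

text \<open>Bookkeeping for the product rule on a word: the differentiated letter is either the head
  or lies in the tail, and in the second case the prefix before it gains the head.\<close>

lemma sum_length_Cons:
  fixes f :: "nat list \<Rightarrow> nat \<Rightarrow> nat list \<Rightarrow> real"
  shows "(\<Sum>t<length (m # w). f (take t (m # w)) ((m # w) ! t) (drop (Suc t) (m # w))) =
    f [] m w + (\<Sum>t<length w. f (m # take t w) (w ! t) (drop (Suc t) w))"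
  unfolding length_Cons sum.lessThan_Suc_shift by simp

text \<open>
  One integration by parts in the first letter \<open>m\<close> of the word \<open>m # w\<close>. It is paired with letter \<open>t\<close> of \<open>w\<close>
  (first sum) or with letter \<open>t\<close> of the word \<open>ws ! k\<close> (second sum), and each pair of letters \<open>m\<close>, \<open>l\<close> leaves
  a factor \<open>Z D\<^sup>m\<^sup>+\<^sup>l Z\<^sup>T\<close> in front of a word; \<open>H (m + l)\<close> evaluates the result. The two terms per pair come from
  the two summands in the derivative of \<open>Z D\<^sup>l Z\<^sup>T\<close>.
\<close>
definition contraction :: "(nat \<Rightarrow> nat list \<Rightarrow> nat list list \<Rightarrow> real) \<Rightarrow> real \<Rightarrow> nat \<Rightarrow> nat list \<Rightarrow> nat list list \<Rightarrow> real" where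
  "contraction H N m w ws =
    (\<Sum>t<length w. 1 / N * H (m + w ! t) (take t w @ rev (drop (Suc t) w)) ws +
        H (m + w ! t) (take t w) (drop (Suc t) w # ws)) +
    1 / N\<^sup>2 * (\<Sum>k<length ws. \<Sum>t<length (ws ! k).
       H (m + ws ! k ! t) (w @ rev (drop (Suc t) (ws ! k) @ take t (ws ! k))) (take k ws @ drop (Suc k) ws) +
       H (m + ws ! k ! t) (w @ drop (Suc t) (ws ! k) @ take t (ws ! k)) (take k ws @ drop (Suc k) ws))"

locale gaussian_matrix = prob_space M for M :: "'w measure" +
  fixes n :: nat and J :: "'c set" and z :: "nat \<Rightarrow> 'c \<Rightarrow> 'w \<Rightarrow> real" and d :: "'c \<Rightarrow> real"
  assumes n_pos: "n > 0" and finite_J: "finite J" and J_nonempty: "J \<noteq> {}"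
    and indep_entries: "indep_vars (\<lambda>_. borel) (\<lambda>(p, j). z p j) ({..<n} \<times> J)"
    and std_normal_entries: "\<And>p j. p < n \<Longrightarrow> j \<in> J \<Longrightarrow> distributed M lborel (z p j) std_normal_density"
begin

sublocale gaussian_family M "{..<n} \<times> J" "\<lambda>(p, j). z p j"
  by unfold_locales (use finite_J indep_entries std_normal_entries in auto)

definition Zm :: "'w \<Rightarrow> nat \<Rightarrow> 'c \<Rightarrow> real" where "Zm \<omega> p j = z p j \<omega>"

definition cN :: real where "cN = 1 / sqrt (real n * real (card J))"

abbreviation "We \<omega> \<equiv> word_ent n J d (Zm \<omega>)"
abbreviation "CW \<omega> \<equiv> col_word n J d (Zm \<omega>)"
abbreviation "Tr \<omega> \<equiv> word_tr n J d (Zm \<omega>)"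

section \<open>Partial derivatives of letters, words and traces\<close>

lemma has_pd_entry:
  "i < n \<Longrightarrow> j \<in> J \<Longrightarrow> q < n \<Longrightarrow> l \<in> J \<Longrightarrow>
    has_pd (i, j) (\<lambda>\<omega>. Zm \<omega> q l) (\<lambda>_. if i = q \<and> j = l then 1 else 0)"
  using has_pd_var[of "(q, l)" "(i, j)"] by (simp add: Zm_def)

text \<open>Only column \<open>j\<close> depends on the entry \<open>(i, j)\<close>, and the
  subtracted trace is constant. What remains is the \<open>(p, q)\<close> entry of
  \<open>e\<^sub>i z\<^sub>j\<^sup>T + z\<^sub>j e\<^sub>i\<^sup>T\<close>, up to scale.\<close>

lemma has_pd_letter_ent:
  assumes ij: "i < n" "j \<in> J" and "p < n" "q < n"
  shows "has_pd (i, j) (\<lambda>\<omega>. letter_ent n J d (Zm \<omega>) m p q)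
    (\<lambda>\<omega>. cN * d j ^ m * ((if i = p then 1 else 0) * Zm \<omega> q j + Zm \<omega> p j * (if i = q then 1 else 0)))"
proof -
  let ?\<delta> = "\<lambda>p l. if i = p \<and> j = l then 1 else (0::real)"
  have "has_pd (i, j) (\<lambda>\<omega>. cN * ((\<Sum>l\<in>J. d l ^ m * (Zm \<omega> p l * Zm \<omega> q l)) + - (if p = q then \<Sum>l\<in>J. d l ^ m else 0)))
    (\<lambda>\<omega>. cN * ((\<Sum>l\<in>J. d l ^ m * (?\<delta> p l * Zm \<omega> q l + Zm \<omega> p l * ?\<delta> q l)) + 0))"
    using assms by (intro has_pd_cmult has_pd_add has_pd_const has_pd_sum has_pd_mult has_pd_entry) auto
  then show ?thesis
  proof (rule has_pd_cong, goal_cases)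
    case (1 \<omega>)
    show ?case by (simp add: letter_ent_def cN_def)
  next
    case (2 \<omega>)
    have "(\<Sum>l\<in>J. d l ^ m * (?\<delta> p l * Zm \<omega> q l + Zm \<omega> p l * ?\<delta> q l)) =
      (\<Sum>l\<in>J. if j = l then d l ^ m * ((if i = p then 1 else 0) * Zm \<omega> q l + Zm \<omega> p l * (if i = q then 1 else 0)) else 0)"
      by (rule sum.cong) auto
    also have "\<dots> = d j ^ m * ((if i = p then 1 else 0) * Zm \<omega> q j + Zm \<omega> p j * (if i = q then 1 else 0))"
      using ij finite_J by simp
    finally show ?case by simp
  qed
qed

text \<open>Differentiating letter \<open>t\<close> cuts the word into \<open>take t w\<close> and
  \<open>drop (Suc t) w\<close>, and each of the two rank-one summands of the differentiated letter
  splits the entry into a product. The prefix acts on a column vector in the second one, hence its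
  reversal.\<close>

lemma has_pd_word_ent:
  assumes ij: "i < n" "j \<in> J" and "p < n" "l < n"
  shows "has_pd (i, j) (\<lambda>\<omega>. We \<omega> w p l)
    (\<lambda>\<omega>. cN * (\<Sum>t<length w. d j ^ (w ! t) * (We \<omega> (take t w) p i * CW \<omega> (drop (Suc t) w) j l +
       CW \<omega> (rev (take t w)) j p * We \<omega> (drop (Suc t) w) i l)))"
  using assms(3)
proof (induction w arbitrary: p)
  case Nil
  show ?case using has_pd_const[of "(i, j)" "if p = l then 1 else 0"] by simp
next
  case (Cons m w)
  let ?D = "\<lambda>\<omega> q. cN * (\<Sum>t<length w. d j ^ (w ! t) * (We \<omega> (take t w) q i * CW \<omega> (drop (Suc t) w) j l +
       CW \<omega> (rev (take t w)) j q * We \<omega> (drop (Suc t) w) i l))"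
  let ?K = "\<lambda>\<omega> q. cN * d j ^ m * ((if i = p then 1 else 0) * Zm \<omega> q j + Zm \<omega> p j * (if i = q then 1 else 0))"
  have "has_pd (i, j) (\<lambda>\<omega>. \<Sum>q<n. letter_ent n J d (Zm \<omega>) m p q * We \<omega> w q l)
    (\<lambda>\<omega>. \<Sum>q<n. ?K \<omega> q * We \<omega> w q l + letter_ent n J d (Zm \<omega>) m p q * ?D \<omega> q)"
    using Cons ij by (intro has_pd_sum has_pd_mult has_pd_letter_ent) auto
  then show ?case
  proof (rule has_pd_cong, goal_cases)
    case (2 \<omega>)
    have A: "(\<Sum>q<n. ?K \<omega> q * We \<omega> w q l) = cN * (d j ^ m * (We \<omega> [] p i * CW \<omega> w j l + CW \<omega> (rev []) j p * We \<omega> w i l))"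
    proof -
      have "(\<Sum>q<n. ?K \<omega> q * We \<omega> w q l) =
          (\<Sum>q<n. cN * d j ^ m * (if i = p then 1 else 0) * (Zm \<omega> q j * We \<omega> w q l) +
            cN * d j ^ m * Zm \<omega> p j * ((if i = q then 1 else 0) * We \<omega> w q l))"
        by (intro sum.cong) (auto simp: algebra_simps)
      also have "\<dots> = cN * d j ^ m * (if i = p then 1 else 0) * CW \<omega> w j l + cN * d j ^ m * Zm \<omega> p j * We \<omega> w i l"
        unfolding sum.distrib sum_distrib_left[symmetric] using ij
        by (simp add: sum_delta_lessThan col_word_def)
      finally show ?thesis using Cons.prems by (simp add: col_word_Nil algebra_simps)
    qed
    \<comment> \<open>By symmetry of the letter, multiplying from the left appends it at the end of
      the reversed prefix.\<close>
    have B: "(\<Sum>q<n. letter_ent n J d (Zm \<omega>) m p q * CW \<omega> (rev u) j q) = CW \<omega> (rev (m # u)) j p" for u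
    proof -
      have "(\<Sum>q<n. letter_ent n J d (Zm \<omega>) m p q * CW \<omega> (rev u) j q) = (\<Sum>q<n. CW \<omega> (rev u) j q * We \<omega> [m] q p)"
        using Cons.prems by (intro sum.cong) (auto simp: sum_delta_lessThan letter_ent_sym)
      also have "\<dots> = CW \<omega> (rev u @ [m]) j p" using Cons.prems by (rule sum_col_word_word_ent)
      finally show ?thesis by simp
    qed
    have "(\<Sum>q<n. letter_ent n J d (Zm \<omega>) m p q * ?D \<omega> q) =
      (\<Sum>q<n. \<Sum>t<length w. cN * (d j ^ (w ! t) * ((letter_ent n J d (Zm \<omega>) m p q * We \<omega> (take t w) q i) * CW \<omega> (drop (Suc t) w) j l +
       (letter_ent n J d (Zm \<omega>) m p q * CW \<omega> (rev (take t w)) j q) * We \<omega> (drop (Suc t) w) i l)))"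
      unfolding sum_distrib_left by (intro sum.cong) (auto simp: algebra_simps)
    also have "\<dots> = (\<Sum>t<length w. cN * (d j ^ (w ! t) * (We \<omega> (m # take t w) p i * CW \<omega> (drop (Suc t) w) j l +
       CW \<omega> (rev (m # take t w)) j p * We \<omega> (drop (Suc t) w) i l)))"
      unfolding B[symmetric]
      by (subst sum.swap) (simp add: sum.distrib sum_distrib_right flip: sum_distrib_left)
    finally have C: "(\<Sum>q<n. letter_ent n J d (Zm \<omega>) m p q * ?D \<omega> q) = \<dots>" .
    show ?case unfolding sum.distrib A C
      using sum_length_Cons[of "\<lambda>u m v. d j ^ m * (We \<omega> u p i * CW \<omega> v j l + CW \<omega> (rev u) j p * We \<omega> v i l)" m w]
      by (simp add: sum_distrib_left distrib_left)
  qed simp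
qed

text \<open>Under a trace the cut word closes up cyclically: what follows letter \<open>t\<close> is
  joined to what precedes it. The two summands of the differentiated letter give this rotated word
  and its reversal.\<close>

definition dTr :: "nat \<Rightarrow> 'c \<Rightarrow> nat list \<Rightarrow> 'w \<Rightarrow> real" where
  "dTr i j w \<omega> = cN / real n * (\<Sum>t<length w. d j ^ (w ! t) *
     (CW \<omega> (drop (Suc t) w @ take t w) j i + CW \<omega> (rev (drop (Suc t) w @ take t w)) j i))"

lemma has_pd_word_tr:
  assumes ij: "i < n" "j \<in> J"
  shows "has_pd (i, j) (\<lambda>\<omega>. Tr \<omega> w) (dTr i j w)"
proof -
  have "has_pd (i, j) (\<lambda>\<omega>. 1 / real n * (\<Sum>p<n. We \<omega> w p p))
    (\<lambda>\<omega>. 1 / real n * (\<Sum>p<n. cN * (\<Sum>t<length w. d j ^ (w ! t) * (We \<omega> (take t w) p i * CW \<omega> (drop (Suc t) w) j p +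
       CW \<omega> (rev (take t w)) j p * We \<omega> (drop (Suc t) w) i p))))"
    using ij by (intro has_pd_cmult has_pd_sum has_pd_word_ent) auto
  then show ?thesis
  proof (rule has_pd_cong, goal_cases)
    case (2 \<omega>)
    have 1: "(\<Sum>p<n. We \<omega> u p i * CW \<omega> v j p) = CW \<omega> (v @ u) j i" for u v
      using sum_col_word_word_ent[OF ij(1)] by (simp add: mult.commute)
    have 2: "(\<Sum>p<n. CW \<omega> (rev u) j p * We \<omega> v i p) = CW \<omega> (rev (v @ u)) j i" for u v
    proof -
      have "(\<Sum>p<n. CW \<omega> (rev u) j p * We \<omega> v i p) = (\<Sum>p<n. CW \<omega> (rev u) j p * We \<omega> (rev v) p i)"
        using ij by (intro sum.cong) (auto simp: word_ent_rev)
      then show ?thesis using sum_col_word_word_ent[OF ij(1)] by simp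
    qed
    have "(\<Sum>p<n. cN * (\<Sum>t<length w. d j ^ (w ! t) * (We \<omega> (take t w) p i * CW \<omega> (drop (Suc t) w) j p +
       CW \<omega> (rev (take t w)) j p * We \<omega> (drop (Suc t) w) i p))) =
      cN * (\<Sum>t<length w. \<Sum>p<n. d j ^ (w ! t) * (We \<omega> (take t w) p i * CW \<omega> (drop (Suc t) w) j p +
       CW \<omega> (rev (take t w)) j p * We \<omega> (drop (Suc t) w) i p))"
      unfolding sum_distrib_left by (rule sum.swap)
    also have "\<dots> = cN * (\<Sum>t<length w. d j ^ (w ! t) *
     (CW \<omega> (drop (Suc t) w @ take t w) j i + CW \<omega> (rev (drop (Suc t) w @ take t w)) j i))"
      unfolding sum_distrib_left[symmetric] sum.distrib 1 2 ..
    finally show ?case by (simp add: dTr_def)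
  qed (simp add: word_tr_def)
qed

definition PTr :: "nat list list \<Rightarrow> 'w \<Rightarrow> real" where
  "PTr ws \<omega> = (\<Prod>w\<leftarrow>ws. Tr \<omega> w)"

lemma PTr_simps [simp]: "PTr [] \<omega> = 1" "PTr (w # ws) \<omega> = Tr \<omega> w * PTr ws \<omega>"
  "PTr (ws @ vs) \<omega> = PTr ws \<omega> * PTr vs \<omega>"
  by (simp_all add: PTr_def)

lemma has_pd_PTr:
  assumes ij: "i < n" "j \<in> J"
  shows "has_pd (i, j) (PTr ws)
    (\<lambda>\<omega>. \<Sum>k<length ws. dTr i j (ws ! k) \<omega> * PTr (take k ws @ drop (Suc k) ws) \<omega>)"
proof (induction ws)
  case Nil
  show ?case using has_pd_const[of "(i, j)" 1] by (simp add: PTr_def)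
next
  case (Cons w ws)
  have "has_pd (i, j) (\<lambda>\<omega>. Tr \<omega> w * PTr ws \<omega>)
    (\<lambda>\<omega>. dTr i j w \<omega> * PTr ws \<omega> + Tr \<omega> w * (\<Sum>k<length ws. dTr i j (ws ! k) \<omega> * PTr (take k ws @ drop (Suc k) ws) \<omega>))"
    using ij by (intro has_pd_mult has_pd_word_tr Cons) auto
  then show ?case
    by (rule has_pd_cong, simp, unfold length_Cons sum.lessThan_Suc_shift)
      (simp add: sum_distrib_left algebra_simps)
qed

lemma integrable_PTr: "integrable M (PTr ws)"
proof -
  obtain j where "j \<in> J" using J_nonempty by auto
  then show ?thesis using has_pd_PTr[of 0 j ws] n_pos has_pd_integrable(1) by blast
qed

section \<open>Integration by parts in the first letter of a trace\<close>

text \<open>These are the coefficients in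
  \<open>(1/|J|) Z D\<^sup>m Z\<^sup>T = eps K\<^sub>m + tau m I\<close>: the size of the
  fluctuation and the mean.\<close>

definition eps :: real where "eps = sqrt (real n / real (card J))"
definition tau :: "nat \<Rightarrow> real" where "tau m = (\<Sum>j\<in>J. d j ^ m) / real (card J)"
text \<open>The normalized trace of \<open>(1/|J|) Z D\<^sup>m Z\<^sup>T\<close> times the word \<open>x\<close>.\<close>
definition G :: "nat \<Rightarrow> nat list \<Rightarrow> 'w \<Rightarrow> real" where
  "G m x \<omega> = eps * Tr \<omega> (m # x) + tau m * Tr \<omega> x"

lemma card_J_pos: "real (card J) > 0"
  using finite_J J_nonempty by (simp add: card_gt_0_iff)

lemma cN_sq: "cN * cN * (real n * real (card J)) = 1"
  using n_pos card_J_pos by (simp add: cN_def)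

lemma sum_col_word_G:
  "(\<Sum>j\<in>J. d j ^ m * (\<Sum>p<n. CW \<omega> w j p * CW \<omega> y j p)) = real n * real (card J) * G m (w @ rev y) \<omega>"
proof -
  have "real (card J) * eps = sqrt (real n * real (card J))"
    unfolding eps_def using card_J_pos by (simp add: real_sqrt_divide real_sqrt_mult field_simps)
  then have e: "sqrt (real n * real (card J)) = real (card J) * eps" ..
  have t: "(\<Sum>j\<in>J. d j ^ m) = real (card J) * tau m" using card_J_pos by (simp add: tau_def)
  show ?thesis unfolding sum_col_word_col_word[OF finite_J J_nonempty n_pos] e t G_def
    by (simp add: algebra_simps)
qed

text \<open>The explicit factor \<open>Zm \<omega> i j\<close> in the row contributes
  \<open>We \<omega> w i i\<close>, the letters contribute the sum. The inner product over
  \<open>q\<close> is left unevaluated, since it becomes a trace only after summation over the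
  columns.\<close>

lemma has_pd_col_word:
  assumes ij: "i < n" "j \<in> J"
  shows "has_pd (i, j) (\<lambda>\<omega>. CW \<omega> w j i)
    (\<lambda>\<omega>. We \<omega> w i i + cN * (\<Sum>t<length w. d j ^ (w ! t) *
      (CW \<omega> (take t w) j i * CW \<omega> (drop (Suc t) w) j i +
       (\<Sum>q<n. CW \<omega> [] j q * CW \<omega> (rev (take t w)) j q) * We \<omega> (drop (Suc t) w) i i)))"
proof -
  let ?D = "\<lambda>\<omega> q. cN * (\<Sum>t<length w. d j ^ (w ! t) * (We \<omega> (take t w) q i * CW \<omega> (drop (Suc t) w) j i +
       CW \<omega> (rev (take t w)) j q * We \<omega> (drop (Suc t) w) i i))"
  have "has_pd (i, j) (\<lambda>\<omega>. \<Sum>q<n. Zm \<omega> q j * We \<omega> w q i)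
    (\<lambda>\<omega>. \<Sum>q<n. (if i = q \<and> j = j then 1 else 0) * We \<omega> w q i + Zm \<omega> q j * ?D \<omega> q)"
    using ij by (intro has_pd_sum has_pd_mult has_pd_entry has_pd_word_ent) auto
  then show ?thesis
  proof (rule has_pd_cong, goal_cases)
    case (2 \<omega>)
    have "(\<Sum>q<n. Zm \<omega> q j * ?D \<omega> q) =
      (\<Sum>q<n. \<Sum>t<length w. cN * (d j ^ (w ! t) * ((Zm \<omega> q j * We \<omega> (take t w) q i) * CW \<omega> (drop (Suc t) w) j i +
       (CW \<omega> [] j q * CW \<omega> (rev (take t w)) j q) * We \<omega> (drop (Suc t) w) i i)))"
      unfolding sum_distrib_left by (intro sum.cong) (auto simp: algebra_simps col_word_Nil)
    also have "\<dots> = cN * (\<Sum>t<length w. d j ^ (w ! t) *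
      (CW \<omega> (take t w) j i * CW \<omega> (drop (Suc t) w) j i +
       (\<Sum>q<n. CW \<omega> [] j q * CW \<omega> (rev (take t w)) j q) * We \<omega> (drop (Suc t) w) i i))"
      by (subst sum.swap) (simp add: sum.distrib sum_distrib_right col_word_def[of n J d "Zm \<omega>" "take _ w"] flip: sum_distrib_left)
    finally show ?case using ij by (simp add: sum.distrib sum_delta_lessThan)
  qed (simp add: col_word_def)
qed

text \<open>Writing out the first letter exposes the entry \<open>Zm \<omega> p j\<close> as an
  explicit factor for integration by parts; the subtracted product comes from the centering of that
  letter.\<close>

lemma word_tr_Cons:
  "Tr \<omega> (m # w) = cN / real n * ((\<Sum>j\<in>J. d j ^ m * (\<Sum>p<n. Zm \<omega> p j * CW \<omega> w j p)) -
     (\<Sum>j\<in>J. d j ^ m) * (\<Sum>p<n. We \<omega> w p p))"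
proof -
  have "(\<Sum>p<n. We \<omega> (m # w) p p) = (\<Sum>p<n. \<Sum>q<n. cN * ((\<Sum>j\<in>J. d j ^ m * (Zm \<omega> p j * Zm \<omega> q j)) * We \<omega> w q p
     - (if p = q then (\<Sum>j\<in>J. d j ^ m) * We \<omega> w p p else 0)))"
    unfolding word_ent.simps letter_ent_def cN_def by (intro sum.cong) (auto simp: algebra_simps diff_divide_distrib)
  also have "\<dots> = cN * ((\<Sum>p<n. \<Sum>q<n. \<Sum>j\<in>J. d j ^ m * (Zm \<omega> p j * (Zm \<omega> q j * We \<omega> w q p))) -
     (\<Sum>j\<in>J. d j ^ m) * (\<Sum>p<n. We \<omega> w p p))"
  proof -
    have "(\<Sum>p<n. \<Sum>q<n. cN * (F p q * We \<omega> w q p - (if p = q then T * We \<omega> w p p else 0))) =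
      cN * ((\<Sum>p<n. \<Sum>q<n. F p q * We \<omega> w q p) - T * (\<Sum>p<n. We \<omega> w p p))" for F T
      by (simp add: sum_subtractf flip: sum_distrib_left)
    from this[of "\<lambda>p q. \<Sum>j\<in>J. d j ^ m * (Zm \<omega> p j * Zm \<omega> q j)" "\<Sum>j\<in>J. d j ^ m"]
    show ?thesis by (simp only: sum_distrib_right mult.assoc)
  qed
  also have "(\<Sum>p<n. \<Sum>q<n. \<Sum>j\<in>J. d j ^ m * (Zm \<omega> p j * (Zm \<omega> q j * We \<omega> w q p))) =
      (\<Sum>j\<in>J. \<Sum>p<n. \<Sum>q<n. d j ^ m * (Zm \<omega> p j * (Zm \<omega> q j * We \<omega> w q p)))"
    by (rule sum_rotate)
  also have "\<dots> = (\<Sum>j\<in>J. d j ^ m * (\<Sum>p<n. Zm \<omega> p j * CW \<omega> w j p))"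
    unfolding col_word_def sum_distrib_left ..
  finally show ?thesis by (simp add: word_tr_def)
qed

definition dcol :: "nat \<Rightarrow> 'c \<Rightarrow> nat list \<Rightarrow> nat list list \<Rightarrow> 'w \<Rightarrow> real" where
  "dcol p j w ws \<omega> =
    (We \<omega> w p p + cN * (\<Sum>t<length w. d j ^ (w ! t) *
      (CW \<omega> (take t w) j p * CW \<omega> (drop (Suc t) w) j p +
       (\<Sum>q<n. CW \<omega> [] j q * CW \<omega> (rev (take t w)) j q) * We \<omega> (drop (Suc t) w) p p))) * PTr ws \<omega> +
    CW \<omega> w j p * (\<Sum>k<length ws. dTr p j (ws ! k) \<omega> * PTr (take k ws @ drop (Suc k) ws) \<omega>)"

lemma has_pd_dcol: "p < n \<Longrightarrow> j \<in> J \<Longrightarrow> has_pd (p, j) (\<lambda>\<omega>. CW \<omega> w j p * PTr ws \<omega>) (dcol p j w ws)"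
  using has_pd_mult[OF _ has_pd_col_word[of p j w] has_pd_PTr[of p j ws]] by (simp add: dcol_def[abs_def])

text \<open>The contributions \<open>We \<omega> w p p\<close> add up exactly to the centering term
  and cancel; this is the purpose of centering the letters. The remaining sums are turned into
  traces by \<open>sum_col_word_G\<close>: \<open>A\<close> collects the pairings inside the word,
  \<open>B'\<close> those with other words.\<close>

lemma sum_dcol:
  "cN / real n * ((\<Sum>j\<in>J. d j ^ m * (\<Sum>p<n. dcol p j w ws \<omega>)) - (\<Sum>j\<in>J. d j ^ m) * (\<Sum>p<n. We \<omega> w p p) * PTr ws \<omega>)
   = contraction (\<lambda>p x vs. G p x \<omega> * PTr vs \<omega>) (real n) m w ws"
proof -
  let ?N = "real n * real (card J)"
  have A: "(\<Sum>j\<in>J. d j ^ m * (\<Sum>p<n. cN * (\<Sum>t<length w. d j ^ (w ! t) *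
      (CW \<omega> (take t w) j p * CW \<omega> (drop (Suc t) w) j p +
       (\<Sum>q<n. CW \<omega> [] j q * CW \<omega> (rev (take t w)) j q) * We \<omega> (drop (Suc t) w) p p)))) =
    cN * ?N * (\<Sum>t<length w. G (m + w ! t) (take t w @ rev (drop (Suc t) w)) \<omega> +
        G (m + w ! t) (take t w) \<omega> * (real n * Tr \<omega> (drop (Suc t) w)))" (is "?L = _")
  proof -
    have "?L = (\<Sum>j\<in>J. \<Sum>p<n. \<Sum>t<length w. cN * (d j ^ (m + w ! t) *
      (CW \<omega> (take t w) j p * CW \<omega> (drop (Suc t) w) j p +
       (\<Sum>q<n. CW \<omega> [] j q * CW \<omega> (rev (take t w)) j q) * We \<omega> (drop (Suc t) w) p p)))"
      unfolding sum_distrib_left power_add by (intro sum.cong refl) (simp only: ac_simps)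
    also have "\<dots> = (\<Sum>t<length w. \<Sum>j\<in>J. \<Sum>p<n. cN * (d j ^ (m + w ! t) *
      (CW \<omega> (take t w) j p * CW \<omega> (drop (Suc t) w) j p +
       (\<Sum>q<n. CW \<omega> [] j q * CW \<omega> (rev (take t w)) j q) * We \<omega> (drop (Suc t) w) p p)))"
      by (rule sum_rotate)
    also have "\<dots> = (\<Sum>t<length w. cN * ((\<Sum>j\<in>J. d j ^ (m + w ! t) * (\<Sum>p<n.
      CW \<omega> (take t w) j p * CW \<omega> (drop (Suc t) w) j p)) +
       (\<Sum>j\<in>J. d j ^ (m + w ! t) * (\<Sum>q<n. CW \<omega> [] j q * CW \<omega> (rev (take t w)) j q)) * (\<Sum>p<n. We \<omega> (drop (Suc t) w) p p)))"
      by (intro sum.cong refl) (simp only: sum_distrib_left[symmetric] sum.distrib distrib_left, simp only: sum_distrib_right mult.assoc)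
    also have "\<dots> = (\<Sum>t<length w. cN * ?N * (G (m + w ! t) (take t w @ rev (drop (Suc t) w)) \<omega> +
        G (m + w ! t) (take t w) \<omega> * (real n * Tr \<omega> (drop (Suc t) w))))"
      unfolding sum_col_word_G using n_pos
      by (intro sum.cong refl) (simp add: word_tr_def algebra_simps)
    finally show ?thesis by (simp only: sum_distrib_left)
  qed
  have B: "(\<Sum>j\<in>J. d j ^ m * (\<Sum>p<n. CW \<omega> w j p * dTr p j v \<omega>)) =
    cN / real n * ?N * (\<Sum>t<length v.
       (G (m + v ! t) (w @ rev (drop (Suc t) v @ take t v)) \<omega> +
        G (m + v ! t) (w @ drop (Suc t) v @ take t v) \<omega>))" (is "?L = _") for v
  proof -
    let ?y = "\<lambda>t. drop (Suc t) v @ take t v"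
    have "?L = (\<Sum>j\<in>J. \<Sum>p<n. \<Sum>t<length v. cN / real n * (d j ^ (m + v ! t) *
      (CW \<omega> w j p * CW \<omega> (?y t) j p + CW \<omega> w j p * CW \<omega> (rev (?y t)) j p)))"
      unfolding sum_distrib_left power_add dTr_def distrib_left by (intro sum.cong refl) (simp only: ac_simps)
    also have "\<dots> = (\<Sum>t<length v. \<Sum>j\<in>J. \<Sum>p<n. cN / real n * (d j ^ (m + v ! t) *
      (CW \<omega> w j p * CW \<omega> (?y t) j p + CW \<omega> w j p * CW \<omega> (rev (?y t)) j p)))"
      by (rule sum_rotate)
    also have "\<dots> = (\<Sum>t<length v. cN / real n * ((\<Sum>j\<in>J. d j ^ (m + v ! t) * (\<Sum>p<n. CW \<omega> w j p * CW \<omega> (?y t) j p))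
       + (\<Sum>j\<in>J. d j ^ (m + v ! t) * (\<Sum>p<n. CW \<omega> w j p * CW \<omega> (rev (?y t)) j p))))"
      by (intro sum.cong refl) (simp only: sum_distrib_left[symmetric] sum.distrib distrib_left)
    also have "\<dots> = (\<Sum>t<length v. cN / real n * ?N *
       (G (m + v ! t) (w @ rev (?y t)) \<omega> + G (m + v ! t) (w @ ?y t) \<omega>))"
      unfolding sum_col_word_G rev_rev_ident by (intro sum.cong refl) (simp only: distrib_left mult.assoc)
    finally show ?thesis by (simp only: sum_distrib_left)
  qed
  have B': "(\<Sum>j\<in>J. d j ^ m * (\<Sum>p<n. CW \<omega> w j p * (\<Sum>k<length ws. dTr p j (ws ! k) \<omega> * PTr (take k ws @ drop (Suc k) ws) \<omega>)))
    = cN / real n * ?N * (\<Sum>k<length ws. \<Sum>t<length (ws ! k).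
       (G (m + ws ! k ! t) (w @ rev (drop (Suc t) (ws ! k) @ take t (ws ! k))) \<omega> +
        G (m + ws ! k ! t) (w @ drop (Suc t) (ws ! k) @ take t (ws ! k)) \<omega>) * PTr (take k ws @ drop (Suc k) ws) \<omega>)" (is "?L = _")
  proof -
    have "?L = (\<Sum>j\<in>J. \<Sum>p<n. \<Sum>k<length ws. d j ^ m * (CW \<omega> w j p * dTr p j (ws ! k) \<omega>) * PTr (take k ws @ drop (Suc k) ws) \<omega>)"
      unfolding sum_distrib_left by (intro sum.cong refl) (simp only: ac_simps)
    also have "\<dots> = (\<Sum>k<length ws. \<Sum>j\<in>J. \<Sum>p<n. d j ^ m * (CW \<omega> w j p * dTr p j (ws ! k) \<omega>) * PTr (take k ws @ drop (Suc k) ws) \<omega>)"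
      by (rule sum_rotate)
    also have "\<dots> = (\<Sum>k<length ws. (\<Sum>j\<in>J. d j ^ m * (\<Sum>p<n. CW \<omega> w j p * dTr p j (ws ! k) \<omega>)) * PTr (take k ws @ drop (Suc k) ws) \<omega>)"
      unfolding sum_distrib_left sum_distrib_right ..
    also have "\<dots> = (\<Sum>k<length ws. cN / real n * ?N * ((\<Sum>t<length (ws ! k).
       G (m + ws ! k ! t) (w @ rev (drop (Suc t) (ws ! k) @ take t (ws ! k))) \<omega> +
        G (m + ws ! k ! t) (w @ drop (Suc t) (ws ! k) @ take t (ws ! k)) \<omega>) * PTr (take k ws @ drop (Suc k) ws) \<omega>))"
      unfolding B by (simp only: mult.assoc)
    finally show ?thesis by (simp only: sum_distrib_left sum_distrib_right)
  qed
  define PP where "PP = PTr ws \<omega>"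
  define S1 where "S1 = (\<Sum>t<length w. G (m + w ! t) (take t w @ rev (drop (Suc t) w)) \<omega> +
        G (m + w ! t) (take t w) \<omega> * (real n * Tr \<omega> (drop (Suc t) w)))"
  define S2 where "S2 = (\<Sum>k<length ws. \<Sum>t<length (ws ! k).
       (G (m + ws ! k ! t) (w @ rev (drop (Suc t) (ws ! k) @ take t (ws ! k))) \<omega> +
        G (m + ws ! k ! t) (w @ drop (Suc t) (ws ! k) @ take t (ws ! k)) \<omega>) * PTr (take k ws @ drop (Suc k) ws) \<omega>)"
  have C: "(\<Sum>j\<in>J. d j ^ m * (\<Sum>p<n. dcol p j w ws \<omega>)) =
     (\<Sum>j\<in>J. d j ^ m) * (\<Sum>p<n. We \<omega> w p p) * PP + cN * ?N * S1 * PP + cN / real n * ?N * S2"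
    unfolding dcol_def S2_def B'[symmetric] S1_def A[symmetric] PP_def[symmetric]
    by (simp only: sum.distrib distrib_left distrib_right sum_distrib_right[symmetric] mult.assoc[symmetric])
  \<comment> \<open>The relation \<open>cN * cN * ?N = 1\<close> fixes the orders: 1/n for a pairing
    inside the word and 1/n^2 for one across words. When a word splits, the trace of the second
    piece brings an extra factor n, so that term has order one.\<close>
  have "cN / real n * ((\<Sum>j\<in>J. d j ^ m * (\<Sum>p<n. dcol p j w ws \<omega>)) - (\<Sum>j\<in>J. d j ^ m) * (\<Sum>p<n. We \<omega> w p p) * PTr ws \<omega>)
    = (cN * cN * ?N) * (1 / real n * S1 * PP + 1 / (real n)\<^sup>2 * S2)"
    unfolding C PP_def[symmetric] by (simp add: algebra_simps power2_eq_square)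
  also have "\<dots> = 1 / real n * S1 * PP + 1 / (real n)\<^sup>2 * S2" by (simp add: cN_sq)
  also have "1 / real n * S1 * PP = (\<Sum>t<length w. (1 / real n * G (m + w ! t) (take t w @ rev (drop (Suc t) w)) \<omega> +
        G (m + w ! t) (take t w) \<omega> * Tr \<omega> (drop (Suc t) w)) * PP)"
    unfolding S1_def sum_distrib_left sum_distrib_right using n_pos
    by (intro sum.cong refl) (simp add: algebra_simps)
  finally show ?thesis unfolding contraction_def S2_def PP_def PTr_simps by (simp only: distrib_right mult.assoc)
qed

text \<open>Each entry \<open>Zm \<omega> p j\<close> multiplies the polynomial
  \<open>CW \<omega> w j p * PTr ws \<omega>\<close>, so Gaussian integration by parts replaces the
  product by \<open>dcol\<close>, and \<open>sum_dcol\<close> evaluates the resulting sum.\<close>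

lemma expectation_PTr_IBP:
  "expectation (PTr ((m # w) # ws)) =
    expectation (\<lambda>\<omega>. contraction (\<lambda>p x vs. G p x \<omega> * PTr vs \<omega>) (real n) m w ws)"
proof -
  have p1: "has_pd (p, j) (\<lambda>\<omega>. CW \<omega> w j p * PTr ws \<omega>) (dcol p j w ws)"
    and p2: "integrable M (\<lambda>\<omega>. Zm \<omega> p j * (CW \<omega> w j p * PTr ws \<omega>))"
    and p3: "expectation (\<lambda>\<omega>. Zm \<omega> p j * (CW \<omega> w j p * PTr ws \<omega>)) = expectation (dcol p j w ws)"
    and p4: "integrable M (dcol p j w ws)" if "p < n" "j \<in> J" for p j
  proof -
    show 1: "has_pd (p, j) (\<lambda>\<omega>. CW \<omega> w j p * PTr ws \<omega>) (dcol p j w ws)"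
      using that by (rule has_pd_dcol)
    show "integrable M (\<lambda>\<omega>. Zm \<omega> p j * (CW \<omega> w j p * PTr ws \<omega>))"
      "expectation (\<lambda>\<omega>. Zm \<omega> p j * (CW \<omega> w j p * PTr ws \<omega>)) = expectation (dcol p j w ws)"
      using gaussian_ibp[OF _ 1] that by (auto simp: Zm_def)
    show "integrable M (dcol p j w ws)" using has_pd_integrable(2)[OF 1] .
  qed
  have p5: "integrable M (\<lambda>\<omega>. We \<omega> w p p * PTr ws \<omega>)" if "p < n" for p
  proof -
    obtain j where j: "j \<in> J" using J_nonempty by auto
    show ?thesis
      using has_pd_mult[OF _ has_pd_word_ent[of p j p p w] has_pd_PTr[of p j ws]] that j
      by (intro has_pd_integrable(1)) auto
  qed
  have "PTr ((m # w) # ws) = (\<lambda>\<omega>. cN / real n * ((\<Sum>j\<in>J. d j ^ m * (\<Sum>p<n. Zm \<omega> p j * (CW \<omega> w j p * PTr ws \<omega>))) -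
     (\<Sum>j\<in>J. d j ^ m) * (\<Sum>p<n. We \<omega> w p p * PTr ws \<omega>)))"
    unfolding PTr_simps word_tr_Cons fun_eq_iff
    by (simp add: left_diff_distrib right_diff_distrib sum_distrib_right sum_distrib_left mult.assoc)
  \<comment> \<open>Stated for arbitrary integrable \<open>f\<close>, because the expectation has to
    be moved inside before the integration by parts and outside again after it.\<close>
  moreover have E: "expectation (\<lambda>\<omega>. cN / real n * ((\<Sum>j\<in>J. d j ^ m * (\<Sum>p<n. f p j \<omega>)) -
     (\<Sum>j\<in>J. d j ^ m) * (\<Sum>p<n. We \<omega> w p p * PTr ws \<omega>))) =
    cN / real n * ((\<Sum>j\<in>J. d j ^ m * (\<Sum>p<n. expectation (f p j))) -
     (\<Sum>j\<in>J. d j ^ m) * (\<Sum>p<n. expectation (\<lambda>\<omega>. We \<omega> w p p * PTr ws \<omega>)))"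
    if f: "\<And>p j. p < n \<Longrightarrow> j \<in> J \<Longrightarrow> integrable M (f p j)" for f
  proof -
    have 1: "integrable M (\<lambda>\<omega>. \<Sum>j\<in>J. d j ^ m * (\<Sum>p<n. f p j \<omega>))"
      by (intro Bochner_Integration.integrable_sum integrable_mult_right f) auto
    have 2: "integrable M (\<lambda>\<omega>. (\<Sum>j\<in>J. d j ^ m) * (\<Sum>p<n. We \<omega> w p p * PTr ws \<omega>))"
      by (intro Bochner_Integration.integrable_sum integrable_mult_right p5) auto
    have 3: "expectation (\<lambda>\<omega>. \<Sum>j\<in>J. d j ^ m * (\<Sum>p<n. f p j \<omega>)) = (\<Sum>j\<in>J. d j ^ m * (\<Sum>p<n. expectation (f p j)))"
      by (subst Bochner_Integration.integral_sum, intro Bochner_Integration.integrable_sum integrable_mult_right f)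
        (auto intro!: sum.cong simp: Bochner_Integration.integral_sum f)
    have 4: "expectation (\<lambda>\<omega>. (\<Sum>j\<in>J. d j ^ m) * (\<Sum>p<n. We \<omega> w p p * PTr ws \<omega>)) =
      (\<Sum>j\<in>J. d j ^ m) * (\<Sum>p<n. expectation (\<lambda>\<omega>. We \<omega> w p p * PTr ws \<omega>))"
      by (simp add: Bochner_Integration.integral_sum p5)
    show ?thesis by (simp only: integral_mult_right_zero[of M "cN / real n"] Bochner_Integration.integral_diff[OF 1 2] 3 4)
  qed
  ultimately have "expectation (PTr ((m # w) # ws)) = cN / real n * ((\<Sum>j\<in>J. d j ^ m * (\<Sum>p<n. expectation (dcol p j w ws))) -
     (\<Sum>j\<in>J. d j ^ m) * (\<Sum>p<n. expectation (\<lambda>\<omega>. We \<omega> w p p * PTr ws \<omega>)))"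
    using E[of "\<lambda>p j \<omega>. Zm \<omega> p j * (CW \<omega> w j p * PTr ws \<omega>)"] p2 p3 by simp
  also have "\<dots> = expectation (\<lambda>\<omega>. cN / real n * ((\<Sum>j\<in>J. d j ^ m * (\<Sum>p<n. dcol p j w ws \<omega>)) -
     (\<Sum>j\<in>J. d j ^ m) * (\<Sum>p<n. We \<omega> w p p * PTr ws \<omega>)))"
    by (rule E[of "\<lambda>p j. dcol p j w ws", OF p4, symmetric])
  also have "\<dots> = expectation (\<lambda>\<omega>. contraction (\<lambda>p x vs. G p x \<omega> * PTr vs \<omega>) (real n) m w ws)"
    unfolding sum_dcol[symmetric] by (simp add: sum_distrib_right mult.assoc)
  finally show ?thesis .
qed

section \<open>The closed recursion for moments of traces\<close>

definition Mom :: "nat list list \<Rightarrow> real" where "Mom ws = expectation (PTr ws)"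

definition GM :: "nat \<Rightarrow> nat list \<Rightarrow> nat list list \<Rightarrow> real" where
  "GM m x ws = eps * Mom ((m # x) # ws) + tau m * Mom (x # ws)"

lemma Mom_Nil: "Mom [] = 1"
  using prob_space by (simp add: Mom_def PTr_def[abs_def])

lemma Mom_Nil_Cons: "Mom ([] # ws) = Mom ws"
  using n_pos by (simp add: Mom_def PTr_def[abs_def] word_tr_def)

lemma G_mult_PTr:
  "integrable M (\<lambda>\<omega>. G m x \<omega> * PTr ws \<omega>)" "expectation (\<lambda>\<omega>. G m x \<omega> * PTr ws \<omega>) = GM m x ws"
proof -
  have eq: "(\<lambda>\<omega>. G m x \<omega> * PTr ws \<omega>) = (\<lambda>\<omega>. eps * PTr ((m # x) # ws) \<omega> + tau m * PTr (x # ws) \<omega>)"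
    by (simp add: G_def distrib_right mult.assoc)
  show "integrable M (\<lambda>\<omega>. G m x \<omega> * PTr ws \<omega>)" unfolding eq
    by (intro Bochner_Integration.integrable_add integrable_mult_right integrable_PTr)
  show "expectation (\<lambda>\<omega>. G m x \<omega> * PTr ws \<omega>) = GM m x ws" unfolding eq GM_def Mom_def
    by (subst Bochner_Integration.integral_add) (simp_all add: integrable_PTr del: PTr_simps)
qed

text \<open>Since \<open>G\<close> is a combination of traces of words, the right-hand side is again
  expressed by \<open>Mom\<close>. Every contraction merges two letters into one or removes both, so
  the number of letters drops.\<close>

lemma Mom_rec: "Mom ((m # w) # ws) = contraction GM (real n) m w ws"
proof -
  note int = Bochner_Integration.integrable_add Bochner_Integration.integrable_sum integrable_mult_right G_mult_PTr(1)
  have add: "expectation (\<lambda>\<omega>. f \<omega> + g \<omega>) = a + b"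
    if "integrable M f" "integrable M g" "expectation f = a" "expectation g = b" for f g a b
    using that by (simp add: Bochner_Integration.integral_add)
  have sum: "expectation (\<lambda>\<omega>. \<Sum>t\<in>S. f t \<omega>) = (\<Sum>t\<in>S. g t)"
    if "\<And>t. t \<in> S \<Longrightarrow> integrable M (f t)" "\<And>t. t \<in> S \<Longrightarrow> expectation (f t) = g t" for f g and S :: "nat set"
    using that by (simp add: Bochner_Integration.integral_sum)
  have cmult: "expectation (\<lambda>\<omega>. c * f \<omega>) = c * a" if "expectation f = a" for c a :: real and f
    using that by simp
  show ?thesis
    unfolding Mom_def[of "(m # w) # ws"] expectation_PTr_IBP contraction_def
    by (intro add sum cmult int G_mult_PTr(2))
qed

end

section \<open>Asymptotics of the moment recursion\<close>

lemma sum_lessThan_add: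
  fixes f :: "nat \<Rightarrow> 'a::comm_monoid_add"
  shows "(\<Sum>k<a + b. f k) = (\<Sum>k<a. f k) + (\<Sum>k<b. f (a + k))"
  by (induction b) (auto simp: ac_simps)

lemma word_list_cases:
  obtains "ws = []" | us where "ws = [] # us" | m w us where "ws = (m # w) # us"
  by (cases ws; cases "hd ws") auto

text \<open>The sum over all noncrossing pairings of the letters, where a pair of letters
  \<open>a\<close>, \<open>b\<close> has weight \<open>\<tau> (a + b)\<close>. The partner of the
  first letter separates the letters enclosed by this pair from those behind it.\<close>

function limit_moment :: "(nat \<Rightarrow> real) \<Rightarrow> nat list \<Rightarrow> real" where
  "limit_moment \<tau> [] = 1"
| "limit_moment \<tau> (m # w) =
    (\<Sum>t<length w. \<tau> (m + w ! t) * (limit_moment \<tau> (take t w) * limit_moment \<tau> (drop (Suc t) w)))"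
  by pat_completeness auto
termination by (relation "Wellfounded.measure (\<lambda>(_, w). length w)") auto

text \<open>Isolates what the asymptotics use: a scalar recursion whose coefficients converge. It is
  required for \<open>n > 0\<close> only, since no matrix exists for \<open>n = 0\<close>.\<close>

locale moment_recursion =
  fixes e :: "nat \<Rightarrow> real" and ta :: "nat \<Rightarrow> nat \<Rightarrow> real" and Mo :: "nat \<Rightarrow> nat list list \<Rightarrow> real"
    and \<tau> :: "nat \<Rightarrow> real"
  assumes e_lim: "e \<longlonglongrightarrow> 0" and ta_lim: "\<And>m. (\<lambda>n. ta n m) \<longlonglongrightarrow> \<tau> m"
    and Mo_Nil: "\<And>n. n > 0 \<Longrightarrow> Mo n [] = 1"
    and Mo_Nil_Cons: "\<And>n ws. n > 0 \<Longrightarrow> Mo n ([] # ws) = Mo n ws"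
    and Mo_rec: "\<And>n m w ws. n > 0 \<Longrightarrow> Mo n ((m # w) # ws) =
      contraction (\<lambda>p x vs. e n * Mo n ((p # x) # vs) + ta n p * Mo n (x # vs)) (real n) m w ws"
begin

text \<open>Each word counts one more than twice its length, so that splitting a word after the loss of two letters
  and deleting an empty word both decrease the size.\<close>
definition msize :: "nat list list \<Rightarrow> nat" where
  "msize ws = (\<Sum>w\<leftarrow>ws. 2 * length w + 1)"

lemma msize_simps [simp]: "msize [] = 0" "msize (w # ws) = 2 * length w + 1 + msize ws"
  "msize (ws @ vs) = msize ws + msize vs"
  by (simp_all add: msize_def)

lemma msize_remove:
  assumes "k < length ws"
  shows "msize (take k ws) + msize (drop (Suc k) ws) + 2 * length (ws ! k) + 1 = msize ws"
  using assms by (subst (3) id_take_nth_drop[OF assms]) simp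

lemma msize_contraction:
  assumes "k < length ws"
  shows "msize (take k ws @ drop (Suc k) ws) + 2 * length (ws ! k) + 1 = msize ws"
  using msize_remove[OF assms] by simp

text \<open>Only the splitting of the word carries no inverse power of n; all other terms of the
  finite sums converge and are multiplied by 1/n or 1/n^2.\<close>

lemma contraction_tendsto:
  assumes H: "\<And>p x vs. msize ((p # x) # vs) < msize ((m # w) # ws) \<Longrightarrow> (\<lambda>n. H n p x vs) \<longlonglongrightarrow> L p x vs"
  shows "(\<lambda>n. contraction (H n) (real n) m w ws) \<longlonglongrightarrow> (\<Sum>t<length w. L (m + w ! t) (take t w) (drop (Suc t) w # ws))"
proof -
  have inv: "(\<lambda>n. 1 / real n) \<longlonglongrightarrow> 0" "(\<lambda>n. 1 / (real n)\<^sup>2) \<longlonglongrightarrow> 0"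
    using tendsto_power[OF lim_1_over_n, of 2] by (auto simp: lim_1_over_n power_divide)
  let ?L = "\<lambda>k t y. L (m + ws ! k ! t) (w @ y (drop (Suc t) (ws ! k) @ take t (ws ! k))) (take k ws @ drop (Suc k) ws)"
  have "(\<lambda>n. contraction (H n) (real n) m w ws) \<longlonglongrightarrow>
    (\<Sum>t<length w. 0 * L (m + w ! t) (take t w @ rev (drop (Suc t) w)) ws + L (m + w ! t) (take t w) (drop (Suc t) w # ws)) +
    0 * (\<Sum>k<length ws. \<Sum>t<length (ws ! k). ?L k t rev + ?L k t (\<lambda>y. y))"
    unfolding contraction_def
    by (intro tendsto_add tendsto_sum tendsto_mult inv H) (auto dest!: msize_contraction)
  then show ?thesis by simp
qed

text \<open>In the surviving terms the merged letter has coefficient \<open>e n\<close>, which tends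
  to 0, so both paired letters are lost and the recursion of \<open>limit_moment\<close> remains. It
  acts on the first word alone, whence the limit factorizes over the words.\<close>

lemma Mo_tendsto: "(\<lambda>n. Mo n ws) \<longlonglongrightarrow> (\<Prod>w\<leftarrow>ws. limit_moment \<tau> w)"
proof (induction "msize ws" arbitrary: ws rule: less_induct)
  case less
  have IH: "(\<lambda>n. Mo n vs) \<longlonglongrightarrow> (\<Prod>w\<leftarrow>vs. limit_moment \<tau> w)" if "msize vs < msize ws" for vs
    using less that by blast
  have ev: "eventually (\<lambda>n::nat. n > 0) sequentially" by (rule eventually_gt_at_top)
  show ?case
  proof (cases ws rule: word_list_cases)
    case 1
    have "eventually (\<lambda>n. Mo n ws = 1) sequentially"
      using ev by eventually_elim (simp add: 1 Mo_Nil)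
    then show ?thesis by (simp add: 1 tendsto_eventually)
  next
    case (2 vs)
    have "eventually (\<lambda>n. Mo n vs = Mo n ws) sequentially"
      using ev by eventually_elim (simp add: 2 Mo_Nil_Cons)
    moreover have "(\<lambda>n. Mo n vs) \<longlonglongrightarrow> (\<Prod>w\<leftarrow>vs. limit_moment \<tau> w)" by (rule IH) (simp add: 2)
    ultimately show ?thesis using 2 by (auto elim: Lim_transform_eventually[rotated])
  next
    case (3 m w ws')
    let ?P = "\<lambda>ws. \<Prod>w\<leftarrow>ws. limit_moment \<tau> w"
    have T: "(\<lambda>n. contraction (\<lambda>p x vs. e n * Mo n ((p # x) # vs) + ta n p * Mo n (x # vs)) (real n) m w ws') \<longlonglongrightarrow>
      (\<Sum>t<length w. 0 * ?P (((m + w ! t) # take t w) # drop (Suc t) w # ws') +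
        \<tau> (m + w ! t) * ?P (take t w # drop (Suc t) w # ws'))"
    proof (rule contraction_tendsto)
      fix p x vs assume "msize ((p # x) # vs) < msize ((m # w) # ws')"
      then show "(\<lambda>n. e n * Mo n ((p # x) # vs) + ta n p * Mo n (x # vs)) \<longlonglongrightarrow>
          0 * ?P ((p # x) # vs) + \<tau> p * ?P (x # vs)"
        by (intro tendsto_add tendsto_mult e_lim ta_lim IH) (simp_all add: 3)
    qed
    have L: "(\<Sum>t<length w. 0 * ?P (((m + w ! t) # take t w) # drop (Suc t) w # ws') +
        \<tau> (m + w ! t) * ?P (take t w # drop (Suc t) w # ws')) = ?P ws"
      by (simp add: 3 sum_distrib_right mult.assoc)
    have "eventually (\<lambda>n. contraction (\<lambda>p x vs. e n * Mo n ((p # x) # vs) + ta n p * Mo n (x # vs)) (real n) m w ws' = Mo n ws) sequentially"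
      using ev unfolding 3 by eventually_elim (rule Mo_rec[symmetric])
    with T show ?thesis unfolding L by (rule Lim_transform_eventually)
  qed
qed

section \<open>Covariances of order 1/n^2\<close>

definition bdd :: "(nat \<Rightarrow> real) \<Rightarrow> bool" where "bdd f \<longleftrightarrow> (\<exists>C. \<forall>n>0. \<bar>f n\<bar> \<le> C)"
definition quad :: "(nat \<Rightarrow> real) \<Rightarrow> bool" where "quad f \<longleftrightarrow> bdd (\<lambda>n. (real n)\<^sup>2 * f n)"

lemma bdd_tendsto: "f \<longlonglongrightarrow> l \<Longrightarrow> bdd f"
  using convergent_imp_Bseq[of f] unfolding bdd_def Bseq_def by (auto simp: convergent_def)

lemma bdd_add: "bdd f \<Longrightarrow> bdd g \<Longrightarrow> bdd (\<lambda>n. f n + g n)"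
proof -
  assume "bdd f" "bdd g"
  then obtain C D where h: "\<And>n. n > 0 \<Longrightarrow> \<bar>f n\<bar> \<le> C" "\<And>n. n > 0 \<Longrightarrow> \<bar>g n\<bar> \<le> D" by (auto simp: bdd_def)
  have "\<bar>f n + g n\<bar> \<le> C + D" if "n > 0" for n
    using h[OF that] by linarith
  then show ?thesis unfolding bdd_def by blast
qed

lemma bdd_mult: "bdd f \<Longrightarrow> bdd g \<Longrightarrow> bdd (\<lambda>n. f n * g n)"
proof -
  assume "bdd f" "bdd g"
  then obtain C D where h: "\<And>n. n > 0 \<Longrightarrow> \<bar>f n\<bar> \<le> C" "\<And>n. n > 0 \<Longrightarrow> \<bar>g n\<bar> \<le> D" by (auto simp: bdd_def)
  then have "\<bar>f n * g n\<bar> \<le> C * D" if "n > 0" for n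
  proof -
    have "0 \<le> C" using h(1)[OF that] by linarith
    then show ?thesis unfolding abs_mult using h[OF that] by (intro mult_mono) auto
  qed
  then show ?thesis unfolding bdd_def by blast
qed

lemma bdd_0: "bdd (\<lambda>_. 0)" unfolding bdd_def by auto

lemma quad_add: "quad f \<Longrightarrow> quad g \<Longrightarrow> quad (\<lambda>n. f n + g n)"
  unfolding quad_def using bdd_add[of "\<lambda>n. (real n)\<^sup>2 * f n" "\<lambda>n. (real n)\<^sup>2 * g n"]
  by (simp add: distrib_left)

lemma bdd_sum: "(\<And>t. t \<in> S \<Longrightarrow> bdd (f t)) \<Longrightarrow> bdd (\<lambda>n. \<Sum>t\<in>S. f t n)"
  by (induction S rule: infinite_finite_induct) (auto intro: bdd_add simp: bdd_0)

lemma quad_sum: "(\<And>t. t \<in> S \<Longrightarrow> quad (f t)) \<Longrightarrow> quad (\<lambda>n. \<Sum>t\<in>S. f t n)"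
  unfolding quad_def sum_distrib_left by (rule bdd_sum)

lemma quad_bdd_mult: "bdd f \<Longrightarrow> quad g \<Longrightarrow> quad (\<lambda>n. f n * g n)"
  unfolding quad_def using bdd_mult[of f "\<lambda>n. (real n)\<^sup>2 * g n"] by (simp add: mult.left_commute)

lemma quad_inverse_sq: "bdd f \<Longrightarrow> quad (\<lambda>n. 1 / (real n)\<^sup>2 * f n)"
  unfolding quad_def bdd_def by (auto simp: field_simps)

lemma quad_cong: "quad f \<Longrightarrow> (\<And>n. n > 0 \<Longrightarrow> f n = g n) \<Longrightarrow> quad g"
  unfolding quad_def bdd_def by auto

lemma bdd_Mo: "bdd (\<lambda>n. Mo n ws)" and bdd_e: "bdd e" and bdd_ta: "bdd (\<lambda>n. ta n m)"
  and bdd_inverse: "bdd (\<lambda>n. 1 / real n)"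
  using Mo_tendsto e_lim ta_lim lim_1_over_n by (auto intro!: bdd_tendsto)

text \<open>The prefactors of a contraction are bounded in n, so the order 1/n^2 of the terms is
  inherited.\<close>

lemma quad_contraction:
  assumes H: "\<And>p x vs. msize ((p # x) # vs) < msize ((m # w) # ws) \<Longrightarrow> quad (\<lambda>n. H n p x vs)"
  shows "quad (\<lambda>n. contraction (H n) (real n) m w ws)"
proof -
  have "bdd (\<lambda>n. 1 / (real n)\<^sup>2)" using bdd_mult[OF bdd_inverse bdd_inverse] by (simp add: power2_eq_square)
  then show ?thesis unfolding contraction_def
    by (intro quad_add quad_sum quad_bdd_mult bdd_inverse H) (auto dest!: msize_contraction)
qed

text \<open>The words in \<open>vs\<close> are mere spectators except where one of their letters is
  the partner of \<open>m\<close>, and each such pairing carries \<open>1 / N\<^sup>2\<close>. This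
  extra sum is the source of the covariance.\<close>

lemma contraction_append:
  "contraction H N m w (us @ vs) = contraction (\<lambda>p x xs. H p x (xs @ vs)) N m w us +
    1 / N\<^sup>2 * (\<Sum>k<length vs. \<Sum>t<length (vs ! k).
       H (m + vs ! k ! t) (w @ rev (drop (Suc t) (vs ! k) @ take t (vs ! k))) (us @ take k vs @ drop (Suc k) vs) +
       H (m + vs ! k ! t) (w @ drop (Suc t) (vs ! k) @ take t (vs ! k)) (us @ take k vs @ drop (Suc k) vs))"
proof -
  define F where "F x xs = (\<Sum>t<length x. H (m + x ! t) (w @ rev (drop (Suc t) x @ take t x)) xs +
       H (m + x ! t) (w @ drop (Suc t) x @ take t x) xs)" for x xs
  have "(\<Sum>k<length (us @ vs). F ((us @ vs) ! k) (take k (us @ vs) @ drop (Suc k) (us @ vs))) =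
    (\<Sum>k<length us. F ((us @ vs) ! k) (take k (us @ vs) @ drop (Suc k) (us @ vs))) +
    (\<Sum>k<length vs. F ((us @ vs) ! (length us + k)) (take (length us + k) (us @ vs) @ drop (Suc (length us + k)) (us @ vs)))"
    unfolding length_append by (rule sum_lessThan_add)
  also have "\<dots> = (\<Sum>k<length us. F (us ! k) ((take k us @ drop (Suc k) us) @ vs)) +
    (\<Sum>k<length vs. F (vs ! k) (us @ take k vs @ drop (Suc k) vs))"
    by (simp add: nth_append Suc_diff_le)
  finally show ?thesis unfolding contraction_def F_def[symmetric] by (simp only: append_Cons distrib_left add.assoc)
qed

lemma contraction_diff_mult:
  "contraction H N m w ws - contraction H' N m w ws * c = contraction (\<lambda>p x vs. H p x vs - H' p x vs * c) N m w ws"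
  unfolding contraction_def
  by (simp add: sum_distrib_right sum_subtractf sum.distrib left_diff_distrib right_diff_distrib distrib_left distrib_right mult.assoc)

text \<open>Subtracting \<open>Mo n vs\<close> times the recursion for \<open>ws\<close> from the
  recursion for \<open>ws @ vs\<close> shows that covariances satisfy the same linear recursion with
  an inhomogeneity of order 1/n^2, namely the pairings between \<open>ws\<close> and
  \<open>vs\<close>. Induction on the size of \<open>ws\<close> propagates this order.\<close>

lemma quad_cov: "quad (\<lambda>n. Mo n (ws @ vs) - Mo n ws * Mo n vs)"
proof (induction "msize ws" arbitrary: ws rule: less_induct)
  case less
  have IH: "quad (\<lambda>n. Mo n (us @ vs) - Mo n us * Mo n vs)" if "msize us < msize ws" for us
    using less that by blast
  show ?case
  proof (cases ws rule: word_list_cases)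
    case 1
    have "quad (\<lambda>_. 0)" by (simp add: quad_def bdd_0)
    then show ?thesis by (rule quad_cong) (simp add: 1 Mo_Nil)
  next
    case (2 us)
    have "quad (\<lambda>n. Mo n (us @ vs) - Mo n us * Mo n vs)" by (rule IH) (simp add: 2)
    then show ?thesis by (rule quad_cong) (simp add: 2 Mo_Nil_Cons)
  next
    case (3 m w us)
    define C where "C us n = Mo n (us @ vs) - Mo n us * Mo n vs" for us n
    define H where "H n p x xs = e n * Mo n ((p # x) # xs) + ta n p * Mo n (x # xs)" for n p x xs
    define B where "B n = (\<Sum>k<length vs. \<Sum>t<length (vs ! k).
       H n (m + vs ! k ! t) (w @ rev (drop (Suc t) (vs ! k) @ take t (vs ! k))) (us @ take k vs @ drop (Suc k) vs) +
       H n (m + vs ! k ! t) (w @ drop (Suc t) (vs ! k) @ take t (vs ! k)) (us @ take k vs @ drop (Suc k) vs))" for n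
    have "quad (\<lambda>n. contraction (\<lambda>p x xs. e n * C ((p # x) # xs) n + ta n p * C (x # xs) n) (real n) m w us + 1 / (real n)\<^sup>2 * B n)"
    proof (rule quad_add[OF quad_contraction quad_inverse_sq])
      fix p x xs assume sz: "msize ((p # x) # xs) < msize ((m # w) # us)"
      have "quad (C ((p # x) # xs))" "quad (C (x # xs))"
        unfolding C_def[abs_def] by (rule IH, use sz 3 in simp)+
      then show "quad (\<lambda>n. e n * C ((p # x) # xs) n + ta n p * C (x # xs) n)"
        by (intro quad_add quad_bdd_mult bdd_e bdd_ta)
    next
      show "bdd B" unfolding B_def H_def by (intro bdd_add bdd_sum bdd_mult bdd_e bdd_ta bdd_Mo)
    qed
    then show ?thesis unfolding 3
    proof (rule quad_cong)
      fix n :: nat assume n: "n > 0"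
      have rec: "Mo n ((m # w) # xs) = contraction (H n) (real n) m w xs" for xs
        unfolding H_def by (rule Mo_rec[OF n])
      have eq: "H n p x (xs @ vs) - H n p x xs * Mo n vs = e n * C ((p # x) # xs) n + ta n p * C (x # xs) n" for p x xs
        by (simp add: H_def C_def algebra_simps)
      show "contraction (\<lambda>p x xs. e n * C ((p # x) # xs) n + ta n p * C (x # xs) n) (real n) m w us + 1 / (real n)\<^sup>2 * B n =
        Mo n (((m # w) # us) @ vs) - Mo n ((m # w) # us) * Mo n vs"
        unfolding append_Cons rec contraction_append eq[symmetric] contraction_diff_mult[symmetric] B_def by simp
    qed
  qed
qed

end

section \<open>Almost sure convergence of traces\<close>

text \<open>The series of the squares has finite expectation, as the sum of 1/n^2 converges; hence
  it is almost surely finite and its terms tend to 0. The joint law of the \<open>f n\<close> does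
  not enter.\<close>

lemma (in prob_space) AE_tendsto_0_of_second_moment:
  fixes f :: "nat \<Rightarrow> 'a \<Rightarrow> real"
  assumes meas: "\<And>n. n > 0 \<Longrightarrow> f n \<in> borel_measurable M"
    and int: "\<And>n. n > 0 \<Longrightarrow> integrable M (\<lambda>\<omega>. (f n \<omega>)\<^sup>2)"
    and bound: "\<And>n. n > 0 \<Longrightarrow> expectation (\<lambda>\<omega>. (f n \<omega>)\<^sup>2) \<le> C / (real n)\<^sup>2"
  shows "AE \<omega> in M. (\<lambda>n. f n \<omega>) \<longlonglongrightarrow> 0"
proof -
  have [measurable]: "f (Suc n) \<in> borel_measurable M" for n using meas by simp
  have sm: "summable (\<lambda>n. C * (1 / (real (Suc n))\<^sup>2))"
    using inverse_squares_sums by (intro summable_mult) (auto simp: sums_iff)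
  have C0: "C \<ge> 0"
  proof -
    have "0 \<le> expectation (\<lambda>\<omega>. (f 1 \<omega>)\<^sup>2)" by simp
    also have "\<dots> \<le> C" using bound[of 1] by simp
    finally show ?thesis .
  qed
  have "(\<integral>\<^sup>+\<omega>. (\<Sum>n. ennreal ((f (Suc n) \<omega>)\<^sup>2)) \<partial>M) = (\<Sum>n. \<integral>\<^sup>+\<omega>. ennreal ((f (Suc n) \<omega>)\<^sup>2) \<partial>M)"
    by (rule nn_integral_suminf) simp
  also have "\<dots> \<le> (\<Sum>n. ennreal (C * (1 / (real (Suc n))\<^sup>2)))"
  proof (rule suminf_le)
    show "(\<integral>\<^sup>+\<omega>. ennreal ((f (Suc n) \<omega>)\<^sup>2) \<partial>M) \<le> ennreal (C * (1 / (real (Suc n))\<^sup>2))" for n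
      using int[of "Suc n"] bound[of "Suc n"] by (subst nn_integral_eq_integral) (auto intro!: ennreal_leI)
  qed auto
  also have "\<dots> = ennreal (\<Sum>n. C * (1 / (real (Suc n))\<^sup>2))"
    using sm C0 by (intro suminf_ennreal2) auto
  also have "\<dots> < \<infinity>" by simp
  finally have "(\<integral>\<^sup>+\<omega>. (\<Sum>n. ennreal ((f (Suc n) \<omega>)\<^sup>2)) \<partial>M) \<noteq> \<infinity>" by simp
  then have "AE \<omega> in M. (\<Sum>n. ennreal ((f (Suc n) \<omega>)\<^sup>2)) \<noteq> \<infinity>"
    by (intro nn_integral_PInf_AE) auto
  then show ?thesis
  proof eventually_elim
    case (elim \<omega>)
    then have "summable (\<lambda>n. (f (Suc n) \<omega>)\<^sup>2)"
      by (intro summable_suminf_not_top) auto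
    then have "(\<lambda>n. (f (Suc n) \<omega>)\<^sup>2) \<longlonglongrightarrow> 0" by (rule summable_LIMSEQ_zero)
    then have "(\<lambda>n. f (Suc n) \<omega>) \<longlonglongrightarrow> 0" by (simp add: tendsto_null_power)
    then show ?case by (rule LIMSEQ_imp_Suc)
  qed
qed

lemma AE_word_tr_tendsto:
  fixes M :: "'w measure" and J :: "nat \<Rightarrow> 'c set" and z :: "nat \<Rightarrow> nat \<Rightarrow> 'c \<Rightarrow> 'w \<Rightarrow> real"
  assumes gm: "\<And>n. n > 0 \<Longrightarrow> gaussian_matrix M n (J n) (z n)"
    and e_lim: "(\<lambda>n. sqrt (real n / real (card (J n)))) \<longlonglongrightarrow> 0"
    and tau_lim: "\<And>m. (\<lambda>n. (\<Sum>j\<in>J n. d n j ^ m) / real (card (J n))) \<longlonglongrightarrow> \<tau> m"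
  shows "AE \<omega> in M. (\<lambda>n. word_tr n (J n) (d n) (\<lambda>p j. z n p j \<omega>) w) \<longlonglongrightarrow> limit_moment \<tau> w"
proof -
  interpret prob_space M using gm[of 1] by (simp add: gaussian_matrix_def)
  define e where "e n = sqrt (real n / real (card (J n)))" for n
  define ta where "ta n m = (\<Sum>j\<in>J n. d n j ^ m) / real (card (J n))" for n m
  define Mo where "Mo n ws = gaussian_matrix.Mom M n (J n) (z n) (d n) ws" for n ws
  define T where "T n \<omega> = word_tr n (J n) (d n) (\<lambda>p j. z n p j \<omega>) w" for n \<omega>
  interpret moment_recursion e ta Mo \<tau>
  proof
    show "e \<longlonglongrightarrow> 0" using e_lim by (simp add: e_def[abs_def])
    show "(\<lambda>n. ta n m) \<longlonglongrightarrow> \<tau> m" for m using tau_lim by (simp add: ta_def)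
    fix n :: nat assume n: "n > 0"
    interpret gaussian_matrix M n "J n" "z n" "d n" by (rule gm[OF n])
    show "Mo n [] = 1" by (simp add: Mo_def Mom_Nil)
    show "Mo n ([] # ws) = Mo n ws" for ws by (simp add: Mo_def Mom_Nil_Cons)
    have "e n = eps" "ta n = tau" by (simp_all add: e_def ta_def eps_def tau_def fun_eq_iff)
    then show "Mo n ((m # w) # ws) =
      contraction (\<lambda>p x vs. e n * Mo n ((p # x) # vs) + ta n p * Mo n (x # vs)) (real n) m w ws"
      for m w ws unfolding Mo_def using Mom_rec[of m w ws] by (simp only: GM_def[abs_def])
  qed
  have T: "integrable M (T n)" "integrable M (\<lambda>\<omega>. T n \<omega> * T n \<omega>)"
    "expectation (T n) = Mo n [w]" "expectation (\<lambda>\<omega>. T n \<omega> * T n \<omega>) = Mo n [w, w]" if n: "n > 0" for n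
  proof -
    interpret gaussian_matrix M n "J n" "z n" "d n" by (rule gm[OF n])
    have eq: "T n = PTr [w]" "(\<lambda>\<omega>. T n \<omega> * T n \<omega>) = PTr [w, w]"
      by (simp_all add: T_def[abs_def] PTr_def[abs_def] Zm_def[abs_def])
    show "integrable M (T n)" unfolding eq(1) by (rule integrable_PTr)
    show "integrable M (\<lambda>\<omega>. T n \<omega> * T n \<omega>)" unfolding eq(2) by (rule integrable_PTr)
    show "expectation (T n) = Mo n [w]" "expectation (\<lambda>\<omega>. T n \<omega> * T n \<omega>) = Mo n [w, w]"
      unfolding eq(2) Mo_def Mom_def by (simp_all add: eq(1))
  qed
  \<comment> \<open>The variance of the trace is the covariance of two one-word lists.\<close>
  obtain C where C: "\<And>n. n > 0 \<Longrightarrow> \<bar>(real n)\<^sup>2 * (Mo n [w, w] - Mo n [w] * Mo n [w])\<bar> \<le> C"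
    using quad_cov[of "[w]" "[w]"] unfolding quad_def bdd_def by auto
  have "AE \<omega> in M. (\<lambda>n. T n \<omega> - Mo n [w]) \<longlonglongrightarrow> 0"
  proof (rule AE_tendsto_0_of_second_moment)
    fix n :: nat assume n: "n > 0"
    show "(\<lambda>\<omega>. T n \<omega> - Mo n [w]) \<in> borel_measurable M" using T(1)[OF n] by auto
    have eq: "(\<lambda>\<omega>. (T n \<omega> - Mo n [w])\<^sup>2) = (\<lambda>\<omega>. T n \<omega> * T n \<omega> + (- 2 * Mo n [w]) * T n \<omega> + (Mo n [w])\<^sup>2)"
      by (simp add: power2_eq_square algebra_simps)
    show "integrable M (\<lambda>\<omega>. (T n \<omega> - Mo n [w])\<^sup>2)" unfolding eq using T[OF n] by auto
    have "expectation (\<lambda>\<omega>. (T n \<omega> - Mo n [w])\<^sup>2) = Mo n [w, w] - Mo n [w] * Mo n [w]"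
      unfolding eq using T[OF n] by (simp add: prob_space power2_eq_square)
    also have "\<dots> \<le> C / (real n)\<^sup>2"
      using C[OF n] n by (simp add: field_simps abs_le_iff)
    finally show "expectation (\<lambda>\<omega>. (T n \<omega> - Mo n [w])\<^sup>2) \<le> C / (real n)\<^sup>2" .
  qed
  then show ?thesis
  proof eventually_elim
    case (elim \<omega>)
    have "(\<lambda>n. (T n \<omega> - Mo n [w]) + Mo n [w]) \<longlonglongrightarrow> 0 + (\<Prod>w\<leftarrow>[w]. limit_moment \<tau> w)"
      by (intro tendsto_add elim Mo_tendsto)
    then show ?case by (simp add: T_def)
  qed
qed

section \<open>The semicircle law and its moments\<close>

text \<open>With \<open>x = 2 * cos \<theta>\<close> this is the integral of \<open>x ^ k\<close>
  times the Chebyshev polynomial of the second kind \<open>U\<^sub>j(x/2)\<close> against the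
  semicircle law on [-2, 2]. It counts the nonnegative lattice paths with \<open>k\<close> steps
  from level \<open>j\<close> to level 0; only \<open>j = 0\<close> is a semicircle moment, the
  other levels make the recursion close.\<close>

definition cheb_moment :: "nat \<Rightarrow> nat \<Rightarrow> real" where
  "cheb_moment k j = 2 / pi * integral {0..pi} (\<lambda>\<theta>. (2 * cos \<theta>) ^ k * sin (real (j + 1) * \<theta>) * sin \<theta>)"

lemma cheb_moment_integrable:
  "(\<lambda>\<theta>. (2 * cos \<theta>) ^ k * sin (a * \<theta>) * sin \<theta>) integrable_on {0..pi}"
  by (intro integrable_continuous_real continuous_intros)

lemma cheb_moment_Suc_Suc: "cheb_moment (Suc k) (Suc j) = cheb_moment k (j + 2) + cheb_moment k j"
proof -
  have "(2 * cos \<theta>) ^ Suc k * sin (real (Suc j + 1) * \<theta>) * sin \<theta> =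
    (2 * cos \<theta>) ^ k * sin (real (j + 2 + 1) * \<theta>) * sin \<theta> +
    (2 * cos \<theta>) ^ k * sin (real (j + 1) * \<theta>) * sin \<theta>" for \<theta> :: real
  proof -
    have "2 * cos \<theta> * sin (real (j + 2) * \<theta>) = sin (real (j + 2) * \<theta> + \<theta>) + sin (real (j + 2) * \<theta> - \<theta>)"
      by (simp add: sin_add sin_diff)
    also have "real (j + 2) * \<theta> + \<theta> = real (j + 2 + 1) * \<theta>" by (simp add: algebra_simps)
    also have "real (j + 2) * \<theta> - \<theta> = real (j + 1) * \<theta>" by (simp add: algebra_simps)
    finally have *: "2 * cos \<theta> * sin (real (Suc j + 1) * \<theta>) = sin (real (j + 2 + 1) * \<theta>) + sin (real (j + 1) * \<theta>)"
      by simp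
    have "(2 * cos \<theta>) ^ Suc k * sin (real (Suc j + 1) * \<theta>) * sin \<theta> =
      (2 * cos \<theta>) ^ k * (2 * cos \<theta> * sin (real (Suc j + 1) * \<theta>)) * sin \<theta>" by simp
    then show ?thesis unfolding * by (simp only: distrib_left distrib_right)
  qed
  then show ?thesis unfolding cheb_moment_def
    by (simp only: Henstock_Kurzweil_Integration.integral_add[OF cheb_moment_integrable cheb_moment_integrable] distrib_left)
qed

lemma cheb_moment_Suc_0: "cheb_moment (Suc k) 0 = cheb_moment k 1"
proof -
  have "(2 * cos \<theta>) ^ Suc k * sin (real (0 + 1) * \<theta>) * sin \<theta> = (2 * cos \<theta>) ^ k * sin (real (1 + 1) * \<theta>) * sin \<theta>" for \<theta> :: real
    by (simp add: sin_double)
  then show ?thesis unfolding cheb_moment_def by (simp only:)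
qed

text \<open>Orthogonality of \<open>sin ((j + 1) \<theta>)\<close> and \<open>sin \<theta>\<close>
  on [0, pi], by explicit antiderivatives. The case \<open>j = 0\<close> is separate because
  \<open>?F\<close> divides by \<open>j\<close>.\<close>

lemma cheb_moment_0: "cheb_moment 0 j = (if j = 0 then 1 else 0)"
proof (cases "j = 0")
  case True
  have "((\<lambda>\<theta>. sin \<theta> * sin \<theta>) has_integral ((pi - sin pi * cos pi) / 2 - (0 - sin 0 * cos 0) / 2)) {0..pi}"
  proof (rule fundamental_theorem_of_calculus)
    show "((\<lambda>\<theta>. (\<theta> - sin \<theta> * cos \<theta>) / 2) has_vector_derivative sin x * sin x) (at x within {0..pi})" for x
    proof -
      have "((\<lambda>\<theta>. (\<theta> - sin \<theta> * cos \<theta>) / 2) has_real_derivative (1 - (cos x * cos x - sin x * sin x)) / 2) (at x within {0..pi})"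
        by (auto intro!: derivative_eq_intros)
      moreover have "(1 - (cos x * cos x - sin x * sin x)) / 2 = sin x * sin x"
        using sin_cos_squared_add[of x] by (simp add: power2_eq_square)
      ultimately show ?thesis by (simp add: has_real_derivative_iff_has_vector_derivative)
    qed
  qed simp
  then show ?thesis using True by (simp add: cheb_moment_def integral_unique)
next
  case False
  then obtain i where j: "j = Suc i" by (cases j) auto
  let ?F = "\<lambda>\<theta>. sin (real j * \<theta>) / (2 * real j) - sin (real (j + 2) * \<theta>) / (2 * real (j + 2))"
  have "((\<lambda>\<theta>. sin (real (j + 1) * \<theta>) * sin \<theta>) has_integral (?F pi - ?F 0)) {0..pi}"
  proof (rule fundamental_theorem_of_calculus)
    show "(?F has_vector_derivative sin (real (j + 1) * x) * sin x) (at x within {0..pi})" for x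
    proof -
      have "(?F has_real_derivative cos (real j * x) / 2 - cos (real (j + 2) * x) / 2) (at x within {0..pi})"
      proof (rule DERIV_diff)
        have "((\<lambda>\<theta>. sin (a * \<theta>) / (2 * a)) has_real_derivative cos (a * x) / 2) (at x within {0..pi})"
          if "a \<noteq> 0" for a
          using that by (auto intro!: derivative_eq_intros)
        from this[of "real j"] this[of "real (j + 2)"] False
        show "((\<lambda>\<theta>. sin (real j * \<theta>) / (2 * real j)) has_real_derivative cos (real j * x) / 2) (at x within {0..pi})"
          "((\<lambda>\<theta>. sin (real (j + 2) * \<theta>) / (2 * real (j + 2))) has_real_derivative cos (real (j + 2) * x) / 2) (at x within {0..pi})"
          by simp_all
      qed
      moreover have "cos (real j * x) / 2 - cos (real (j + 2) * x) / 2 = sin (real (j + 1) * x) * sin x"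
      proof -
        have "real j * x = real (j + 1) * x - x" "real (j + 2) * x = real (j + 1) * x + x"
          by (simp_all add: algebra_simps)
        then show ?thesis by (simp only: cos_add cos_diff) (simp add: field_simps)
      qed
      ultimately show ?thesis by (simp add: has_real_derivative_iff_has_vector_derivative)
    qed
  qed simp
  moreover have "?F pi - ?F 0 = 0" using sin_npi[of j] sin_npi[of "j + 2"] by (simp add: mult.commute)
  ultimately show ?thesis using False by (simp add: cheb_moment_def integral_unique)
qed

text \<open>First-passage decomposition of lattice paths on the nonnegative integers that step by one.\<close>
lemma cheb_moment_convolution:
  "cheb_moment k (Suc j) = (\<Sum>i<k. cheb_moment i j * cheb_moment (k - 1 - i) 0)"
proof (induction k arbitrary: j)
  case 0
  show ?case by (simp add: cheb_moment_0)
next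
  case (Suc k)
  \<comment> \<open>The summand \<open>i = 0\<close> vanishes for \<open>j > 0\<close>; for
    \<open>j = 0\<close> it accounts for the paths whose first step already reaches level 0.\<close>
  have e: "(\<Sum>i<Suc k. cheb_moment i j * cheb_moment (Suc k - 1 - i) 0) =
    cheb_moment 0 j * cheb_moment k 0 + (\<Sum>i<k. cheb_moment (Suc i) j * cheb_moment (k - 1 - i) 0)"
    unfolding sum.lessThan_Suc_shift by simp
  show ?case
  proof (cases j)
    case 0
    show ?thesis unfolding e unfolding 0 cheb_moment_Suc_0
      using Suc[of 1] cheb_moment_Suc_Suc[of k 0] by (simp add: cheb_moment_0 numeral_2_eq_2)
  next
    case (Suc j')
    show ?thesis unfolding e unfolding Suc cheb_moment_Suc_Suc distrib_right sum.distrib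
      using Suc.IH[of "j' + 2"] Suc.IH[of j'] cheb_moment_Suc_Suc[of k "Suc j'"] by (simp add: cheb_moment_0)
  qed
qed

lemma cheb_moment_Catalan:
  "cheb_moment (Suc k) 0 = (\<Sum>i<k. cheb_moment i 0 * cheb_moment (k - 1 - i) 0)"
  using cheb_moment_convolution[of k 0] by (simp add: cheb_moment_Suc_0)

text \<open>In a word of ones each pair has weight \<open>\<tau> 2\<close>, that is a factor
  \<open>s\<close> for each of its two letters. After removing these factors, the recursion is the
  Catalan recursion of \<open>cheb_moment\<close>.\<close>

lemma limit_moment_replicate:
  assumes "\<tau> 2 = s\<^sup>2"
  shows "limit_moment \<tau> (replicate k 1) = s ^ k * cheb_moment k 0"
proof (induction k rule: less_induct)
  case (less k)
  show ?case
  proof (cases k)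
    case 0
    then show ?thesis by (simp add: cheb_moment_0)
  next
    case (Suc l)
    have "limit_moment \<tau> (replicate k 1) =
      (\<Sum>t<l. s\<^sup>2 * (limit_moment \<tau> (replicate t 1) * limit_moment \<tau> (replicate (l - 1 - t) 1)))"
      unfolding Suc replicate_Suc limit_moment.simps length_replicate
      using assms by (intro sum.cong refl) (auto simp: min_absorb1 numeral_2_eq_2)
    also have "\<dots> = (\<Sum>t<l. s ^ k * (cheb_moment t 0 * cheb_moment (l - 1 - t) 0))"
    proof (rule sum.cong[OF refl])
      fix t assume t: "t \<in> {..<l}"
      have "k = 2 + t + (l - 1 - t)" using t Suc by auto
      then have "s ^ k = s\<^sup>2 * s ^ t * s ^ (l - 1 - t)" by (metis power_add)
      moreover have "limit_moment \<tau> (replicate t 1) = s ^ t * cheb_moment t 0"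
        "limit_moment \<tau> (replicate (l - 1 - t) 1) = s ^ (l - 1 - t) * cheb_moment (l - 1 - t) 0"
        by (rule less, use t Suc in simp)+
      ultimately show "s\<^sup>2 * (limit_moment \<tau> (replicate t 1) * limit_moment \<tau> (replicate (l - 1 - t) 1)) =
        s ^ k * (cheb_moment t 0 * cheb_moment (l - 1 - t) 0)" by simp
    qed
    finally show ?thesis unfolding Suc cheb_moment_Catalan by (simp add: sum_distrib_left)
  qed
qed

text \<open>The integrand is at most \<open>2 ^ k\<close> and the interval has length pi. The bound
  is crude, but geometric growth is all that the method of moments asks for.\<close>

lemma cheb_moment_abs_le: "\<bar>cheb_moment k 0\<bar> \<le> 2 * 2 ^ k"
proof -
  have "norm (integral {0..pi} (\<lambda>\<theta>. (2 * cos \<theta>) ^ k * sin (real (0 + 1) * \<theta>) * sin \<theta>)) \<le> 2 ^ k * (pi - 0)"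
  proof (rule integral_bound)
    show "norm ((2 * cos t) ^ k * sin (real (0 + 1) * t) * sin t) \<le> 2 ^ k" for t
    proof -
      have "\<bar>2 * cos t\<bar> ^ k \<le> 2 ^ k" by (intro power_mono) (auto simp: abs_mult)
      moreover have "\<bar>sin t\<bar> * \<bar>sin t\<bar> \<le> 1 * 1" by (intro mult_mono) auto
      ultimately have "\<bar>2 * cos t\<bar> ^ k * (\<bar>sin t\<bar> * \<bar>sin t\<bar>) \<le> 2 ^ k * (1 * 1)"
        by (intro mult_mono) auto
      then show ?thesis by (simp add: abs_mult power_abs mult.assoc)
    qed
  qed (auto intro!: continuous_intros)
  then show ?thesis unfolding cheb_moment_def by (simp add: abs_mult field_simps)
qed

section \<open>The semicircle law as a measure\<close>

definition semicircle_density :: "real \<Rightarrow> real \<Rightarrow> real" where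
  "semicircle_density R x = 2 / (pi * R\<^sup>2) * sqrt (R\<^sup>2 - x\<^sup>2) * indicator {-R<..<R} x"

text \<open>The substitution \<open>x = R * cos \<theta>\<close> turns the density into
  \<open>2 / pi * (sin \<theta>)\<^sup>2\<close>.\<close>

lemma semicircle_moment:
  assumes R: "R > 0"
  shows "has_bochner_integral lborel (\<lambda>x. semicircle_density R x * x ^ k) ((R / 2) ^ k * cheb_moment k 0)"
proof -
  define f where "f x = 2 / (pi * R\<^sup>2) * sqrt (R\<^sup>2 - x\<^sup>2) * x ^ k" for x
  have cf: "continuous_on S f" for S unfolding f_def by (intro continuous_intros)
  \<comment> \<open>At the endpoints the square root vanishes, so the open interval may be
    closed.\<close>
  have eq: "semicircle_density R x * x ^ k = indicator {-R..R} x *\<^sub>R f x" for x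
    by (auto simp: semicircle_density_def f_def indicator_def not_less le_less)
  have int: "set_integrable lborel {-R..R} f" using cf by (rule borel_integrable_atLeastAtMost')
  \<comment> \<open>The cosine decreases from \<open>R\<close> to \<open>-R\<close>: the first
    integral is over an empty interval and equals 0, and the second enters with a minus sign that is
    removed below.\<close>
  have "((\<lambda>\<theta>. (- R * sin \<theta>) *\<^sub>R f (R * cos \<theta>)) has_integral
     (integral {R * cos 0..R * cos pi} f - integral {R * cos pi..R * cos 0} f)) {0..pi}"
  proof (rule has_integral_substitution_general[of "{}" _ _ _ "-R" R])
    show "(\<lambda>\<theta>. R * cos \<theta>) ` {0..pi} \<subseteq> {- R..R}"
    proof (rule image_subsetI)
      fix \<theta> :: real
      have "\<bar>R * cos \<theta>\<bar> \<le> R * 1"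
        unfolding abs_mult using R by (intro mult_mono) auto
      then show "R * cos \<theta> \<in> {- R..R}" by (simp add: abs_le_iff)
    qed
  qed (auto intro!: cf continuous_intros derivative_eq_intros)
  from has_integral_neg[OF this]
  have h: "((\<lambda>\<theta>. - ((- R * sin \<theta>) *\<^sub>R f (R * cos \<theta>))) has_integral integral {-R..R} f) {0..pi}"
    using R by simp
  have e: "- ((- R * sin \<theta>) *\<^sub>R f (R * cos \<theta>)) =
      (R / 2) ^ k * (2 / pi) * ((2 * cos \<theta>) ^ k * sin (real (0 + 1) * \<theta>) * sin \<theta>)" if "\<theta> \<in> {0..pi}" for \<theta>
  proof -
    have "R\<^sup>2 - (R * cos \<theta>)\<^sup>2 = R\<^sup>2 * (1 - (cos \<theta>)\<^sup>2)" by (simp add: power_mult_distrib algebra_simps)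
    also have "\<dots> = (R * sin \<theta>)\<^sup>2" by (simp add: sin_squared_eq power_mult_distrib)
    finally have r: "sqrt (R\<^sup>2 - (R * cos \<theta>)\<^sup>2) = R * sin \<theta>"
      using R that sin_ge_zero[of \<theta>] by simp
    have "- ((- R * sin \<theta>) *\<^sub>R f (R * cos \<theta>)) = R * sin \<theta> * (2 / (pi * R\<^sup>2) * (R * sin \<theta>) * (R * cos \<theta>) ^ k)"
      unfolding f_def r by simp
    also have "(R * cos \<theta>) ^ k = (R / 2) ^ k * (2 * cos \<theta>) ^ k"
      using power_mult_distrib[of "R / 2" "2 * cos \<theta>" k] by simp
    finally show ?thesis using R by (simp add: power2_eq_square)
  qed
  have "((\<lambda>\<theta>. (R / 2) ^ k * (2 / pi) * ((2 * cos \<theta>) ^ k * sin (real (0 + 1) * \<theta>) * sin \<theta>)) has_integral integral {-R..R} f) {0..pi}"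
    by (rule has_integral_eq[OF e h])
  then have "integral {-R..R} f = integral {0..pi} (\<lambda>\<theta>. (R / 2) ^ k * (2 / pi) * ((2 * cos \<theta>) ^ k * sin (real (0 + 1) * \<theta>) * sin \<theta>))"
    by (rule integral_unique[symmetric])
  also have "\<dots> = (R / 2) ^ k * cheb_moment k 0"
    by (simp only: integral_mult_right cheb_moment_def mult.assoc)
  finally have v: "integral {-R..R} f = (R / 2) ^ k * cheb_moment k 0" .
  show ?thesis unfolding eq has_bochner_integral_iff
    using int set_borel_integral_eq_integral(2)[OF int] v
    by (simp add: set_integrable_def set_lebesgue_integral_def)
qed

definition semicircle :: "real \<Rightarrow> real measure" where
  "semicircle R = density lborel (\<lambda>x. ennreal (semicircle_density R x))"

lemma semicircle_density_nonneg: "0 \<le> semicircle_density R x"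
proof (cases "x \<in> {-R<..<R}")
  case True
  then have "x\<^sup>2 \<le> R\<^sup>2" using abs_le_square_iff[of x R] by auto
  then show ?thesis by (simp add: semicircle_density_def)
qed (simp add: semicircle_density_def)

lemma borel_measurable_semicircle_density [measurable]: "semicircle_density R \<in> borel_measurable borel"
  unfolding semicircle_density_def[abs_def] by measurable

lemma real_distribution_semicircle:
  assumes R: "R > 0" shows "real_distribution (semicircle R)"
proof -
  have "(\<integral>\<^sup>+x. ennreal (semicircle_density R x) \<partial>lborel) = ennreal 1"
    using semicircle_moment[OF R, of 0] semicircle_density_nonneg
    by (subst nn_integral_eq_integral) (auto simp: has_bochner_integral_iff cheb_moment_0)
  then have "prob_space (semicircle R)"
    by (intro prob_spaceI) (simp add: semicircle_def emeasure_density)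
  then show ?thesis
    by (simp add: real_distribution_def real_distribution_axioms_def semicircle_def)
qed

lemma semicircle_moments:
  assumes R: "R > 0"
  shows "integrable (semicircle R) (\<lambda>x. x ^ k)" "(\<integral>x. x ^ k \<partial>semicircle R) = (R / 2) ^ k * cheb_moment k 0"
  using semicircle_moment[OF R, of k] semicircle_density_nonneg
  by (auto simp: semicircle_def integrable_density integral_density has_bochner_integral_iff)

lemma cdf_semicircle:
  assumes R: "R > 0"
  shows "cdf (semicircle R) x = (\<integral>t. indicator {..x} t * semicircle_density R t \<partial>lborel)"
proof -
  interpret real_distribution "semicircle R" using R by (rule real_distribution_semicircle)
  have "cdf (semicircle R) x = (\<integral>t. indicator {..x} t \<partial>semicircle R)" by (simp add: cdf_def)
  also have "\<dots> = (\<integral>t. semicircle_density R t * indicator {..x} t \<partial>lborel)"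
    unfolding semicircle_def using semicircle_density_nonneg by (subst integral_density) auto
  finally show ?thesis by (simp add: mult.commute)
qed

lemma isCont_cdf_semicircle:
  assumes R: "R > 0" shows "isCont (cdf (semicircle R)) x"
proof -
  interpret real_distribution "semicircle R" using R by (rule real_distribution_semicircle)
  have "AE t in lborel. t \<in> {x} \<longrightarrow> ennreal (semicircle_density R t) = 0"
    using AE_lborel_singleton[of x] by eventually_elim simp
  then have "{x} \<in> null_sets (semicircle R)"
    unfolding semicircle_def by (subst null_sets_density_iff) auto
  then show ?thesis unfolding isCont_cdf by (simp add: measure_eq_0_null_sets)
qed

section \<open>The method of moments\<close>

text \<open>By Levy's continuity theorem it suffices to compare characteristic functions. Both are
  close to their Taylor polynomials of a fixed degree \<open>K\<close>, whose coefficients are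
  moments and converge. The remainders are controlled by the moment of order \<open>K\<close>, so a
  growth bound is needed for the limit law only.\<close>

theorem weak_conv_moments:
  fixes \<mu> :: "nat \<Rightarrow> real measure" and \<nu> :: "real measure"
  assumes \<mu>: "\<And>n. real_distribution (\<mu> n)" and \<nu>: "real_distribution \<nu>"
    and int_\<mu>: "\<And>n k. integrable (\<mu> n) (\<lambda>x. x ^ k)" and int_\<nu>: "\<And>k. integrable \<nu> (\<lambda>x. x ^ k)"
    and lim: "\<And>k. (\<lambda>n. \<integral>x. x ^ k \<partial>\<mu> n) \<longlonglongrightarrow> (\<integral>x. x ^ k \<partial>\<nu>)"
    and bound: "\<And>k. (\<integral>x. x ^ k \<partial>\<nu>) \<le> B * R ^ k" and B: "B \<ge> 0" and R: "R \<ge> 0"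
  shows "weak_conv_m \<mu> \<nu>"
proof (rule levy_continuity[OF \<mu> \<nu>])
  fix t :: real
  show "(\<lambda>n. char (\<mu> n) t) \<longlonglongrightarrow> char \<nu> t"
  proof (rule LIMSEQ_I)
    fix \<epsilon> :: real assume \<epsilon>: "\<epsilon> > 0"
    \<comment> \<open>Two Taylor remainders, each with constant 2, give the factor 4.\<close>
    have "(\<lambda>k. 4 * B * (inverse (fact k) * (\<bar>t\<bar> * R) ^ k)) \<longlonglongrightarrow> 4 * B * 0"
      by (intro tendsto_mult tendsto_const summable_LIMSEQ_zero summable_exp)
    then have "eventually (\<lambda>k. 4 * B * (inverse (fact k) * (\<bar>t\<bar> * R) ^ k) < \<epsilon>) sequentially"
      using \<epsilon> by (intro order_tendstoD(2)[of _ "4 * B * 0"]) auto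
    then obtain l where l: "\<And>k. k \<ge> l \<Longrightarrow> 4 * B * (inverse (fact k) * (\<bar>t\<bar> * R) ^ k) < \<epsilon>"
      unfolding eventually_sequentially by auto
    \<comment> \<open>An even degree makes the absolute moment in the remainder an ordinary
      moment.\<close>
    define K where "K = 2 * l"
    have even: "even K" by (simp add: K_def)
    have K: "4 * B * (inverse (fact K) * (\<bar>t\<bar> * R) ^ K) < \<epsilon>" by (rule l) (simp add: K_def)
    define P where "P M = (\<Sum>k\<le>K. ((\<i> * t) ^ k / fact k) * complex_of_real (\<integral>x. x ^ k \<partial>M))" for M :: "real measure"
    have approx: "cmod (char M t - P M) \<le> 2 * \<bar>t\<bar> ^ K / fact K * (\<integral>x. x ^ K \<partial>M)"
      if "real_distribution M" "\<And>k. integrable M (\<lambda>x. x ^ k)" for M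
      using real_distribution.char_approx1[OF that(1), where n = K and t = t, OF that(2)] even by (simp add: P_def power_even_abs)
    define b where "b n = cmod (P (\<mu> n) - P \<nu>) + 2 * \<bar>t\<bar> ^ K / fact K * (\<integral>x. x ^ K \<partial>\<mu> n) +
      2 * \<bar>t\<bar> ^ K / fact K * (\<integral>x. x ^ K \<partial>\<nu>)" for n
    have "b \<longlonglongrightarrow> cmod (P \<nu> - P \<nu>) + 2 * \<bar>t\<bar> ^ K / fact K * (\<integral>x. x ^ K \<partial>\<nu>) +
      2 * \<bar>t\<bar> ^ K / fact K * (\<integral>x. x ^ K \<partial>\<nu>)"
      unfolding b_def[abs_def] P_def by (intro tendsto_intros lim)
    moreover have "cmod (P \<nu> - P \<nu>) + 2 * \<bar>t\<bar> ^ K / fact K * (\<integral>x. x ^ K \<partial>\<nu>) +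
      2 * \<bar>t\<bar> ^ K / fact K * (\<integral>x. x ^ K \<partial>\<nu>) < \<epsilon>"
    proof -
      have "4 * \<bar>t\<bar> ^ K / fact K * (\<integral>x. x ^ K \<partial>\<nu>) \<le> 4 * \<bar>t\<bar> ^ K / fact K * (B * R ^ K)"
        by (intro mult_left_mono bound) auto
      also have "\<dots> = 4 * B * (inverse (fact K) * (\<bar>t\<bar> * R) ^ K)"
        unfolding power_mult_distrib by (simp add: field_simps)
      finally show ?thesis using K by simp
    qed
    ultimately have "eventually (\<lambda>n. b n < \<epsilon>) sequentially" by (rule order_tendstoD(2))
    then obtain N where N: "\<And>n. n \<ge> N \<Longrightarrow> b n < \<epsilon>" unfolding eventually_sequentially by auto
    show "\<exists>N. \<forall>n\<ge>N. cmod (char (\<mu> n) t - char \<nu> t) < \<epsilon>"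
    proof (intro exI allI impI)
      fix n assume "N \<le> n"
      have "cmod (char (\<mu> n) t - char \<nu> t) \<le> cmod (char (\<mu> n) t - P (\<mu> n)) + cmod (P (\<mu> n) - P \<nu>) + cmod (P \<nu> - char \<nu> t)"
        using norm_triangle_ineq[of "char (\<mu> n) t - P (\<mu> n) + (P (\<mu> n) - P \<nu>)" "P \<nu> - char \<nu> t"]
          norm_triangle_ineq[of "char (\<mu> n) t - P (\<mu> n)" "P (\<mu> n) - P \<nu>"] by simp
      also have "\<dots> \<le> b n"
        using approx[OF \<mu> int_\<mu>, of n] approx[OF \<nu> int_\<nu>] by (simp add: b_def norm_minus_commute)
      also have "\<dots> < \<epsilon>" by (rule N) fact
      finally show "cmod (char (\<mu> n) t - char \<nu> t) < \<epsilon>" .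
    qed
  qed
qed

theorem ecdf_tendsto_semicircle:
  fixes y :: "nat \<Rightarrow> nat \<Rightarrow> real"
  assumes R: "R > 0"
    and lim: "\<And>k. (\<lambda>n. (\<Sum>i<n. y n i ^ k) / real n) \<longlonglongrightarrow> (R / 2) ^ k * cheb_moment k 0"
  shows "(\<lambda>n. ecdf n (y n) x) \<longlonglongrightarrow> cdf (semicircle R) x"
proof -
  \<comment> \<open>The empirical measure, shifted by one because \<open>{..<0}\<close> carries no
    uniform distribution.\<close>
  define \<mu> where "\<mu> n = distr (measure_pmf (pmf_of_set {..<Suc n})) borel (y (Suc n))" for n
  have f: "finite {..<Suc n}" "{..<Suc n} \<noteq> {}" for n by auto
  have rd: "real_distribution (\<mu> n)" for n
    unfolding \<mu>_def by (intro prob_space.real_distribution_distr measure_pmf.prob_space_axioms) auto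
  have int: "(\<integral>t. h t \<partial>\<mu> n) = (\<Sum>i<Suc n. h (y (Suc n) i)) / real (Suc n)"
    if "h \<in> borel_measurable borel" for h :: "real \<Rightarrow> real" and n
    unfolding \<mu>_def using that by (subst integral_distr) (auto simp: integral_pmf_of_set[OF f(2,1)])
  have "weak_conv_m \<mu> (semicircle R)"
  proof (rule weak_conv_moments)
    show "integrable (\<mu> n) (\<lambda>x. x ^ k)" for n k
      unfolding \<mu>_def by (subst integrable_distr_eq) (auto intro!: integrable_measure_pmf_finite simp: set_pmf_of_set[OF f(2,1)])
    show "(\<lambda>n. \<integral>x. x ^ k \<partial>\<mu> n) \<longlonglongrightarrow> (\<integral>x. x ^ k \<partial>semicircle R)" for k
      using LIMSEQ_Suc[OF lim[of k]] by (simp add: int semicircle_moments[OF R] del: sum.lessThan_Suc of_nat_Suc)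
    show "(\<integral>x. x ^ k \<partial>semicircle R) \<le> 2 * R ^ k" for k
    proof -
      have "(R / 2) ^ k * cheb_moment k 0 \<le> (R / 2) ^ k * (2 * 2 ^ k)"
        using cheb_moment_abs_le[of k] R by (intro mult_left_mono) auto
      then show ?thesis by (simp add: semicircle_moments[OF R] power_divide)
    qed
  qed (use R rd real_distribution_semicircle semicircle_moments in auto)
  then have "(\<lambda>n. cdf (\<mu> n) x) \<longlonglongrightarrow> cdf (semicircle R) x"
    using isCont_cdf_semicircle[OF R] by (simp add: weak_conv_m_def weak_conv_def)
  moreover have "cdf (\<mu> n) x = ecdf (Suc n) (y (Suc n)) x" for n
  proof -
    interpret real_distribution "\<mu> n" by (rule rd)
    have "cdf (\<mu> n) x = (\<integral>t. indicator {..x} t \<partial>\<mu> n)" by (simp add: cdf_def)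
    then show ?thesis by (simp add: int ecdf_def indicator_def sum.If_cases lessThan_def Collect_conj_eq del: sum.lessThan_Suc)
  qed
  ultimately show ?thesis by (auto intro: LIMSEQ_imp_Suc)
qed

section \<open>The spectral theorem for real symmetric matrices\<close>

lemma symmetric_bilinear:
  fixes A :: "real mat"
  assumes A: "A \<in> carrier_mat n n" and sym: "A\<^sup>T = A" and x: "x \<in> carrier_vec n" and y: "y \<in> carrier_vec n"
  shows "x \<bullet> (A *\<^sub>v y) = (A *\<^sub>v x) \<bullet> y"
  using transpose_vec_mult_scalar[OF A y x] sym by simp

lemma transpose_sandwich:
  fixes A :: "'a :: comm_semiring_0 mat"
  assumes A: "A \<in> carrier_mat n n" and sym: "A\<^sup>T = A" and P: "P \<in> carrier_mat n n"
  shows "(P\<^sup>T * (A * P))\<^sup>T = P\<^sup>T * (A * P)"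
proof -
  have PT: "P\<^sup>T \<in> carrier_mat n n" using P by simp
  have "(P\<^sup>T * (A * P))\<^sup>T = (A * P)\<^sup>T * P\<^sup>T\<^sup>T"
    by (rule transpose_mult[OF PT mult_carrier_mat[OF A P]])
  also have "(A * P)\<^sup>T = P\<^sup>T * A" using transpose_mult[OF A P] sym by simp
  also have "P\<^sup>T * A * P\<^sup>T\<^sup>T = P\<^sup>T * (A * P)" using assoc_mult_mat[OF PT A P] by simp
  finally show ?thesis .
qed

lemma scalar_prod_self_nonneg: "0 \<le> (x :: real vec) \<bullet> x"
  by (simp add: scalar_prod_def sum_nonneg)

text \<open>A complex eigenvector \<open>x + \<i> y\<close> with eigenvalue
  \<open>a + \<i> b\<close> always exists. Evaluating \<open>x \<bullet> (A *\<^sub>v y)\<close> in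
  two ways by symmetry gives \<open>b * (x \<bullet> x + y \<bullet> y) = 0\<close>, so
  \<open>b = 0\<close> and whichever of \<open>x\<close>, \<open>y\<close> is nonzero is a real
  eigenvector.\<close>

lemma real_symmetric_eigenvector:
  fixes A :: "real mat"
  assumes A: "A \<in> carrier_mat n n" and sym: "A\<^sup>T = A" and n: "n > 0"
  obtains v e where "v \<in> carrier_vec n" "v \<noteq> 0\<^sub>v n" "A *\<^sub>v v = e \<cdot>\<^sub>v v"
proof -
  let ?C = "map_mat complex_of_real A"
  have C: "?C \<in> carrier_mat n n" using A by simp
  obtain k where "k \<in> spectrum ?C" using spectrum_non_empty[OF C] n by auto
  then obtain v where v: "v \<in> carrier_vec n" "v \<noteq> 0\<^sub>v n" "?C *\<^sub>v v = k \<cdot>\<^sub>v v"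
    using A by (auto simp: spectrum_def eigenvalue_def eigenvector_def)
  define x where "x = map_vec Re v"
  define y where "y = map_vec Im v"
  define a where "a = Re k"
  define b where "b = Im k"
  have xy: "x \<in> carrier_vec n" "y \<in> carrier_vec n" using v by (auto simp: x_def y_def)
  have eq: "(?C *\<^sub>v v) $ i = (k \<cdot>\<^sub>v v) $ i" for i using v(3) by simp
  have Cv: "(?C *\<^sub>v v) $ i = complex_of_real ((A *\<^sub>v x) $ i) + \<i> * complex_of_real ((A *\<^sub>v y) $ i)" if "i < n" for i
    using that A v(1) by (simp add: scalar_prod_def complex_eq_iff x_def y_def row_def)
  have Ax: "(A *\<^sub>v x) $ i = a * x $ i - b * y $ i" and Ay: "(A *\<^sub>v y) $ i = a * y $ i + b * x $ i" if "i < n" for i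
    using eq[of i] v(1) that unfolding Cv[OF that] by (simp_all add: complex_eq_iff x_def y_def a_def b_def)
  have "x \<bullet> (A *\<^sub>v y) = (\<Sum>i = 0..<n. x $ i * (a * y $ i + b * x $ i))"
    unfolding scalar_prod_def using xy A Ay by (intro sum.cong) auto
  also have "\<dots> = a * (x \<bullet> y) + b * (x \<bullet> x)"
    unfolding scalar_prod_def using xy by (simp add: sum_distrib_left sum.distrib distrib_left ac_simps)
  finally have "x \<bullet> (A *\<^sub>v y) = a * (x \<bullet> y) + b * (x \<bullet> x)" .
  moreover have "(A *\<^sub>v x) \<bullet> y = a * (x \<bullet> y) - b * (y \<bullet> y)"
  proof -
    have "(A *\<^sub>v x) \<bullet> y = (\<Sum>i = 0..<n. (a * x $ i - b * y $ i) * y $ i)"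
      unfolding scalar_prod_def using xy A Ax by (intro sum.cong) auto
    also have "\<dots> = a * (x \<bullet> y) - b * (y \<bullet> y)"
      unfolding scalar_prod_def using xy by (simp add: sum_distrib_left sum_subtractf left_diff_distrib right_diff_distrib ac_simps)
    finally show ?thesis .
  qed
  ultimately have b: "b * (x \<bullet> x + y \<bullet> y) = 0"
    using symmetric_bilinear[OF A sym xy] by (simp add: algebra_simps)
  have nz: "x \<noteq> 0\<^sub>v n \<or> y \<noteq> 0\<^sub>v n"
  proof (rule ccontr)
    assume "\<not> ?thesis"
    then have "Re (v $ i) = 0 \<and> Im (v $ i) = 0" if "i < n" for i
      using that v(1) unfolding x_def y_def by (metis carrier_vecD index_map_vec(1) index_zero_vec(1))
    then have "v = 0\<^sub>v n" using v(1) by (intro eq_vecI) (auto simp: complex_eq_iff)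
    with v(2) show False by simp
  qed
  have "x \<bullet> x + y \<bullet> y > 0"
    using nz xy scalar_prod_self_nonneg[of x] scalar_prod_self_nonneg[of y]
      conjugate_square_greater_0_vec[OF xy(1)] conjugate_square_greater_0_vec[OF xy(2)]
    by (auto simp: conjugate_vec_def)
  with b have b0: "b = 0" by simp
  have "A *\<^sub>v x = a \<cdot>\<^sub>v x" "A *\<^sub>v y = a \<cdot>\<^sub>v y"
    using Ax Ay b0 A xy by (auto intro!: eq_vecI)
  with nz xy that show thesis by blast
qed

text \<open>Complete \<open>v\<close> to a basis, orthogonalize by Gram-Schmidt, which keeps the
  first vector, and normalize the columns.\<close>

lemma orthogonal_completion:
  fixes v :: "real vec"
  assumes v: "v \<in> carrier_vec n" "v \<noteq> 0\<^sub>v n" and n: "n > 0"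
  obtains W c where "W \<in> carrier_mat n n" "W\<^sup>T * W = 1\<^sub>m n" "col W 0 = c \<cdot>\<^sub>v v"
proof -
  interpret cof_vec_space n "TYPE(real)" .
  define b where "b = basis_completion v"
  define ws where "ws = gram_schmidt n b"
  from basis_completion[OF v, folded b_def]
  have bb: "distinct b" "\<not> lin_dep (set b)" "set b \<subseteq> carrier_vec n" "hd b = v" "length b = n" by auto
  then obtain vs where bv: "b = v # vs" using n by (cases b) auto
  from gram_schmidt_result[OF bb(3,1,2) refl, folded ws_def]
  have ws: "set ws \<subseteq> carrier_vec n" "corthogonal ws" "length ws = n" by (auto simp: bb)
  from gram_schmidt_hd[OF v(1), of vs, folded bv] have hdws: "hd ws = v" unfolding ws_def .
  define s where "s j = sqrt (ws ! j \<bullet> ws ! j)" for j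
  define W where "W = mat n n (\<lambda>(i, j). (ws ! j) $ i / s j)"
  have wj: "ws ! j \<in> carrier_vec n" if "j < n" for j using that ws by auto
  have dot: "(ws ! i \<bullet> ws ! j = 0) = (i \<noteq> j)" if "i < n" "j < n" for i j
    using corthogonalD[OF ws(2), of i j] that ws(3) by (simp add: conjugate_vec_def)
  have s: "s j * s j = ws ! j \<bullet> ws ! j" "s j \<noteq> 0" if "j < n" for j
    using dot[OF that that] scalar_prod_self_nonneg[of "ws ! j"] by (auto simp: s_def)
  show thesis
  proof (rule that)
    show W: "W \<in> carrier_mat n n" by (simp add: W_def)
    show "W\<^sup>T * W = 1\<^sub>m n"
    proof (rule eq_matI)
      fix i j assume "i < dim_row (1\<^sub>m n)" "j < dim_col (1\<^sub>m n)"
      then have ij: "i < n" "j < n" by auto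
      have "(W\<^sup>T * W) $$ (i, j) = (ws ! i \<bullet> ws ! j) / (s i * s j)"
        using ij wj[OF ij(1)] wj[OF ij(2)] by (simp add: W_def scalar_prod_def sum_divide_distrib)
      then show "(W\<^sup>T * W) $$ (i, j) = 1\<^sub>m n $$ (i, j)"
        using ij dot[OF ij] s[OF ij(1)] by auto
    qed (auto simp: W_def)
    show "col W 0 = (1 / s 0) \<cdot>\<^sub>v v"
      using n hdws ws wj[of 0] hd_conv_nth[of ws] by (intro eq_vecI) (auto simp: W_def)
  qed
qed

text \<open>Deflation: in an orthonormal basis whose first vector is an eigenvector, the first
  column of the matrix vanishes below the diagonal, and by symmetry so does the first row. The
  remaining block is symmetric of size \<open>n\<close>; its diagonalization is the induction
  hypothesis \<open>IH\<close>.\<close>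

lemma real_spectral_theorem_step:
  fixes A :: "real mat"
  assumes A: "A \<in> carrier_mat (Suc n) (Suc n)" and sym: "A\<^sup>T = A"
    and IH: "\<And>B. B \<in> carrier_mat n n \<Longrightarrow> B\<^sup>T = B \<Longrightarrow>
      \<exists>V d. V \<in> carrier_mat n n \<and> V\<^sup>T * V = 1\<^sub>m n \<and> V * V\<^sup>T = 1\<^sub>m n \<and> B = V * mat_diag n d * (V\<^sup>T :: real mat)"
  obtains U d where "U \<in> carrier_mat (Suc n) (Suc n)" "U\<^sup>T * U = 1\<^sub>m (Suc n)" "U * U\<^sup>T = 1\<^sub>m (Suc n)"
    "A = U * mat_diag (Suc n) d * U\<^sup>T"
proof -
  obtain v e where v: "v \<in> carrier_vec (Suc n)" "v \<noteq> 0\<^sub>v (Suc n)" "A *\<^sub>v v = e \<cdot>\<^sub>v v"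
    using real_symmetric_eigenvector[OF A sym] by auto
  obtain W c where W: "W \<in> carrier_mat (Suc n) (Suc n)" "W\<^sup>T * W = 1\<^sub>m (Suc n)" "col W 0 = c \<cdot>\<^sub>v v"
    using orthogonal_completion[OF v(1,2)] by auto
  have WT: "W\<^sup>T \<in> carrier_mat (Suc n) (Suc n)" using W(1) by simp
  have WW: "W * W\<^sup>T = 1\<^sub>m (Suc n)" using mat_mult_left_right_inverse[OF WT W(1) W(2)] .
  define A' where "A' = W\<^sup>T * (A * W)"
  have A': "A' \<in> carrier_mat (Suc n) (Suc n)" unfolding A'_def using W(1) A WT by auto
  have symA': "A'\<^sup>T = A'"
    unfolding A'_def by (rule transpose_sandwich[OF A sym W(1)])
  have Ac: "A *\<^sub>v col W 0 = e \<cdot>\<^sub>v col W 0"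
    unfolding W(3) using v A by (simp add: mult_mat_vec smult_smult_assoc mult.commute)
  have A'0: "A' $$ (i, 0) = (if i = 0 then e else 0)" if i: "i < Suc n" for i
  proof -
    have "A' $$ (i, 0) = col W i \<bullet> (A *\<^sub>v col W 0)"
    proof -
      have "A' $$ (i, 0) = row W\<^sup>T i \<bullet> col (A * W) 0"
        unfolding A'_def using i W(1) A by simp
      also have "col (A * W) 0 = A *\<^sub>v col W 0" using W(1) A by (intro col_mult2) auto
      finally show ?thesis using i W(1) by simp
    qed
    also have "\<dots> = e * (col W i \<bullet> col W 0)" unfolding Ac using W(1) by simp
    also have "col W i \<bullet> col W 0 = (W\<^sup>T * W) $$ (i, 0)" using i W(1) by simp
    finally show ?thesis unfolding W(2) using i by simp
  qed
  have A'0': "A' $$ (0, i) = (if i = 0 then e else 0)" if i: "i < Suc n" for i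
    using A'0[OF i] arg_cong[OF symA', of "\<lambda>B. B $$ (0, i)"] A' i by simp
  define B where "B = mat n n (\<lambda>(i, j). A' $$ (Suc i, Suc j))"
  have B: "B \<in> carrier_mat n n" by (simp add: B_def)
  have symB: "B\<^sup>T = B"
  proof (rule eq_matI)
    fix i j assume "i < dim_row B" "j < dim_col B"
    then have ij: "i < n" "j < n" by (auto simp: B_def)
    show "B\<^sup>T $$ (i, j) = B $$ (i, j)"
      using ij arg_cong[OF symA', of "\<lambda>M. M $$ (Suc i, Suc j)"] A' by (simp add: B_def)
  qed (auto simp: B_def)
  obtain V d where V: "V \<in> carrier_mat n n" "V\<^sup>T * V = 1\<^sub>m n" "V * V\<^sup>T = 1\<^sub>m n" "B = V * mat_diag n d * V\<^sup>T"
    using IH[OF B symB] by blast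
  define E where "E = mat 1 1 (\<lambda>_. e)"
  define V' where "V' = four_block_mat (1\<^sub>m 1) (0\<^sub>m 1 n) (0\<^sub>m n 1) V"
  define d' where "d' i = (case i of 0 \<Rightarrow> e | Suc k \<Rightarrow> d k)" for i
  have A'4: "A' = four_block_mat E (0\<^sub>m 1 n) (0\<^sub>m n 1) B"
  proof (rule eq_matI)
    fix i j assume "i < dim_row (four_block_mat E (0\<^sub>m 1 n) (0\<^sub>m n 1) B)" "j < dim_col (four_block_mat E (0\<^sub>m 1 n) (0\<^sub>m n 1) B)"
    then have ij: "i < Suc n" "j < Suc n" by (auto simp: E_def B_def)
    show "A' $$ (i, j) = four_block_mat E (0\<^sub>m 1 n) (0\<^sub>m n 1) B $$ (i, j)"
      using ij A'0[of i] A'0'[of j] by (cases i; cases j) (auto simp: E_def B_def)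
  qed (use A' in \<open>auto simp: E_def B_def\<close>)
  have D4: "mat_diag (Suc n) d' = four_block_mat E (0\<^sub>m 1 n) (0\<^sub>m n 1) (mat_diag n d)"
  proof (rule eq_matI)
    fix i j assume "i < dim_row (four_block_mat E (0\<^sub>m 1 n) (0\<^sub>m n 1) (mat_diag n d))"
      "j < dim_col (four_block_mat E (0\<^sub>m 1 n) (0\<^sub>m n 1) (mat_diag n d))"
    then have ij: "i < Suc n" "j < Suc n" by (auto simp: E_def mat_diag_def)
    show "mat_diag (Suc n) d' $$ (i, j) = four_block_mat E (0\<^sub>m 1 n) (0\<^sub>m n 1) (mat_diag n d) $$ (i, j)"
      using ij by (cases i; cases j) (auto simp: E_def mat_diag_def d'_def)
  qed (auto simp: E_def mat_diag_def)
  have E: "E \<in> carrier_mat 1 1" by (simp add: E_def)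
  have V': "V' \<in> carrier_mat (Suc n) (Suc n)" using V by (auto simp: V'_def)
  have V'T: "V'\<^sup>T = four_block_mat (1\<^sub>m 1) (0\<^sub>m 1 n) (0\<^sub>m n 1) V\<^sup>T"
    unfolding V'_def using V by (subst transpose_four_block_mat[of _ 1 1 _ n _ n]) auto
  have mul: "four_block_mat P (0\<^sub>m 1 n) (0\<^sub>m n 1) Q * four_block_mat P' (0\<^sub>m 1 n) (0\<^sub>m n 1) Q' =
    four_block_mat (P * P') (0\<^sub>m 1 n) (0\<^sub>m n 1) (Q * Q')"
    if "P \<in> carrier_mat 1 1" "P' \<in> carrier_mat 1 1" "Q \<in> carrier_mat n n" "Q' \<in> carrier_mat n n" for P P' Q Q' :: "real mat"
    using that by (subst mult_four_block_mat[of _ 1 1 _ n _ n _ _ 1 _ n]) auto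
  have VTc: "V\<^sup>T \<in> carrier_mat n n" using V by simp
  have VV: "V'\<^sup>T * V' = 1\<^sub>m (Suc n)" "V' * V'\<^sup>T = 1\<^sub>m (Suc n)"
    unfolding V'T unfolding V'_def
    unfolding mul[OF one_carrier_mat one_carrier_mat VTc V(1)] mul[OF one_carrier_mat one_carrier_mat V(1) VTc] V(2,3)
    using four_block_one_mat[of 1 n] by simp_all
  have A'V: "A' = V' * mat_diag (Suc n) d' * V'\<^sup>T"
    unfolding D4 V'T unfolding V'_def mul[OF one_carrier_mat E V(1) mat_diag_dim]
      left_mult_one_mat[OF E] mul[OF E one_carrier_mat mult_carrier_mat[OF V(1) mat_diag_dim] VTc]
      right_mult_one_mat[OF E] V(4)[symmetric] A'4 ..
  define U where "U = W * V'"
  have U: "U \<in> carrier_mat (Suc n) (Suc n)" using W(1) V' by (auto simp: U_def)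
  have V'Tc: "V'\<^sup>T \<in> carrier_mat (Suc n) (Suc n)" using V' by simp
  note as = assoc_mult_mat[of _ "Suc n" "Suc n" _ "Suc n" _ "Suc n"]
  have UT: "U\<^sup>T = V'\<^sup>T * W\<^sup>T" unfolding U_def by (rule transpose_mult[OF W(1) V'])
  have UTU: "U\<^sup>T * U = 1\<^sub>m (Suc n)"
  proof -
    have "U\<^sup>T * U = V'\<^sup>T * ((W\<^sup>T * W) * V')" unfolding UT unfolding U_def using W(1) WT V' V'Tc by (simp add: as)
    then show ?thesis unfolding W(2) using V' VV by simp
  qed
  have UTc: "U\<^sup>T \<in> carrier_mat (Suc n) (Suc n)" using U by simp
  have "A = (W * W\<^sup>T) * A * (W * W\<^sup>T)" unfolding WW using A by simp
  also have "\<dots> = W * A' * W\<^sup>T" unfolding A'_def using W(1) WT A by (simp add: as)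
  also have "\<dots> = U * mat_diag (Suc n) d' * U\<^sup>T"
    unfolding A'V UT unfolding U_def using W(1) WT V' V'Tc by (simp add: as mult_carrier_mat[of _ "Suc n" "Suc n" _ "Suc n"])
  finally have "A = U * mat_diag (Suc n) d' * U\<^sup>T" .
  with U UTU mat_mult_left_right_inverse[OF UTc U UTU] show thesis by (rule that)
qed

theorem real_spectral_theorem:
  fixes A :: "real mat"
  assumes "A \<in> carrier_mat n n" and "A\<^sup>T = A"
  shows "\<exists>U d. U \<in> carrier_mat n n \<and> U\<^sup>T * U = 1\<^sub>m n \<and> U * U\<^sup>T = 1\<^sub>m n \<and> A = U * mat_diag n d * U\<^sup>T"
  using assms
proof (induction n arbitrary: A)
  case 0
  then show ?case by (intro exI[of _ "1\<^sub>m 0"] exI[of _ "\<lambda>_. 0"]) (auto intro!: eq_matI)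
next
  case (Suc n)
  obtain U d where "U \<in> carrier_mat (Suc n) (Suc n)" "U\<^sup>T * U = 1\<^sub>m (Suc n)" "U * U\<^sup>T = 1\<^sub>m (Suc n)"
    "A = U * mat_diag (Suc n) d * U\<^sup>T"
    using real_spectral_theorem_step[OF Suc.prems Suc.IH] by metis
  then show ?case by (intro exI[of _ U] exI[of _ d] conjI)
qed

section \<open>Sylvester's law of inertia\<close>

lemma index_sandwich:
  fixes U :: "'a :: comm_semiring_0 mat"
  assumes U: "U \<in> carrier_mat n n" and pq: "p < n" "q < n"
  shows "(U * mat_diag n f * U\<^sup>T) $$ (p, q) = (\<Sum>i<n. U $$ (p, i) * f i * U $$ (q, i))"
proof -
  have "(U * mat_diag n f * U\<^sup>T) $$ (p, q) = (\<Sum>i = 0..<n. U $$ (p, i) * f i * U $$ (q, i))"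
    unfolding mat_diag_mult_right[OF U] using U pq by (simp add: scalar_prod_def)
  then show ?thesis by (simp add: atLeast0LessThan)
qed

lemma quadratic_form_sandwich:
  fixes S :: "real mat"
  assumes S: "S \<in> carrier_mat n n" and x: "x \<in> carrier_vec n"
  shows "x \<bullet> ((S * mat_diag n a * S\<^sup>T) *\<^sub>v x) = (\<Sum>i<n. a i * ((S\<^sup>T *\<^sub>v x) $ i)\<^sup>2)"
proof -
  define y where "y = S\<^sup>T *\<^sub>v x"
  have y: "y \<in> carrier_vec n" using S x by (simp add: y_def)
  have ST: "S\<^sup>T \<in> carrier_mat n n" using S by simp
  have "(S * mat_diag n a * S\<^sup>T) *\<^sub>v x = S *\<^sub>v (mat_diag n a *\<^sub>v y)"
    unfolding y_def using S ST x
    by (simp add: assoc_mult_mat_vec[of _ n n _ n] mult_carrier_mat[of _ n n _ n])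
  then have "x \<bullet> ((S * mat_diag n a * S\<^sup>T) *\<^sub>v x) = y \<bullet> (mat_diag n a *\<^sub>v y)"
    unfolding y_def using transpose_vec_mult_scalar[OF S _ x, of "mat_diag n a *\<^sub>v y"] y
    by (simp add: y_def mult_mat_vec_carrier[OF mat_diag_dim])
  also have "\<dots> = (\<Sum>i<n. y $ i * (a i * y $ i))"
  proof -
    have "(mat_diag n a *\<^sub>v y) $ i = a i * y $ i" if "i < n" for i
    proof -
      have "(mat_diag n a *\<^sub>v y) $ i = (\<Sum>j = 0..<n. (if i = j then a j else 0) * y $ j)"
        using that y by (simp add: mat_diag_def scalar_prod_def)
      also have "\<dots> = (\<Sum>j = 0..<n. if i = j then a j * y $ j else 0)" by (intro sum.cong) auto
      finally show ?thesis using that by simp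
    qed
    then show ?thesis using y by (simp add: scalar_prod_def atLeast0LessThan mat_diag_def)
  qed
  finally show ?thesis by (simp add: y_def power2_eq_square ac_simps)
qed

text \<open>Stack the vectors as rows and pad with zero rows to a square matrix. Its last row is
  zero because \<open>length L < n\<close>, so the determinant vanishes and a kernel vector
  exists.\<close>

lemma common_orthogonal_vector:
  fixes L :: "real vec list"
  assumes L: "length L < n"
  obtains v where "v \<in> carrier_vec n" "v \<noteq> 0\<^sub>v n" "\<And>w. w \<in> set L \<Longrightarrow> w \<in> carrier_vec n \<Longrightarrow> w \<bullet> v = 0"
proof -
  define E where "E = mat n n (\<lambda>(i, j). if i < length L then (L ! i) $ j else 0)"
  have E: "E \<in> carrier_mat n n" by (simp add: E_def)
  have "det E = (\<Sum>j<n. E $$ (n - 1, j) * cofactor E (n - 1) j)"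
    by (rule laplace_expansion_row[OF E]) (use L in auto)
  also have "\<dots> = 0" using L by (intro sum.neutral) (auto simp: E_def)
  finally obtain v where v: "v \<in> carrier_vec n" "v \<noteq> 0\<^sub>v n" "E *\<^sub>v v = 0\<^sub>v n"
    using det_0_iff_vec_prod_zero_field[OF E] by auto
  show thesis
  proof (rule that[OF v(1,2)])
    fix w assume w: "w \<in> set L" "w \<in> carrier_vec n"
    then obtain i where i: "i < length L" "L ! i = w" by (auto simp: in_set_conv_nth)
    have "w = row E i" using i w L by (intro eq_vecI) (auto simp: E_def)
    moreover have "(E *\<^sub>v v) $ i = row E i \<bullet> v" using i L E by simp
    moreover have "(E *\<^sub>v v) $ i = 0" using v(3) i L by simp
    ultimately show "w \<bullet> v = 0" by simp
  qed
qed

text \<open>Otherwise a dimension count yields \<open>v \<noteq> 0\<close> orthogonal to the columns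
  of \<open>S\<close> with \<open>a i > 0\<close> and to those of \<open>U\<close> with
  \<open>b i \<le> 0\<close>. The common quadratic form at \<open>v\<close> is then both nonpositive
  and nonnegative, hence 0, so \<open>U\<^sup>T *\<^sub>v v\<close> vanishes also where
  \<open>b i > 0\<close>, against invertibility of \<open>U\<close>.\<close>

lemma inertia_le:
  fixes S U :: "real mat"
  assumes S: "S \<in> carrier_mat n n" and U: "U \<in> carrier_mat n n"
    and U': "U' \<in> carrier_mat n n" "U * U' = 1\<^sub>m n"
    and eq: "S * mat_diag n a * S\<^sup>T = U * mat_diag n b * U\<^sup>T"
  shows "card {i. i < n \<and> a i \<le> 0} + card {i. i < n \<and> b i > 0} \<le> n"
proof (rule ccontr)
  assume c: "\<not> ?thesis"
  define La where "La = filter (\<lambda>i. a i > 0) [0..<n]"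
  define Lb where "Lb = filter (\<lambda>i. b i \<le> 0) [0..<n]"
  have len: "length La = card {i. i < n \<and> a i > 0}" "length Lb = card {i. i < n \<and> b i \<le> 0}"
    unfolding La_def Lb_def by (auto simp: length_filter_conv_card intro!: arg_cong[of _ _ card])
  have "card {i. i < n \<and> a i > 0} + card {i. i < n \<and> a i \<le> 0} = n"
    "card {i. i < n \<and> b i > 0} + card {i. i < n \<and> b i \<le> 0} = n"
    by (subst card_Un_disjoint[symmetric], simp, simp, force, subst (5) card_lessThan[symmetric], rule arg_cong[of _ _ card], force)+
  \<comment> \<open>The two index sets are the complements of those in \<open>c\<close>, whose sizes
    add up to more than \<open>n\<close>; so theirs add up to less than \<open>n\<close>.\<close>
  then have "length (map (col S) La @ map (col U) Lb) < n" using c len by simp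
  then obtain v where v: "v \<in> carrier_vec n" "v \<noteq> 0\<^sub>v n"
    and orth: "\<And>w. w \<in> set (map (col S) La @ map (col U) Lb) \<Longrightarrow> w \<in> carrier_vec n \<Longrightarrow> w \<bullet> v = 0"
    using common_orthogonal_vector by blast
  have Sv: "(S\<^sup>T *\<^sub>v v) $ i = 0" if "i < n" "a i > 0" for i
    using orth[of "col S i"] that S by (auto simp: La_def)
  have Uv: "(U\<^sup>T *\<^sub>v v) $ i = 0" if "i < n" "b i \<le> 0" for i
    using orth[of "col U i"] that U by (auto simp: Lb_def)
  have le: "(\<Sum>i<n. a i * ((S\<^sup>T *\<^sub>v v) $ i)\<^sup>2) \<le> 0"
  proof (rule sum_nonpos)
    fix i assume "i \<in> {..<n}"
    then show "a i * ((S\<^sup>T *\<^sub>v v) $ i)\<^sup>2 \<le> 0"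
      using Sv[of i] by (cases "a i > 0") (auto simp: mult_nonpos_nonneg)
  qed
  have ge: "0 \<le> b i * ((U\<^sup>T *\<^sub>v v) $ i)\<^sup>2" if "i < n" for i
    using Uv[OF that] by (cases "b i \<le> 0") auto
  have "(\<Sum>i<n. a i * ((S\<^sup>T *\<^sub>v v) $ i)\<^sup>2) = (\<Sum>i<n. b i * ((U\<^sup>T *\<^sub>v v) $ i)\<^sup>2)"
    unfolding quadratic_form_sandwich[OF S v(1), symmetric] quadratic_form_sandwich[OF U v(1), symmetric] eq ..
  with le have "(\<Sum>i<n. b i * ((U\<^sup>T *\<^sub>v v) $ i)\<^sup>2) \<le> 0" by simp
  moreover have "(\<Sum>i<n. b i * ((U\<^sup>T *\<^sub>v v) $ i)\<^sup>2) \<ge> 0" by (intro sum_nonneg ge) auto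
  ultimately have "(\<Sum>i<n. b i * ((U\<^sup>T *\<^sub>v v) $ i)\<^sup>2) = 0" by simp
  then have z: "b i * ((U\<^sup>T *\<^sub>v v) $ i)\<^sup>2 = 0" if "i < n" for i
    using that ge by (subst (asm) sum_nonneg_eq_0_iff) auto
  have "(U\<^sup>T *\<^sub>v v) $ i = 0" if "i < n" for i
    using z[OF that] Uv[OF that] by (cases "b i \<le> 0") auto
  then have Uv0: "U\<^sup>T *\<^sub>v v = 0\<^sub>v n" using U by (intro eq_vecI) auto
  have "U'\<^sup>T * U\<^sup>T = 1\<^sub>m n" using transpose_mult[OF U U'(1)] U'(2) by simp
  then have "v = (U'\<^sup>T * U\<^sup>T) *\<^sub>v v" using v by simp
  also have "\<dots> = U'\<^sup>T *\<^sub>v (U\<^sup>T *\<^sub>v v)" using U U' v by (intro assoc_mult_mat_vec) auto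
  also have "\<dots> = 0\<^sub>v n" unfolding Uv0 using U' by (intro eq_vecI) auto
  finally show False using v by simp
qed

text \<open>Both directions of \<open>inertia_le\<close>, with the positive indices exchanged for
  their complement.\<close>

theorem Sylvester_inertia:
  fixes S U :: "real mat"
  assumes S: "S \<in> carrier_mat n n" "S' \<in> carrier_mat n n" "S * S' = 1\<^sub>m n"
    and U: "U \<in> carrier_mat n n" "U' \<in> carrier_mat n n" "U * U' = 1\<^sub>m n"
    and eq: "S * mat_diag n a * S\<^sup>T = U * mat_diag n b * U\<^sup>T"
  shows "card {i. i < n \<and> a i \<le> 0} = card {i. i < n \<and> b i \<le> 0}"
proof -
  have split: "card {i. i < n \<and> c i > 0} + card {i. i < n \<and> c i \<le> 0} = n" for c :: "nat \<Rightarrow> real"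
    by (subst card_Un_disjoint[symmetric], simp, simp, force, subst (5) card_lessThan[symmetric], rule arg_cong[of _ _ card], force)
  show ?thesis
    using inertia_le[OF S(1) U eq] inertia_le[OF U(1) S eq[symmetric]] split[of a] split[of b] by linarith
qed

section \<open>Simultaneous diagonalization\<close>

text \<open>The vector is \<open>S\<^sup>-\<^sup>T e\<^sub>i\<close>. It reads off a single diagonal
  coefficient and so transfers definiteness of the form to the sign of that coefficient.\<close>

lemma quadratic_form_unit:
  fixes S :: "real mat"
  assumes S: "S \<in> carrier_mat n n" and S': "S' \<in> carrier_mat n n" "S' * S = 1\<^sub>m n" and i: "i < n"
  obtains x where "x \<in> carrier_vec n" "x \<noteq> 0\<^sub>v n" "\<And>a. x \<bullet> ((S * mat_diag n a * S\<^sup>T) *\<^sub>v x) = a i"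
proof -
  define x where "x = S'\<^sup>T *\<^sub>v unit_vec n i"
  have x: "x \<in> carrier_vec n" using S' by (simp add: x_def)
  have "S\<^sup>T * S'\<^sup>T = 1\<^sub>m n" using transpose_mult[OF S'(1) S] S'(2) by simp
  then have Sx: "S\<^sup>T *\<^sub>v x = unit_vec n i"
    unfolding x_def using S S'(1) assoc_mult_mat_vec[of "S\<^sup>T" n n "S'\<^sup>T" n "unit_vec n i"] by simp
  have "x \<noteq> 0\<^sub>v n"
  proof
    assume "x = 0\<^sub>v n"
    then have "S\<^sup>T *\<^sub>v x = 0\<^sub>v n" using S by (auto intro!: eq_vecI)
    then have "unit_vec n i $ i = (0\<^sub>v n $ i :: real)" using Sx by simp
    then show False using i by simp
  qed
  moreover have "x \<bullet> ((S * mat_diag n a * S\<^sup>T) *\<^sub>v x) = a i" for a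
  proof -
    have "x \<bullet> ((S * mat_diag n a * S\<^sup>T) *\<^sub>v x) = (\<Sum>j<n. if j = i then a j else 0)"
      unfolding quadratic_form_sandwich[OF S x] Sx using i by (intro sum.cong) (auto simp: unit_vec_def)
    then show ?thesis using i by simp
  qed
  ultimately show thesis using that x by metis
qed

text \<open>Take a square root \<open>B = T * T\<^sup>T\<close> from the spectral theorem and
  diagonalize \<open>T\<^sup>-\<^sup>1 A T\<^sup>-\<^sup>T\<close> by an orthogonal
  \<open>V\<close>. Then \<open>S = T * V\<close> serves both forms, because \<open>V\<close>
  cancels in \<open>S * S\<^sup>T\<close>.\<close>

theorem simultaneous_diagonalization:
  fixes A B :: "real mat"
  assumes A: "A \<in> carrier_mat n n" "A\<^sup>T = A" and B: "B \<in> carrier_mat n n" "B\<^sup>T = B"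
    and psd: "\<And>x. x \<in> carrier_vec n \<Longrightarrow> 0 \<le> x \<bullet> (A *\<^sub>v x)"
    and pd: "\<And>x. x \<in> carrier_vec n \<Longrightarrow> x \<noteq> 0\<^sub>v n \<Longrightarrow> 0 < x \<bullet> (B *\<^sub>v x)"
  obtains S S' \<theta> where "S \<in> carrier_mat n n" "S' \<in> carrier_mat n n" "S * S' = 1\<^sub>m n" "S' * S = 1\<^sub>m n"
    "A = S * mat_diag n \<theta> * S\<^sup>T" "B = S * S\<^sup>T" "\<And>i. i < n \<Longrightarrow> 0 \<le> \<theta> i"
proof -
  note as = assoc_mult_mat[of _ n n _ n _ n] and mc = mult_carrier_mat[of _ n n _ n]
  obtain U b where U: "U \<in> carrier_mat n n" "U\<^sup>T * U = 1\<^sub>m n" "U * U\<^sup>T = 1\<^sub>m n" "B = U * mat_diag n b * U\<^sup>T"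
    using real_spectral_theorem[OF B] by blast
  have UT: "U\<^sup>T \<in> carrier_mat n n" using U(1) by simp
  have b: "b i > 0" if "i < n" for i
  proof -
    note i = that
    obtain x where "x \<in> carrier_vec n" "x \<noteq> 0\<^sub>v n" "\<And>a. x \<bullet> ((U * mat_diag n a * U\<^sup>T) *\<^sub>v x) = a i"
      using quadratic_form_unit[OF U(1) UT U(2) i] by blast
    then show ?thesis using pd[of x] unfolding U(4) by simp
  qed
  have bnz: "b i \<noteq> 0" if "i < n" for i using b[OF that] by simp
  define R where "R = mat_diag n (\<lambda>i. sqrt (b i))"
  define R' where "R' = mat_diag n (\<lambda>i. 1 / sqrt (b i))"
  have R: "R \<in> carrier_mat n n" "R' \<in> carrier_mat n n" by (simp_all add: R_def R'_def)
  have RT: "R\<^sup>T = R" by (auto simp: R_def mat_diag_def intro!: eq_matI)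
  have RR': "R * R' = 1\<^sub>m n" unfolding R_def R'_def mat_diag_diag
    using bnz by (intro eq_matI) (auto simp: mat_diag_def)
  have RR: "R * R = mat_diag n b" unfolding R_def mat_diag_diag
    using b by (intro eq_matI) (auto simp: mat_diag_def less_imp_le)
  define T where "T = U * R"
  define T' where "T' = R' * U\<^sup>T"
  have T: "T \<in> carrier_mat n n" "T' \<in> carrier_mat n n" using U(1) UT R by (auto simp: T_def T'_def)
  have TT: "T\<^sup>T = R * U\<^sup>T" unfolding T_def transpose_mult[OF U(1) R(1)] RT ..
  have BT: "B = T * T\<^sup>T"
    unfolding TT U(4) RR[symmetric] unfolding T_def using U(1) UT R by (simp add: as mc)
  have TT': "T * T' = 1\<^sub>m n"
  proof -
    have "T * T' = U * ((R * R') * U\<^sup>T)" unfolding T_def T'_def using U(1) UT R by (simp add: as mc)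
    then show ?thesis unfolding RR' using UT U(3) by simp
  qed
  have T'T: "T' * T = 1\<^sub>m n" by (rule mat_mult_left_right_inverse[OF T TT'])
  \<comment> \<open>The inverse transpose of \<open>T\<close>: congruence by \<open>P\<close> takes
    \<open>B\<close> to the identity.\<close>
  define P where "P = T'\<^sup>T"
  have P: "P \<in> carrier_mat n n" using T by (simp add: P_def)
  have PT: "P\<^sup>T = T'" by (simp add: P_def)
  obtain V \<theta> where V: "V \<in> carrier_mat n n" "V\<^sup>T * V = 1\<^sub>m n" "V * V\<^sup>T = 1\<^sub>m n" "P\<^sup>T * (A * P) = V * mat_diag n \<theta> * V\<^sup>T"
    using real_spectral_theorem[OF _ transpose_sandwich[OF A P]] A(1) P T PT by (metis mult_carrier_mat)
  have VT: "V\<^sup>T \<in> carrier_mat n n" using V(1) by simp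
  define S where "S = T * V"
  define S' where "S' = V\<^sup>T * T'"
  have S: "S \<in> carrier_mat n n" "S' \<in> carrier_mat n n" using T V(1) VT by (auto simp: S_def S'_def)
  have ST: "S\<^sup>T = V\<^sup>T * T\<^sup>T" unfolding S_def by (rule transpose_mult[OF T(1) V(1)])
  have TTc: "T\<^sup>T \<in> carrier_mat n n" using T by simp
  have SS': "S * S' = 1\<^sub>m n"
  proof -
    have "S * S' = T * ((V * V\<^sup>T) * T')" unfolding S_def S'_def using T V(1) VT by (simp add: as mc)
    then show ?thesis unfolding V(3) using T TT' by simp
  qed
  have S'S: "S' * S = 1\<^sub>m n" by (rule mat_mult_left_right_inverse[OF S SS'])
  have BS: "B = S * S\<^sup>T"
  proof -
    have "S * S\<^sup>T = T * ((V * V\<^sup>T) * T\<^sup>T)" unfolding ST unfolding S_def using T V(1) VT TTc by (simp add: as mc)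
    then show ?thesis unfolding V(3) BT using TTc by simp
  qed
  have PTT: "P * T\<^sup>T = 1\<^sub>m n" unfolding P_def using transpose_mult[OF T] TT' T'T transpose_mult[OF T(1,2)]
    by (metis T(1) T(2) transpose_mult transpose_one)
  have AS: "A = S * mat_diag n \<theta> * S\<^sup>T"
  proof -
    have "S * mat_diag n \<theta> * S\<^sup>T = T * (V * mat_diag n \<theta> * V\<^sup>T) * T\<^sup>T"
      unfolding ST unfolding S_def using T V(1) VT TTc by (simp add: as mc)
    also have "\<dots> = (T * T') * (A * (P * T\<^sup>T))"
      unfolding V(4)[symmetric] PT using T TTc P A by (simp add: as mc)
    also have "\<dots> = A" unfolding TT' PTT using A by simp
    finally show ?thesis ..
  qed
  have th: "0 \<le> \<theta> i" if "i < n" for i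
  proof -
    note i = that
    obtain x where x: "x \<in> carrier_vec n" "\<And>a. x \<bullet> ((S * mat_diag n a * S\<^sup>T) *\<^sub>v x) = a i"
      using quadratic_form_unit[OF S S'S i] by blast
    show ?thesis using psd[OF x(1)] x(2)[of \<theta>] unfolding AS[symmetric] by simp
  qed
  show thesis by (rule that[OF S SS' S'S AS BS th])
qed

text \<open>\<open>F\<close> need not be symmetric, but similarity to a real diagonal matrix makes
  its characteristic polynomial split, so all \<open>n\<close> eigenvalues are listed with
  multiplicity.\<close>

lemma sorted_eigenvalues_similar_diag:
  fixes F :: "real mat"
  assumes "S \<in> carrier_mat n n" "S' \<in> carrier_mat n n" "S * S' = 1\<^sub>m n" "S' * S = 1\<^sub>m n"
    and "F = S * mat_diag n \<theta> * S'"
  shows "sorted_eigenvalues F = sort (map \<theta> [0..<n])"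
proof -
  have F: "F \<in> carrier_mat n n" unfolding assms(5) using assms(1,2) by (simp add: mult_carrier_mat[of _ n n _ n])
  have "similar_mat_wit F (mat_diag n \<theta>) S S'"
    using assms F by (intro similar_mat_witI[of _ _ n]) auto
  then have "char_poly F = char_poly (mat_diag n \<theta>)"
    by (intro char_poly_similar) (auto simp: similar_mat_def)
  also have "\<dots> = (\<Prod>a\<leftarrow>diag_mat (mat_diag n \<theta>). [:- a, 1:])"
    by (rule char_poly_upper_triangular[OF mat_diag_dim]) (auto simp: mat_diag_def)
  also have "diag_mat (mat_diag n \<theta>) = map \<theta> [0..<n]"
    by (auto simp: diag_mat_def mat_diag_def)
  finally have cp: "char_poly F = (\<Prod>a\<leftarrow>map \<theta> [0..<n]. [:- a, 1:])" .
  have "proots (\<Prod>a\<leftarrow>xs. [:- a, 1:]) = mset xs" for xs :: "real list"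
  proof (induction xs)
    case (Cons a xs)
    have "(\<Prod>a\<leftarrow>xs. [:- a, 1:]) \<noteq> (0 :: real poly)" by (auto simp: prod_list_zero_iff)
    then show ?case using Cons by (simp add: proots_mult del: mult_pCons_left)
  qed simp
  then show ?thesis unfolding sorted_eigenvalues_def cp by (simp only: sorted_list_of_multiset_mset)
qed

lemma sum_nth_sort:
  fixes f :: "real \<Rightarrow> real"
  shows "(\<Sum>i<n. f (sort (map \<theta> [0..<n]) ! i)) = (\<Sum>i<n. f (\<theta> i))"
proof -
  have "(\<Sum>i<n. f (sort (map \<theta> [0..<n]) ! i)) = sum_list (map f (sort (map \<theta> [0..<n])))"
    by (simp add: sum_list_sum_nth atLeast0LessThan)
  also have "\<dots> = sum_mset (image_mset f (mset (map \<theta> [0..<n])))"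
    by (metis mset_map mset_sort sum_mset_sum_list)
  also have "\<dots> = sum_list (map f (map \<theta> [0..<n]))" by (metis mset_map sum_mset_sum_list)
  finally show ?thesis by (simp add: sum_list_sum_nth atLeast0LessThan)
qed

section \<open>Eigenvalue counts of Fisher matrices\<close>

abbreviation gram :: "nat \<Rightarrow> nat \<Rightarrow> (nat \<Rightarrow> nat \<Rightarrow> real) \<Rightarrow> real mat" where
  "gram n m X \<equiv> mat_of n m X * (mat_of n m X)\<^sup>T"

lemma mat_of_carrier [simp]: "mat_of n m X \<in> carrier_mat n m"
  by (simp add: mat_of_def)

lemma mat_of_dim [simp]: "dim_row (mat_of n m X) = n" "dim_col (mat_of n m X) = m"
  by (simp_all add: mat_of_def)

lemma gram_carrier [simp]: "gram n m X \<in> carrier_mat n n"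
  by (simp add: mult_carrier_mat[of _ n m _ n])

lemma gram_index: "i < n \<Longrightarrow> j < n \<Longrightarrow> gram n m X $$ (i, j) = (\<Sum>k<m. X i k * X j k)"
  by (simp add: mat_of_def scalar_prod_def atLeast0LessThan)

lemma smult_gram_index:
  "i < n \<Longrightarrow> j < n \<Longrightarrow> (c \<cdot>\<^sub>m gram n m X) $$ (i, j) = c * (\<Sum>k<m. X i k * X j k)"
  using gram_index[of i n j m X] by simp

lemma gram_sym: "(c \<cdot>\<^sub>m gram n m X)\<^sup>T = c \<cdot>\<^sub>m gram n m X"
proof (rule eq_matI)
  fix i j assume "i < dim_row (c \<cdot>\<^sub>m gram n m X)" "j < dim_col (c \<cdot>\<^sub>m gram n m X)"
  then have ij: "i < n" "j < n" by auto
  then have "(c \<cdot>\<^sub>m gram n m X)\<^sup>T $$ (i, j) = (c \<cdot>\<^sub>m gram n m X) $$ (j, i)"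
    by (intro index_transpose_mat) auto
  then show "(c \<cdot>\<^sub>m gram n m X)\<^sup>T $$ (i, j) = (c \<cdot>\<^sub>m gram n m X) $$ (i, j)"
    unfolding smult_gram_index[OF ij] smult_gram_index[OF ij(2,1)] by (simp only: mult.commute)
qed (auto simp: mat_of_def)

lemma gram_quadratic:
  assumes x: "x \<in> carrier_vec n"
  shows "x \<bullet> ((c \<cdot>\<^sub>m gram n m X) *\<^sub>v x) = c * (((mat_of n m X)\<^sup>T *\<^sub>v x) \<bullet> ((mat_of n m X)\<^sup>T *\<^sub>v x))"
proof -
  let ?Y = "mat_of n m X" and ?y = "(mat_of n m X)\<^sup>T *\<^sub>v x"
  have y: "?y \<in> carrier_vec m" by (rule mult_mat_vec_carrier[OF _ x]) simp
  have g: "gram n m X *\<^sub>v x = ?Y *\<^sub>v ?y"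
    by (rule assoc_mult_mat_vec[OF mat_of_carrier _ x]) simp
  have "(c \<cdot>\<^sub>m gram n m X) *\<^sub>v x = c \<cdot>\<^sub>v (gram n m X *\<^sub>v x)"
  proof (rule eq_vecI)
    fix i assume "i < dim_vec (c \<cdot>\<^sub>v (gram n m X *\<^sub>v x))"
    then have i: "i < n" by simp
    have "row (gram n m X) i \<in> carrier_vec n" by (intro carrier_vecI) simp
    then show "((c \<cdot>\<^sub>m gram n m X) *\<^sub>v x) $ i = (c \<cdot>\<^sub>v (gram n m X *\<^sub>v x)) $ i"
      using i x by (simp add: smult_scalar_prod_distrib[of _ n])
  qed simp
  then have "x \<bullet> ((c \<cdot>\<^sub>m gram n m X) *\<^sub>v x) = c * (x \<bullet> (?Y *\<^sub>v ?y))"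
    unfolding g using x mult_mat_vec_carrier[OF mat_of_carrier y] by simp
  then show ?thesis using transpose_vec_mult_scalar[OF mat_of_carrier y x] by simp
qed

lemma gram_psd:
  assumes "x \<in> carrier_vec n" "c \<ge> 0"
  shows "0 \<le> x \<bullet> ((c \<cdot>\<^sub>m gram n m X) *\<^sub>v x)"
  unfolding gram_quadratic[OF assms(1)] using assms(2) scalar_prod_self_nonneg by simp

lemma gram_pd:
  assumes x: "x \<in> carrier_vec n" "x \<noteq> 0\<^sub>v n" and c: "c > 0" and det: "det (gram n m X) \<noteq> 0"
  shows "0 < x \<bullet> ((c \<cdot>\<^sub>m gram n m X) *\<^sub>v x)"
proof -
  let ?Y = "mat_of n m X" and ?y = "(mat_of n m X)\<^sup>T *\<^sub>v x"
  have y: "?y \<in> carrier_vec m" by (rule mult_mat_vec_carrier[OF _ x(1)]) simp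
  have "?y \<bullet> ?y \<noteq> 0"
  proof
    assume "?y \<bullet> ?y = 0"
    then have "?y \<bullet>c ?y = 0" by (simp add: conjugate_vec_def)
    then have "?y = 0\<^sub>v m" using conjugate_square_eq_0_vec[OF y] by simp
    moreover have "gram n m X *\<^sub>v x = ?Y *\<^sub>v ?y"
      by (rule assoc_mult_mat_vec[OF mat_of_carrier _ x(1)]) simp
    ultimately have "gram n m X *\<^sub>v x = 0\<^sub>v n"
      by (auto intro!: eq_vecI simp: mat_of_def)
    then show False using det det_0_iff_vec_prod_zero_field[OF gram_carrier] x by blast
  qed
  then show ?thesis unfolding gram_quadratic[OF x(1)]
    using c scalar_prod_self_nonneg[of ?y] by (simp add: less_le)
qed

lemma mat_inverse_eq:
  fixes B :: "real mat"
  assumes B: "B \<in> carrier_mat n n" and X: "X \<in> carrier_mat n n" and BX: "B * X = 1\<^sub>m n"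
  shows "the (mat_inverse B) = X"
proof -
  have "det B * det X = 1" using det_mult[OF B X] BX by simp
  then have "det B \<noteq> 0" by auto
  then have "B \<in> Units (ring_mat TYPE(real) n ())" by (rule det_non_zero_imp_unit[OF B])
  then obtain C where C: "mat_inverse B = Some C" using mat_inverse(1)[OF B, of "()"] by (cases "mat_inverse B") auto
  then have CB: "C * B = 1\<^sub>m n" "C \<in> carrier_mat n n" using mat_inverse(2)[OF B] by auto
  have "C = C * (B * X)" unfolding BX using CB by simp
  also have "\<dots> = (C * B) * X" by (rule assoc_mult_mat[OF CB(2) B X, symmetric])
  also have "\<dots> = X" using CB X by simp
  finally show ?thesis using C by simp
qed

text \<open>A word of \<open>k\<close> letters 1 is the power \<open>K\<^sup>k\<close> of a
  symmetric matrix, so its normalized trace is the \<open>k\<close>-th moment of the spectral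
  distribution. The same \<kappa> must serve the inertia argument, hence the decomposition is part
  of the conclusion.\<close>

lemma word_tr_replicate:
  assumes n: "n > 0"
  obtains U \<kappa> where "U \<in> carrier_mat n n" "U * U\<^sup>T = 1\<^sub>m n"
    "\<And>p q. p < n \<Longrightarrow> q < n \<Longrightarrow> letter_ent n J d Z 1 p q = (U * mat_diag n \<kappa> * U\<^sup>T) $$ (p, q)"
    "\<And>k. word_tr n J d Z (replicate k 1) = (\<Sum>i<n. \<kappa> i ^ k) / real n"
proof -
  define K where "K = mat n n (\<lambda>(p, q). letter_ent n J d Z 1 p q)"
  have K: "K \<in> carrier_mat n n" by (simp add: K_def)
  have "K\<^sup>T = K" by (rule eq_matI) (auto simp: K_def letter_ent_sym)
  then obtain U \<kappa> where U: "U \<in> carrier_mat n n" "U\<^sup>T * U = 1\<^sub>m n" "U * U\<^sup>T = 1\<^sub>m n" "K = U * mat_diag n \<kappa> * U\<^sup>T"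
    using real_spectral_theorem[OF K] by blast
  have orth: "(\<Sum>r<n. U $$ (r, j) * U $$ (r, i)) = (if j = i then 1 else 0)" if "i < n" "j < n" for i j
    using arg_cong[OF U(2), of "\<lambda>M. M $$ (j, i)"] that U(1) by (simp add: scalar_prod_def atLeast0LessThan)
  have orth': "(\<Sum>i<n. U $$ (p, i) * U $$ (q, i)) = (if p = q then 1 else 0)" if "p < n" "q < n" for p q
    using arg_cong[OF U(3), of "\<lambda>M. M $$ (p, q)"] that U(1) by (simp add: scalar_prod_def atLeast0LessThan)
  have Kpq: "letter_ent n J d Z 1 p q = (U * mat_diag n \<kappa> * U\<^sup>T) $$ (p, q)" if "p < n" "q < n" for p q
    using arg_cong[OF U(4), of "\<lambda>M. M $$ (p, q)"] that by (simp add: K_def)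
  have W: "word_ent n J d Z (replicate k 1) p q = (\<Sum>i<n. U $$ (p, i) * \<kappa> i ^ k * U $$ (q, i))"
    if "p < n" "q < n" for k p q
    using that
  proof (induction k arbitrary: p)
    case 0
    then show ?case using orth' by simp
  next
    case (Suc k)
    have "word_ent n J d Z (replicate (Suc k) 1) p q =
        (\<Sum>r<n. (\<Sum>j<n. U $$ (p, j) * \<kappa> j * U $$ (r, j)) * (\<Sum>i<n. U $$ (r, i) * \<kappa> i ^ k * U $$ (q, i)))"
      using Suc by (simp add: Kpq index_sandwich[OF U(1)] del: One_nat_def)
    also have "\<dots> = (\<Sum>r<n. \<Sum>j<n. \<Sum>i<n. U $$ (p, j) * \<kappa> j * (\<kappa> i ^ k * U $$ (q, i)) * (U $$ (r, j) * U $$ (r, i)))"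
      unfolding sum_product by (intro sum.cong refl) (simp only: ac_simps)
    also have "\<dots> = (\<Sum>j<n. \<Sum>i<n. \<Sum>r<n. U $$ (p, j) * \<kappa> j * (\<kappa> i ^ k * U $$ (q, i)) * (U $$ (r, j) * U $$ (r, i)))"
      by (rule sum_rotate[symmetric])
    also have "\<dots> = (\<Sum>j<n. \<Sum>i<n. if j = i then U $$ (p, j) * \<kappa> j * (\<kappa> i ^ k * U $$ (q, i)) else 0)"
      unfolding sum_distrib_left[symmetric] using orth by (intro sum.cong refl) auto
    also have "\<dots> = (\<Sum>i<n. U $$ (p, i) * \<kappa> i ^ Suc k * U $$ (q, i))"
      by (auto intro!: sum.cong)
    finally show ?case .
  qed
  have "word_tr n J d Z (replicate k 1) = (\<Sum>i<n. \<kappa> i ^ k) / real n" for k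
  proof -
    have "(\<Sum>p<n. word_ent n J d Z (replicate k 1) p p) = (\<Sum>p<n. \<Sum>i<n. \<kappa> i ^ k * (U $$ (p, i) * U $$ (p, i)))"
      using W by (intro sum.cong refl) (auto simp: ac_simps)
    also have "\<dots> = (\<Sum>i<n. \<Sum>p<n. \<kappa> i ^ k * (U $$ (p, i) * U $$ (p, i)))" by (rule sum.swap)
    also have "\<dots> = (\<Sum>i<n. \<kappa> i ^ k)"
      unfolding sum_distrib_left[symmetric] using orth by (intro sum.cong refl) auto
    finally show ?thesis by (simp add: word_tr_def)
  qed
  then show thesis using that U(1,3) Kpq by blast
qed

text \<open>With \<open>A = S diag(\<theta>) S\<^sup>T\<close> and \<open>B = S S\<^sup>T\<close>
  the Fisher matrix is \<open>S diag(\<theta>) S\<^sup>-\<^sup>1\<close>, so \<theta> lists its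
  eigenvalues. The form \<open>A - \<rho> B\<close> is diagonalized by \<open>S\<close> with entries
  \<open>\<theta> i - \<rho>\<close> and by \<open>U\<close> with entries affine in
  \<open>\<kappa> i\<close>, and inertia equates the counts.\<close>

theorem fisher_eigenvalue_count:
  fixes X Y :: "nat \<Rightarrow> nat \<Rightarrow> real" and r :: real
  assumes n: "n > 0" "n1 > 0" "n2 > 0" and det: "det (gram n n2 Y) \<noteq> 0"
  defines "J \<equiv> {..<n1} <+> {..<n2}"
    and "Z \<equiv> \<lambda>i c. case c of Inl j \<Rightarrow> X i j | Inr j \<Rightarrow> Y i j"
    and "d \<equiv> \<lambda>c. case c of Inl _ \<Rightarrow> 1 | Inr _ \<Rightarrow> - r"
    and "lam \<equiv> \<lambda>i. sorted_eigenvalues (fisher_mat n n1 n2 X Y) ! i"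
  obtains \<kappa> where "\<And>k. word_tr n J d Z (replicate k 1) = (\<Sum>i<n. \<kappa> i ^ k) / real n"
    "ecdf n lam (real n2 / real n1 * r) = ecdf n \<kappa> ((r * real n2 - real n1) / sqrt (real n * real (n1 + n2)))"
    "\<And>i. i < n \<Longrightarrow> 0 \<le> lam i"
proof -
  define A where "A = (1 / real n1) \<cdot>\<^sub>m gram n n1 X"
  define B where "B = (1 / real n2) \<cdot>\<^sub>m gram n n2 Y"
  have AB: "A \<in> carrier_mat n n" "B \<in> carrier_mat n n" by (auto simp: A_def B_def mat_of_def)
  have sym: "A\<^sup>T = A" "B\<^sup>T = B" unfolding A_def B_def by (rule gram_sym)+
  have psd: "0 \<le> x \<bullet> (A *\<^sub>v x)" if "x \<in> carrier_vec n" for x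
    unfolding A_def by (rule gram_psd[OF that]) simp
  have pd: "0 < x \<bullet> (B *\<^sub>v x)" if "x \<in> carrier_vec n" "x \<noteq> 0\<^sub>v n" for x
    unfolding B_def by (rule gram_pd[OF that _ det]) (use n in simp)
  obtain S S' \<theta> where S: "S \<in> carrier_mat n n" "S' \<in> carrier_mat n n" "S * S' = 1\<^sub>m n" "S' * S = 1\<^sub>m n"
    and AS: "A = S * mat_diag n \<theta> * S\<^sup>T" and BS: "B = S * S\<^sup>T" and \<theta>: "\<And>i. i < n \<Longrightarrow> 0 \<le> \<theta> i"
    using simultaneous_diagonalization[OF AB(1) sym(1) AB(2) sym(2) psd pd] by blast
  note as = assoc_mult_mat[of _ n n _ n _ n] and mc = mult_carrier_mat[of _ n n _ n]
  have ST: "S\<^sup>T \<in> carrier_mat n n" "S'\<^sup>T \<in> carrier_mat n n" using S by auto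
  have STS': "S\<^sup>T * S'\<^sup>T = 1\<^sub>m n" using transpose_mult[OF S(2,1)] S(4) by simp
  have "B * (S'\<^sup>T * S') = 1\<^sub>m n"
  proof -
    have "B * (S'\<^sup>T * S') = S * ((S\<^sup>T * S'\<^sup>T) * S')" unfolding BS using S(1,2) ST by (simp add: as mc)
    then show ?thesis unfolding STS' using S by simp
  qed
  then have inv: "the (mat_inverse B) = S'\<^sup>T * S'"
    using AB S ST by (intro mat_inverse_eq[of _ n]) (auto simp: mc)
  have "fisher_mat n n1 n2 X Y = A * (S'\<^sup>T * S')"
    unfolding fisher_mat_def A_def[symmetric] B_def[symmetric] inv ..
  also have "\<dots> = S * mat_diag n \<theta> * ((S\<^sup>T * S'\<^sup>T) * S')" unfolding AS using S(1,2) ST by (simp add: as mc)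
  also have "\<dots> = S * mat_diag n \<theta> * S'" unfolding STS' using S by simp
  finally have F: "sorted_eigenvalues (fisher_mat n n1 n2 X Y) = sort (map \<theta> [0..<n])"
    by (rule sorted_eigenvalues_similar_diag[OF S])
  have lam0: "0 \<le> lam i" if "i < n" for i
  proof -
    have "lam i \<in> set (sort (map \<theta> [0..<n]))"
      unfolding lam_def F by (rule nth_mem) (use that in simp)
    then show ?thesis using \<theta> by auto
  qed
  obtain U \<kappa> where U: "U \<in> carrier_mat n n" "U * U\<^sup>T = 1\<^sub>m n"
    and K: "\<And>p q. p < n \<Longrightarrow> q < n \<Longrightarrow> letter_ent n J d Z 1 p q = (U * mat_diag n \<kappa> * U\<^sup>T) $$ (p, q)"
    and tr: "\<And>k. word_tr n J d Z (replicate k 1) = (\<Sum>i<n. \<kappa> i ^ k) / real n"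
    using word_tr_replicate[OF n(1), of J d Z] by blast
  \<comment> \<open>With this \<open>\<rho>\<close>,
    \<open>n1 (A - \<rho> B) = X X\<^sup>T - r Y Y\<^sup>T\<close>. The constants \<open>s\<close>
    and \<open>\<tau> = tr(D)\<close> undo the scaling and the centering of the letter 1.\<close>
  define \<rho> where "\<rho> = real n2 / real n1 * r"
  define s where "s = sqrt (real n * real (n1 + n2))"
  define \<tau> where "\<tau> = real n1 - r * real n2"
  have finJ: "finite J" "J \<noteq> {}" using n by (auto simp: J_def)
  have cardJ: "card J = n1 + n2" by (simp add: J_def card_Plus)
  have s: "s > 0" using n by (simp add: s_def)
  have sumJ: "(\<Sum>c\<in>J. f c) = (\<Sum>j<n1. f (Inl j)) + (\<Sum>j<n2. f (Inr j))" for f :: "nat + nat \<Rightarrow> real"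
    unfolding J_def by (simp add: sum.Plus)
  have ent: "A $$ (p, q) - \<rho> * B $$ (p, q) = (s * letter_ent n J d Z 1 p q + (if p = q then \<tau> else 0)) / real n1"
    if pq: "p < n" "q < n" for p q
  proof -
    have "(\<Sum>c\<in>J. d c ^ 1 * (Z p c * Z q c)) = s * letter_ent n J d Z 1 p q + (if p = q then \<Sum>c\<in>J. d c ^ 1 else 0)"
      unfolding s_def cardJ[symmetric] by (rule sum_gram[OF finJ n(1)])
    also have "(\<Sum>c\<in>J. d c ^ 1) = \<tau>" unfolding sumJ by (simp add: d_def \<tau>_def)
    also have "(\<Sum>c\<in>J. d c ^ 1 * (Z p c * Z q c)) = (\<Sum>j<n1. X p j * X q j) - r * (\<Sum>j<n2. Y p j * Y q j)"
      unfolding sumJ by (simp add: d_def Z_def sum_negf sum_distrib_left mult.assoc)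
    finally have e: "(\<Sum>j<n1. X p j * X q j) - r * (\<Sum>j<n2. Y p j * Y q j) =
      s * letter_ent n J d Z 1 p q + (if p = q then \<tau> else 0)" .
    have "A $$ (p, q) - \<rho> * B $$ (p, q) = ((\<Sum>j<n1. X p j * X q j) - r * (\<Sum>j<n2. Y p j * Y q j)) / real n1"
      unfolding A_def B_def \<rho>_def smult_gram_index[OF pq] using n
      by (simp add: field_simps)
    then show ?thesis unfolding e .
  qed
  have eqm: "S * mat_diag n (\<lambda>i. \<theta> i - \<rho>) * S\<^sup>T = U * mat_diag n (\<lambda>i. (s * \<kappa> i + \<tau>) / real n1) * U\<^sup>T"
  proof (rule eq_matI)
    fix p q assume "p < dim_row (U * mat_diag n (\<lambda>i. (s * \<kappa> i + \<tau>) / real n1) * U\<^sup>T)"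
      "q < dim_col (U * mat_diag n (\<lambda>i. (s * \<kappa> i + \<tau>) / real n1) * U\<^sup>T)"
    then have pq: "p < n" "q < n" using U by auto
    have "(S * mat_diag n (\<lambda>i. \<theta> i - \<rho>) * S\<^sup>T) $$ (p, q) = A $$ (p, q) - \<rho> * B $$ (p, q)"
    proof -
      have "B = S * mat_diag n (\<lambda>_. 1) * S\<^sup>T" unfolding BS using S by simp
      then have "B $$ (p, q) = (\<Sum>i<n. S $$ (p, i) * 1 * S $$ (q, i))" using index_sandwich[OF S(1) pq, of "\<lambda>_. 1"] by simp
      moreover have "A $$ (p, q) = (\<Sum>i<n. S $$ (p, i) * \<theta> i * S $$ (q, i))"
        unfolding AS by (rule index_sandwich[OF S(1) pq])
      ultimately show ?thesis
        unfolding index_sandwich[OF S(1) pq] by (simp add: sum_distrib_left algebra_simps flip: sum_subtractf)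
    qed
    also have "\<dots> = (s * (\<Sum>i<n. U $$ (p, i) * \<kappa> i * U $$ (q, i)) + \<tau> * (\<Sum>i<n. U $$ (p, i) * U $$ (q, i))) / real n1"
    proof -
      have "(\<Sum>i<n. U $$ (p, i) * U $$ (q, i)) = (if p = q then 1 else 0)"
        using arg_cong[OF U(2), of "\<lambda>M. M $$ (p, q)"] pq U(1) by (simp add: scalar_prod_def atLeast0LessThan)
      then show ?thesis unfolding ent[OF pq] K[OF pq] index_sandwich[OF U(1) pq] by simp
    qed
    also have "\<dots> = (\<Sum>i<n. U $$ (p, i) * ((s * \<kappa> i + \<tau>) / real n1) * U $$ (q, i))"
      by (simp add: sum_distrib_left sum_divide_distrib sum.distrib add_divide_distrib algebra_simps)
    finally show "(S * mat_diag n (\<lambda>i. \<theta> i - \<rho>) * S\<^sup>T) $$ (p, q) =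
      (U * mat_diag n (\<lambda>i. (s * \<kappa> i + \<tau>) / real n1) * U\<^sup>T) $$ (p, q)"
      unfolding index_sandwich[OF U(1) pq] .
  qed (use S U in auto)
  have UT: "U\<^sup>T \<in> carrier_mat n n" using U by simp
  have "card {i. i < n \<and> \<theta> i - \<rho> \<le> 0} = card {i. i < n \<and> (s * \<kappa> i + \<tau>) / real n1 \<le> 0}"
    by (rule Sylvester_inertia[OF S(1-3) U(1) UT U(2) eqm])
  moreover have "(s * \<kappa> i + \<tau>) / real n1 \<le> 0 \<longleftrightarrow> \<kappa> i \<le> - \<tau> / s" for i
    using s n by (auto simp: field_simps)
  ultimately have c: "card {i. i < n \<and> \<theta> i \<le> \<rho>} = card {i. i < n \<and> \<kappa> i \<le> - \<tau> / s}" by simp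
  have cnt: "(\<Sum>i<n. if f i \<le> x then 1 else 0) = real (card {i. i < n \<and> f i \<le> x})" for f :: "nat \<Rightarrow> real" and x
    by (simp add: sum.If_cases lessThan_def Collect_conj_eq)
  have "(\<Sum>i<n. if lam i \<le> \<rho> then 1 else 0) = (\<Sum>i<n. if \<theta> i \<le> \<rho> then 1 else (0::real))"
    unfolding lam_def F by (rule sum_nth_sort)
  then have "ecdf n lam \<rho> = ecdf n \<kappa> (- \<tau> / s)" unfolding ecdf_def cnt c by simp
  then show thesis using that[OF tr _ lam0] by (simp add: \<rho>_def s_def \<tau>_def)
qed

section \<open>Almost sure invertibility of Gaussian Gram matrices\<close>

text \<open>Bridges the index sets in use: entries tagged as belonging to \<open>X\<close> or
  \<open>Y\<close>, columns of the joint matrix \<open>Z\<close>, and the entries of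
  \<open>Y\<close> alone.\<close>

lemma (in prob_space) indep_vars_reindex:
  assumes inj: "inj_on h I" and ind: "indep_vars M' X (h ` I)"
  shows "indep_vars (\<lambda>i. M' (h i)) (\<lambda>i. X (h i)) I"
  unfolding indep_vars_def2
proof (intro conjI ballI)
  show "random_variable (M' (h i)) (X (h i))" if "i \<in> I" for i
    using ind that by (auto simp: indep_vars_def2)
  have ind': "indep_sets (\<lambda>i. {X i -` A \<inter> space M |A. A \<in> sets (M' i)}) (h ` I)"
    using ind by (simp add: indep_vars_def2)
  show "indep_sets (\<lambda>i. {X (h i) -` A \<inter> space M |A. A \<in> sets (M' (h i))}) I"
    unfolding indep_sets_def
  proof (intro conjI ballI allI impI)
    show "{X (h i) -` A \<inter> space M |A. A \<in> sets (M' (h i))} \<subseteq> events" if "i \<in> I" for i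
      using ind' that unfolding indep_sets_def by auto
    fix J A assume J: "J \<subseteq> I" "J \<noteq> {}" "finite J"
      and A: "A \<in> (\<Pi> i\<in>J. {X (h i) -` A \<inter> space M |A. A \<in> sets (M' (h i))})"
    have inJ: "inj_on h J" using inj J(1) by (rule inj_on_subset)
    define B where "B x = A (the_inv_into J h x)" for x
    have Bh: "B (h j) = A j" if "j \<in> J" for j
      using the_inv_into_f_f[OF inJ that] by (simp add: B_def)
    have "B \<in> (\<Pi> x\<in>h ` J. {X x -` A \<inter> space M |A. A \<in> sets (M' x)})"
      using A Bh by (fastforce simp: Pi_iff)
    moreover have "h ` J \<subseteq> h ` I" "h ` J \<noteq> {}" "finite (h ` J)" using J by auto
    ultimately have "prob (\<Inter>x\<in>h ` J. B x) = (\<Prod>x\<in>h ` J. prob (B x))"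
      using ind' unfolding indep_sets_def by blast
    then show "prob (\<Inter>j\<in>J. A j) = (\<Prod>j\<in>J. prob (A j))"
      using Bh by (simp add: prod.reindex[OF inJ])
  qed
qed

text \<open>For a fixed value of \<open>V\<close> with \<open>f V \<noteq> 0\<close>, the affine
  expression vanishes at a single value of \<open>u W\<close>, which has probability 0 because
  \<open>u W\<close> has a density. Independence and Fubini integrate this over
  \<open>V\<close>.\<close>

lemma (in prob_space) AE_affine_nonzero:
  fixes V W :: "'a \<Rightarrow> 'b" and u f g :: "'b \<Rightarrow> real"
  assumes ind: "indep_var N V T W" and u[measurable]: "u \<in> borel_measurable T"
    and dist: "distributed M lborel (\<lambda>\<omega>. u (W \<omega>)) h"
    and f[measurable]: "f \<in> borel_measurable N" and g[measurable]: "g \<in> borel_measurable N"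
  shows "AE \<omega> in M. f (V \<omega>) \<noteq> 0 \<longrightarrow> u (W \<omega>) * f (V \<omega>) + g (V \<omega>) \<noteq> 0"
proof -
  have rv[measurable]: "V \<in> M \<rightarrow>\<^sub>M N" "W \<in> M \<rightarrow>\<^sub>M T"
    using ind by (auto dest: indep_var_rv1 indep_var_rv2)
  have eq: "distr M N V \<Otimes>\<^sub>M distr M T W = distr M (N \<Otimes>\<^sub>M T) (\<lambda>x. (V x, W x))"
    using ind by (simp add: indep_var_distribution_eq)
  interpret PV: prob_space "distr M N V" by (rule prob_space_distr) simp
  interpret PW: prob_space "distr M T W" by (rule prob_space_distr) simp
  interpret VW: pair_sigma_finite "distr M N V" "distr M T W" ..
  have single: "AE w in distr M T W. u w \<noteq> c" for c :: real
  proof -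
    have [measurable]: "h \<in> borel_measurable lborel" using dist by (simp add: distributed_def)
    have "AE x in lborel. x \<noteq> c" using AE_lborel_singleton[of c] by auto
    then have "AE x in density lborel h. x \<noteq> c" by (subst AE_density) (auto elim: eventually_mono)
    then have "AE x in distr M lborel (\<lambda>\<omega>. u (W \<omega>)). x \<noteq> c"
      unfolding distributed_distr_eq_density[OF dist] .
    then have "AE \<omega> in M. u (W \<omega>) \<noteq> c" by (subst (asm) AE_distr_iff) auto
    then show ?thesis by (subst AE_distr_iff) auto
  qed
  have "AE p in distr M N V \<Otimes>\<^sub>M distr M T W. f (fst p) \<noteq> 0 \<longrightarrow> u (snd p) * f (fst p) + g (fst p) \<noteq> 0"
  proof (rule VW.AE_pair_measure)
    show "{p \<in> space (distr M N V \<Otimes>\<^sub>M distr M T W). f (fst p) \<noteq> 0 \<longrightarrow> u (snd p) * f (fst p) + g (fst p) \<noteq> 0}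
      \<in> sets (distr M N V \<Otimes>\<^sub>M distr M T W)"
      by measurable
    show "AE v in distr M N V. AE w in distr M T W. f (fst (v, w)) \<noteq> 0 \<longrightarrow> u (snd (v, w)) * f (fst (v, w)) + g (fst (v, w)) \<noteq> 0"
    proof (rule AE_I2)
      fix v
      show "AE w in distr M T W. f (fst (v, w)) \<noteq> 0 \<longrightarrow> u (snd (v, w)) * f (fst (v, w)) + g (fst (v, w)) \<noteq> 0"
        using single[of "- g v / f v"] by eventually_elim (auto simp: field_simps)
    qed
  qed
  then show ?thesis unfolding eq by (subst (asm) AE_distr_iff) auto
qed

lemma borel_measurable_det:
  assumes "\<And>i j. i < n \<Longrightarrow> j < n \<Longrightarrow> h i j \<in> borel_measurable N"
  shows "(\<lambda>x. det (mat n n (\<lambda>(i, j). h i j x)) :: real) \<in> borel_measurable N"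
proof -
  have "det (mat n n (\<lambda>(i, j). h i j x)) = (\<Sum>p\<in>{p. p permutes {0..<n}}. signof p * (\<Prod>i = 0..<n. h i (p i) x))" for x
    by (subst det_def'[of _ n]) (auto intro!: sum.cong prod.cong simp: permutes_in_image)
  moreover have "(\<lambda>x. \<Sum>p\<in>{p. p permutes {0..<n}}. signof p * (\<Prod>i = 0..<n. h i (p i) x)) \<in> borel_measurable N"
  proof (intro borel_measurable_sum borel_measurable_times borel_measurable_prod borel_measurable_const)
    fix p i assume "p \<in> {p. p permutes {0..<n}}" "i \<in> {0..<n}"
    then have "i < n" "p i < n" using permutes_in_image[of p "{0..<n}" i] by auto
    then show "(\<lambda>x. h i (p i) x) \<in> borel_measurable N" using assms by simp
  qed
  ultimately show ?thesis by simp
qed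

text \<open>The determinant is affine in its corner entry, with the leading minor as slope: expand
  both matrices along the last column, where they have the same cofactors.\<close>

lemma det_split_last_entry:
  fixes h :: "nat \<Rightarrow> nat \<Rightarrow> 'a :: comm_ring_1"
  shows "det (mat (Suc k) (Suc k) (\<lambda>(i, j). h i j)) = h k k * det (mat k k (\<lambda>(i, j). h i j)) +
    det (mat (Suc k) (Suc k) (\<lambda>(i, j). if i = k \<and> j = k then 0 else h i j))"
proof -
  let ?A = "mat (Suc k) (Suc k) (\<lambda>(i, j). h i j)"
  let ?B = "mat (Suc k) (Suc k) (\<lambda>(i, j). if i = k \<and> j = k then 0 else h i j)"
  have co: "cofactor ?A i k = cofactor ?B i k" if "i < Suc k" for i
  proof -
    have "mat_delete ?A i k = mat_delete ?B i k"
      by (rule eq_matI) (auto simp: mat_delete_def)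
    then show ?thesis by (simp add: cofactor_def)
  qed
  have last: "cofactor ?A k k = det (mat k k (\<lambda>(i, j). h i j))"
  proof -
    have "mat_delete ?A k k = mat k k (\<lambda>(i, j). h i j)"
      by (rule eq_matI) (auto simp: mat_delete_def)
    then show ?thesis by (simp add: cofactor_def power_add[symmetric])
  qed
  have "det ?A = (\<Sum>i<Suc k. ?A $$ (i, k) * cofactor ?A i k)"
    by (rule laplace_expansion_column) auto
  also have "\<dots> = (\<Sum>i<k. h i k * cofactor ?A i k) + h k k * cofactor ?A k k" by simp
  finally have A: "det ?A = (\<Sum>i<k. h i k * cofactor ?B i k) + h k k * cofactor ?A k k" using co by simp
  have "det ?B = (\<Sum>i<Suc k. ?B $$ (i, k) * cofactor ?B i k)"
    by (rule laplace_expansion_column) auto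
  also have "\<dots> = (\<Sum>i<k. h i k * cofactor ?B i k)" by simp
  finally show ?thesis using A last by simp
qed

text \<open>By induction the leading minor of size \<open>k\<close> is almost surely nonzero. Given
  all other entries, the next minor is then a nonconstant affine function of the entry
  \<open>(k, k)\<close>.\<close>

lemma (in prob_space) AE_det_minor_nonzero:
  fixes Y :: "nat \<Rightarrow> nat \<Rightarrow> 'a \<Rightarrow> real"
  assumes ind: "indep_vars (\<lambda>_. borel) (\<lambda>(i, j). Y i j) ({..<n} \<times> {..<n})"
    and dist: "\<And>i j. i < n \<Longrightarrow> j < n \<Longrightarrow> distributed M lborel (Y i j) h"
  shows "k \<le> n \<Longrightarrow> AE \<omega> in M. det (mat k k (\<lambda>(i, j). Y i j \<omega>)) \<noteq> 0"
proof (induction k)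
  case 0
  then show ?case by (simp add: det_def)
next
  case (Suc k)
  \<comment> \<open>The positions that stay fixed; the corner entry is independent of them.\<close>
  define K where "K = {..<Suc k} \<times> {..<Suc k} - {(k, k)}"
  define V where "V \<omega> = restrict (\<lambda>(i, j). Y i j \<omega>) K" for \<omega>
  let ?N = "PiM K (\<lambda>_. borel :: real measure)"
  define f where "f v = det (mat k k (\<lambda>(i, j). v (i, j)))" for v :: "nat \<times> nat \<Rightarrow> real"
  define g where "g v = det (mat (Suc k) (Suc k) (\<lambda>(i, j). if i = k \<and> j = k then 0 else v (i, j)))"
    for v :: "nat \<times> nat \<Rightarrow> real"
  have f: "f \<in> borel_measurable ?N" unfolding f_def[abs_def]
    by (intro borel_measurable_det measurable_component_singleton) (auto simp: K_def)
  have g: "g \<in> borel_measurable ?N" unfolding g_def[abs_def]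
  proof (rule borel_measurable_det)
    fix i j assume ij: "i < Suc k" "j < Suc k"
    show "(\<lambda>v. if i = k \<and> j = k then 0 else v (i, j)) \<in> borel_measurable ?N"
    proof (cases "i = k \<and> j = k")
      case False
      then have "(i, j) \<in> K" using ij by (auto simp: K_def)
      then have "(\<lambda>v. v (i, j)) \<in> borel_measurable ?N" by (rule measurable_component_singleton)
      then show ?thesis using False by simp
    qed simp
  qed
  have "indep_var ?N (\<lambda>\<omega>. restrict (\<lambda>i. (case i of (i, j) \<Rightarrow> Y i j) \<omega>) K)
      (PiM {(k, k)} (\<lambda>_. borel)) (\<lambda>\<omega>. restrict (\<lambda>i. (case i of (i, j) \<Rightarrow> Y i j) \<omega>) {(k, k)})"
    using Suc.prems by (intro indep_var_restrict[OF ind]) (auto simp: K_def)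
  from AE_affine_nonzero[OF this, of "\<lambda>v. v (k, k)", OF measurable_component_singleton _ f g]
  have "AE \<omega> in M. f (V \<omega>) \<noteq> 0 \<longrightarrow> Y k k \<omega> * f (V \<omega>) + g (V \<omega>) \<noteq> 0"
    using dist[of k k] Suc.prems by (simp add: V_def case_prod_unfold)
  moreover have "AE \<omega> in M. det (mat k k (\<lambda>(i, j). Y i j \<omega>)) \<noteq> 0" using Suc by simp
  ultimately show ?case
  proof eventually_elim
    case (elim \<omega>)
    have fV: "f (V \<omega>) = det (mat k k (\<lambda>(i, j). Y i j \<omega>))"
      unfolding f_def V_def by (intro arg_cong[of _ _ det] eq_matI) (auto simp: K_def)
    have gV: "g (V \<omega>) = det (mat (Suc k) (Suc k) (\<lambda>(i, j). if i = k \<and> j = k then 0 else Y i j \<omega>))"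
      unfolding g_def V_def by (intro arg_cong[of _ _ det] eq_matI) (auto simp: K_def)
    show ?case using elim unfolding fV gV det_split_last_entry[of k "\<lambda>i j. Y i j \<omega>"] by simp
  qed
qed

text \<open>A kernel vector \<open>v\<close> of \<open>Y Y\<^sup>T\<close> satisfies
  \<open>Y\<^sup>T v = 0\<close>, and the first \<open>n\<close> coordinates of this vector are the
  transposed leading block applied to \<open>v\<close>.\<close>

lemma det_gram_nonzero:
  assumes nm: "n \<le> m" and det: "det (mat n n (\<lambda>(i, j). Y i j)) \<noteq> 0"
  shows "det (gram n m Y) \<noteq> 0"
proof
  let ?B = "mat n n (\<lambda>(i, j). Y i j)"
  assume "det (gram n m Y) = 0"
  then obtain v where v: "v \<in> carrier_vec n" "v \<noteq> 0\<^sub>v n" "gram n m Y *\<^sub>v v = 0\<^sub>v n"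
    using det_0_iff_vec_prod_zero_field[OF gram_carrier] by blast
  let ?y = "(mat_of n m Y)\<^sup>T *\<^sub>v v"
  have y: "?y \<in> carrier_vec m" by (rule mult_mat_vec_carrier[OF _ v(1)]) simp
  have "1 \<cdot>\<^sub>m gram n m Y = gram n m Y" by (intro eq_matI) auto
  then have "?y \<bullet> ?y = v \<bullet> (gram n m Y *\<^sub>v v)" using gram_quadratic[OF v(1), of 1 m Y] by simp
  also have "\<dots> = 0" unfolding v(3) using v(1) by simp
  finally have "?y \<bullet>c ?y = 0" by (simp add: conjugate_vec_def)
  then have y0: "?y = 0\<^sub>v m" using conjugate_square_eq_0_vec[OF y] by simp
  have "?B\<^sup>T *\<^sub>v v = 0\<^sub>v n"
  proof (rule eq_vecI)
    fix j assume "j < dim_vec (0\<^sub>v n)"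
    then have j: "j < n" "j < m" using nm by auto
    have "(?B\<^sup>T *\<^sub>v v) $ j = ?y $ j"
      using j v(1) by (simp add: scalar_prod_def mat_of_def)
    then show "(?B\<^sup>T *\<^sub>v v) $ j = 0\<^sub>v n $ j" unfolding y0 using j by simp
  qed simp
  moreover have BT: "?B\<^sup>T \<in> carrier_mat n n" by simp
  ultimately have "det (?B\<^sup>T) = 0" using det_0_iff_vec_prod_zero_field[OF BT] v by blast
  then show False using det det_transpose[of ?B n] by simp
qed

theorem (in prob_space) AE_det_gram_nonzero:
  fixes Y :: "nat \<Rightarrow> nat \<Rightarrow> 'a \<Rightarrow> real"
  assumes ind: "indep_vars (\<lambda>_. borel) (\<lambda>(i, j). Y i j) ({..<n} \<times> {..<m})" and nm: "n \<le> m"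
    and dist: "\<And>i j. i < n \<Longrightarrow> j < m \<Longrightarrow> distributed M lborel (Y i j) h"
  shows "AE \<omega> in M. det (gram n m (\<lambda>i j. Y i j \<omega>)) \<noteq> 0"
proof -
  have "AE \<omega> in M. det (mat n n (\<lambda>(i, j). Y i j \<omega>)) \<noteq> 0"
    by (rule AE_det_minor_nonzero[where n = n and h = h, OF indep_vars_subset[OF ind]]) (use nm dist in auto)
  then show ?thesis by eventually_elim (rule det_gram_nonzero[OF nm])
qed

section \<open>The limit law\<close>

text \<open>Sandwich \<open>X n\<close> between points of \<open>D\<close> close to \<open>a\<close>
  and use continuity of \<open>G\<close> there. It serves moving thresholds with
  \<open>D = UNIV\<close> and the passage from rational to real arguments with constant
  \<open>X\<close>.\<close>

lemma mono_tendsto_dense: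
  fixes F :: "nat \<Rightarrow> real \<Rightarrow> real"
  assumes mono: "\<And>n x y. x \<le> y \<Longrightarrow> F n x \<le> F n y"
    and conv: "\<And>x. x \<in> D \<Longrightarrow> (\<lambda>n. F n x) \<longlonglongrightarrow> G x"
    and dense: "\<And>x y. x < y \<Longrightarrow> \<exists>d\<in>D. x < d \<and> d < y"
    and cont: "isCont G a" and X: "X \<longlonglongrightarrow> a"
  shows "(\<lambda>n. F n (X n)) \<longlonglongrightarrow> G a"
proof (rule order_tendstoI)
  have G: "(G \<longlongrightarrow> G a) (at a)" using cont by (simp add: isCont_def)
  fix l assume "l < G a"
  then obtain \<delta> where \<delta>: "\<delta> > 0" "\<And>x. x \<noteq> a \<Longrightarrow> dist x a < \<delta> \<Longrightarrow> l < G x"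
    using order_tendstoD(1)[OF G \<open>l < G a\<close>] unfolding eventually_at by auto
  obtain b where b: "b \<in> D" "a - \<delta> < b" "b < a" using dense[of "a - \<delta>" a] \<delta>(1) by auto
  have "l < G b" using b by (intro \<delta>(2)) (auto simp: dist_real_def)
  then have "eventually (\<lambda>n. l < F n b) sequentially" using order_tendstoD(1)[OF conv[OF b(1)]] by blast
  moreover have "eventually (\<lambda>n. b < X n) sequentially" using order_tendstoD(1)[OF X b(3)] .
  ultimately show "eventually (\<lambda>n. l < F n (X n)) sequentially"
  proof eventually_elim
    case (elim n)
    then show ?case using mono[of b "X n" n] by linarith
  qed
next
  have G: "(G \<longlongrightarrow> G a) (at a)" using cont by (simp add: isCont_def)
  fix u assume "G a < u"
  then obtain \<delta> where \<delta>: "\<delta> > 0" "\<And>x. x \<noteq> a \<Longrightarrow> dist x a < \<delta> \<Longrightarrow> G x < u"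
    using order_tendstoD(2)[OF G \<open>G a < u\<close>] unfolding eventually_at by auto
  obtain b where b: "b \<in> D" "a < b" "b < a + \<delta>" using dense[of a "a + \<delta>"] \<delta>(1) by auto
  have "G b < u" using b by (intro \<delta>(2)) (auto simp: dist_real_def)
  then have "eventually (\<lambda>n. F n b < u) sequentially" using order_tendstoD(2)[OF conv[OF b(1)]] by blast
  moreover have "eventually (\<lambda>n. X n < b) sequentially" using order_tendstoD(2)[OF X b(2)] .
  ultimately show "eventually (\<lambda>n. F n (X n) < u) sequentially"
  proof eventually_elim
    case (elim n)
    then show ?case using mono[of "X n" b n] by linarith
  qed
qed

lemma ecdf_mono: "x \<le> y \<Longrightarrow> ecdf n f x \<le> ecdf n f y"
  unfolding ecdf_def by (intro divide_right_mono sum_mono) auto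

text \<open>Here \<open>N\<close>, \<open>a\<close>, \<open>b\<close> stand for \<open>n\<close>,
  \<open>n1\<close>, \<open>n2\<close>. The right-hand side uses only ratios that converge. Its
  first summand is the discrepancy between \<open>b / (a + b)\<close> and the centering
  \<open>c\<close>, which vanishes as \<open>N / b\<close> tends to 0; the second carries
  \<xi>.\<close>

lemma threshold_identity:
  fixes N a b c s t r \<xi> :: real
  assumes N: "N > 0" and a: "a > N" and b: "b > N" and t: "t > 0"
    and c: "c = (b - N) / (a + b - 2 * N)" and s: "s = sqrt (a / N - 1)"
    and t_def: "t = c - \<xi> / (2 * s)" and r: "r = 1 / t - 1"
  shows "(r * b - a) / sqrt (N * (a + b)) =
    1 / t * (sqrt ((N / b) / (a / b + 1)) * ((a / b - 1) / (a / b + 1 - 2 * (N / b))) +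
      \<xi> / 2 * sqrt ((a / b + 1) / (a / b - N / b)))"
proof -
  define w where "w = sqrt ((a + b) / N)"
  have pos: "a > 0" "b > 0" "a + b > 0" "a + b - 2 * N > 0" using N a b by auto
  have w: "w > 0" "w * w = (a + b) / N" using N pos by (auto simp: w_def)
  have sN: "sqrt (N * (a + b)) = N * w"
  proof -
    have "N * (a + b) = N\<^sup>2 * ((a + b) / N)" using N by (simp add: power2_eq_square)
    then have "sqrt (N * (a + b)) = sqrt (N\<^sup>2) * sqrt ((a + b) / N)" by (simp only: real_sqrt_mult)
    then show ?thesis using N by (simp add: w_def)
  qed
  have s0: "s > 0" using N a by (simp add: s)
  have e1: "r * b - a = (a + b) / t * (b / (a + b) - t)"
  proof -
    have "(a + b) / t * (b / (a + b)) = b / t" "(a + b) / t * t = a + b" using t pos by auto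
    then show ?thesis unfolding right_diff_distrib by (simp add: r left_diff_distrib)
  qed
  have e2: "b / (a + b) - t = N * (a - b) / ((a + b) * (a + b - 2 * N)) + \<xi> / (2 * s)"
  proof -
    have "b / (a + b) - c = N * (a - b) / ((a + b) * (a + b - 2 * N))"
      unfolding c using pos by (simp add: divide_simps) (simp add: algebra_simps)
    then show ?thesis unfolding t_def by simp
  qed
  have e3: "(a + b) / (N * w) = w" using w N by (simp add: field_simps)
  have e4: "w * (N * (a - b) / ((a + b) * (a + b - 2 * N))) = 1 / w * ((a - b) / (a + b - 2 * N))"
  proof -
    have "w * (N * (a - b) / ((a + b) * (a + b - 2 * N))) = (w * N / (a + b)) * ((a - b) / (a + b - 2 * N))" by simp
    also have "w * N / (a + b) = 1 / w" using w N pos by (simp add: field_simps)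
    finally show ?thesis .
  qed
  have e5: "1 / w = sqrt ((N / b) / (a / b + 1))"
  proof -
    have *: "(N / b) / (a / b + 1) = N / (a + b)" using pos by (simp add: field_simps)
    show ?thesis unfolding * w_def by (simp add: real_sqrt_divide)
  qed
  have e6: "(a - b) / (a + b - 2 * N) = (a / b - 1) / (a / b + 1 - 2 * (N / b))"
    using pos by (simp add: divide_simps)
  have e7: "w / s = sqrt ((a / b + 1) / (a / b - N / b))"
  proof -
    have "((a + b) / N) / (a / N - 1) = (a / b + 1) / (a / b - N / b)"
      using pos N a by (simp add: divide_simps)
    then show ?thesis unfolding w_def s by (simp flip: real_sqrt_divide)
  qed
  have "(r * b - a) / sqrt (N * (a + b)) = 1 / t * ((a + b) / (N * w)) * (b / (a + b) - t)"
    unfolding e1 sN by simp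
  also have "\<dots> = 1 / t * (w * (N * (a - b) / ((a + b) * (a + b - 2 * N))) + \<xi> / 2 * (w / s))"
    unfolding e3 e2 using s0 by (simp add: algebra_simps)
  finally show ?thesis unfolding e4 e5 e6 e7 .
qed

text \<open>The transformation increases with the eigenvalue, so its sublevel sets are again half
  lines; \<open>t\<close> is the bound for \<open>b / (a * l + b)\<close> and must be positive for
  the inversion.\<close>

lemma transformed_le_iff:
  fixes l c s t \<xi> a b :: real
  assumes l: "l \<ge> 0" and a: "a > 0" and b: "b > 0" and s: "s > 0" and t: "t > 0" "t = c - \<xi> / (2 * s)"
  shows "2 * s * (c - b / (a * l + b)) \<le> \<xi> \<longleftrightarrow> l \<le> b / a * (1 / t - 1)"
proof -
  have d: "a * l + b > 0" using l a b by (simp add: add_nonneg_pos)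
  have "2 * s * (c - b / (a * l + b)) \<le> \<xi> \<longleftrightarrow> c - b / (a * l + b) \<le> \<xi> / (2 * s)"
    using s by (simp add: field_simps)
  also have "\<dots> \<longleftrightarrow> t \<le> b / (a * l + b)" unfolding t(2) by auto
  also have "\<dots> \<longleftrightarrow> t * (a * l + b) \<le> b" using d by (simp add: pos_le_divide_eq)
  also have "\<dots> \<longleftrightarrow> l \<le> b / a * (1 / t - 1)"
    using a t(1) by (simp add: field_simps)
  finally show ?thesis .
qed

text \<open>Stated for one fixed \<xi>: the weights \<open>- r n\<close> in the joint matrix depend
  on \<xi>, and with them the exceptional null set.\<close>

theorem fisher_ecdf_tendsto:
  fixes M :: "'w measure"
    and n1 n2 :: "nat \<Rightarrow> nat"
    and X Y :: "nat \<Rightarrow> nat \<Rightarrow> nat \<Rightarrow> 'w \<Rightarrow> real"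
    and \<gamma> \<xi> :: real
  assumes M: "prob_space M"
    and n1: "\<And>n. n1 n \<ge> n" and n2: "\<And>n. n2 n \<ge> n"
    and X: "\<And>n i j. i < n \<Longrightarrow> j < n1 n \<Longrightarrow> distributed M lborel (X n i j) std_normal_density"
    and Y: "\<And>n i j. i < n \<Longrightarrow> j < n2 n \<Longrightarrow> distributed M lborel (Y n i j) std_normal_density"
    and ind: "\<And>n. prob_space.indep_vars M (\<lambda>_. borel)
               (\<lambda>k. case k of Inl (i, j) \<Rightarrow> X n i j | Inr (i, j) \<Rightarrow> Y n i j)
               (({..<n} \<times> {..<n1 n}) <+> ({..<n} \<times> {..<n2 n}))"
    and lim1: "(\<lambda>n. real n / real (n1 n)) \<longlonglongrightarrow> 0"
    and lim2: "(\<lambda>n. real n / real (n2 n)) \<longlonglongrightarrow> 0"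
    and \<gamma>: "\<gamma> > 0"
    and lim: "(\<lambda>n. real (n1 n) / real (n2 n)) \<longlonglongrightarrow> \<gamma>"
  shows "AE \<omega> in M. (\<lambda>n. ecdf n
        (\<lambda>i. let lam = sorted_eigenvalues
                        (fisher_mat n (n1 n) (n2 n) (\<lambda>i j. X n i j \<omega>) (\<lambda>i j. Y n i j \<omega>)) ! i
             in 2 * sqrt (real (n1 n) / real n - 1) *
                (real (n2 n - n) / real (n1 n + n2 n - 2 * n)
                 - real (n2 n) / (real (n1 n) * lam + real (n2 n))))
        \<xi>) \<longlonglongrightarrow> cdf (semicircle (4 * \<gamma> / (1 + \<gamma>) powr (3/2))) \<xi>"
proof -
  interpret prob_space M by (rule M)
  define \<sigma> where "\<sigma> = 4 * \<gamma> / (1 + \<gamma>) powr (3/2)"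
  have \<sigma>: "\<sigma> > 0" using \<gamma> by (simp add: \<sigma>_def)
  define g where "g n = real (n1 n) / real (n2 n)" for n
  define v where "v n = real n / real (n2 n)" for n
  define c where "c n = real (n2 n - n) / real (n1 n + n2 n - 2 * n)" for n
  define s where "s n = sqrt (real (n1 n) / real n - 1)" for n
  define t where "t n = c n - \<xi> / (2 * s n)" for n
  define r where "r n = 1 / t n - 1" for n
  \<comment> \<open>The factor that takes the limiting radius \<open>2 * sqrt \<gamma>\<close> of
    the spectrum of \<open>K\<close> to \<open>\<sigma>\<close>. The value of
    \<open>\<sigma>\<close> is exactly the one for which the rescaled thresholds \<open>x n\<close>
    tend to \<xi>.\<close>
  define q where "q = \<sigma> / (2 * sqrt \<gamma>)"
  define x where "x n = q * ((r n * real (n2 n) - real (n1 n)) / sqrt (real n * real (n1 n + n2 n)))" for n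
  have g: "g \<longlonglongrightarrow> \<gamma>" and v: "v \<longlonglongrightarrow> 0" using lim lim2 by (simp_all add: g_def[abs_def] v_def[abs_def])
  have big: "eventually (\<lambda>n. n > 0 \<and> n1 n > n \<and> n2 n > n) sequentially"
  proof -
    have "eventually (\<lambda>n. real n / real (n1 n) < 1) sequentially" "eventually (\<lambda>n. real n / real (n2 n) < 1) sequentially"
      using order_tendstoD(2)[OF lim1, of 1] order_tendstoD(2)[OF lim2, of 1] by simp_all
    with eventually_gt_at_top[of 0] show ?thesis
    proof eventually_elim
      case (elim n)
      then have "n1 n > 0" "n2 n > 0" using n1[of n] n2[of n] by linarith+
      then show ?case using elim by (simp add: divide_less_eq)
    qed
  qed
  have c_eq: "c n = (real (n2 n) - real n) / (real (n1 n) + real (n2 n) - 2 * real n)" for n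
    unfolding c_def using n1[of n] n2[of n] by (simp add: of_nat_diff)
  have c: "c \<longlonglongrightarrow> 1 / (1 + \<gamma>)"
  proof -
    have "(\<lambda>n. (1 - v n) / (g n + 1 - 2 * v n)) \<longlonglongrightarrow> (1 - 0) / (\<gamma> + 1 - 2 * 0)"
      using \<gamma> by (intro tendsto_intros g v) auto
    moreover have "eventually (\<lambda>n. (1 - v n) / (g n + 1 - 2 * v n) = c n) sequentially"
      using big
    proof eventually_elim
      case (elim n)
      then show ?case unfolding c_eq v_def g_def by (simp add: divide_simps)
    qed
    ultimately show ?thesis by (simp add: Lim_transform_eventually add.commute)
  qed
  have lim_s: "(\<lambda>n. \<xi> / (2 * s n)) \<longlonglongrightarrow> 0"
  proof -
    have "(\<lambda>n. \<xi> / 2 * sqrt ((real n / real (n1 n)) / (1 - real n / real (n1 n)))) \<longlonglongrightarrow> \<xi> / 2 * sqrt (0 / (1 - 0))"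
      by (intro tendsto_intros lim1) auto
    moreover have "eventually (\<lambda>n. \<xi> / 2 * sqrt ((real n / real (n1 n)) / (1 - real n / real (n1 n))) = \<xi> / (2 * s n)) sequentially"
      using big
    proof eventually_elim
      case (elim n)
      then have "(real n / real (n1 n)) / (1 - real n / real (n1 n)) = 1 / (real (n1 n) / real n - 1)"
        by (simp add: divide_simps)
      then show ?case by (simp add: s_def real_sqrt_divide)
    qed
    ultimately have "(\<lambda>n. \<xi> / (2 * s n)) \<longlonglongrightarrow> \<xi> / 2 * sqrt (0 / (1 - 0))"
      by (rule Lim_transform_eventually)
    then show ?thesis by simp
  qed
  have t: "t \<longlonglongrightarrow> 1 / (1 + \<gamma>)"
    using tendsto_diff[OF c lim_s] by (simp add: t_def[abs_def])
  have r: "r \<longlonglongrightarrow> \<gamma>"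
  proof -
    have "r \<longlonglongrightarrow> 1 / (1 / (1 + \<gamma>)) - 1"
      unfolding r_def[abs_def] using \<gamma> by (intro tendsto_intros t) auto
    then show ?thesis by simp
  qed
  \<comment> \<open>For small \<open>n\<close> the bound \<open>t n\<close> may fail to be positive,
    so the thresholds correspond only eventually.\<close>
  have tpos: "eventually (\<lambda>n. t n > 0) sequentially"
    using order_tendstoD(1)[OF t, of 0] \<gamma> by simp
  have x: "x \<longlonglongrightarrow> \<xi>"
  proof -
    let ?h = "\<lambda>n. q * (1 / t n * (sqrt (v n / (g n + 1)) * ((g n - 1) / (g n + 1 - 2 * v n)) +
        \<xi> / 2 * sqrt ((g n + 1) / (g n - v n))))"
    have "?h \<longlonglongrightarrow> q * (1 / (1 / (1 + \<gamma>)) * (sqrt (0 / (\<gamma> + 1)) * ((\<gamma> - 1) / (\<gamma> + 1 - 2 * 0)) +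
        \<xi> / 2 * sqrt ((\<gamma> + 1) / (\<gamma> - 0))))"
      using \<gamma> by (intro tendsto_intros g v t) auto
    also have "q * (1 / (1 / (1 + \<gamma>)) * (sqrt (0 / (\<gamma> + 1)) * ((\<gamma> - 1) / (\<gamma> + 1 - 2 * 0)) +
        \<xi> / 2 * sqrt ((\<gamma> + 1) / (\<gamma> - 0)))) = \<xi>"
    proof -
      have "(1 + \<gamma>) powr (3/2) = (1 + \<gamma>) powr (1 + 1/2)" by simp
      also have "\<dots> = (1 + \<gamma>) * sqrt (1 + \<gamma>)" using \<gamma> by (subst powr_add) (simp add: powr_half_sqrt)
      finally have p: "(1 + \<gamma>) powr (3/2) = (1 + \<gamma>) * sqrt (1 + \<gamma>)" .
      have "sqrt \<gamma> * sqrt \<gamma> = \<gamma>" "sqrt (1 + \<gamma>) \<noteq> 0" "sqrt \<gamma> \<noteq> 0" using \<gamma> by auto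
      then show ?thesis unfolding q_def \<sigma>_def p using \<gamma>
        by (simp add: real_sqrt_divide add.commute divide_simps)
    qed
    finally have "?h \<longlonglongrightarrow> \<xi>" .
    moreover have "eventually (\<lambda>n. ?h n = x n) sequentially"
      using big tpos
    proof eventually_elim
      case (elim n)
      have "(r n * real (n2 n) - real (n1 n)) / sqrt (real n * (real (n1 n) + real (n2 n))) =
        1 / t n * (sqrt (v n / (g n + 1)) * ((g n - 1) / (g n + 1 - 2 * v n)) + \<xi> / 2 * sqrt ((g n + 1) / (g n - v n)))"
        unfolding v_def g_def
        by (rule threshold_identity[OF _ _ _ elim(2) c_eq s_def t_def r_def]) (use elim(1) in auto)
      then show ?case by (simp add: x_def)
    qed
    ultimately show ?thesis by (rule Lim_transform_eventually)
  qed
  define J where "J n = {..<n1 n} <+> {..<n2 n}" for n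
  define d where "d n = (\<lambda>k. case k of Inl (_::nat) \<Rightarrow> 1 | Inr (_::nat) \<Rightarrow> - r n)" for n
  define z where "z n i k = (case k of Inl j \<Rightarrow> X n i j | Inr j \<Rightarrow> Y n i j)" for n i k
  \<comment> \<open>The limit of the average of \<open>D\<^sup>m\<close>: the weights 1 and
    \<open>- r n\<close> occur in the ratio \<gamma> to 1, and \<open>r n\<close> tends to \<gamma>.
    In particular \<open>\<tau> 2 = \<gamma>\<close>.\<close>
  define \<tau> where "\<tau> m = (\<gamma> + (- \<gamma>) ^ m) / (\<gamma> + 1)" for m
  have \<tau>2: "\<tau> 2 = (sqrt \<gamma>)\<^sup>2" using \<gamma> by (simp add: \<tau>_def power2_eq_square field_simps)
  have cardJ: "card (J n) = n1 n + n2 n" for n by (simp add: J_def card_Plus)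
  have sumJ: "(\<Sum>k\<in>J n. d n k ^ m) = real (n1 n) + real (n2 n) * (- r n) ^ m" for n m
    unfolding J_def d_def by (simp add: sum.Plus)
  have gm: "gaussian_matrix M n (J n) (z n)" if n: "n > 0" for n
  proof
    show "n > 0" by (rule n)
    show "finite (J n)" by (simp add: J_def)
    have "Inl 0 \<in> J n" using n n1[of n] by (auto simp: J_def)
    then show "J n \<noteq> {}" by blast
    show "distributed M lborel (z n p k) std_normal_density" if "p < n" "k \<in> J n" for p k
      using that X Y by (auto simp: z_def J_def)
    \<comment> \<open>Moves the tag from the column index to the whole entry, which is how the
      independence assumption is indexed.\<close>
    define h where "h = (\<lambda>(p, k). case k of Inl j \<Rightarrow> Inl (p :: nat, j :: nat) | Inr j \<Rightarrow> Inr (p, j :: nat))"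
    have inj: "inj_on h ({..<n} \<times> J n)"
      by (auto simp: inj_on_def h_def split: sum.splits)
    have "h ` ({..<n} \<times> J n) = ({..<n} \<times> {..<n1 n}) <+> ({..<n} \<times> {..<n2 n})"
      by (auto simp: h_def J_def image_iff Plus_def split: sum.splits) force+
    from indep_vars_reindex[OF inj, of "\<lambda>_. borel", unfolded this, OF ind]
    have "indep_vars (\<lambda>_. borel) (\<lambda>i. case h i of Inl (i, j) \<Rightarrow> X n i j | Inr (i, j) \<Rightarrow> Y n i j) ({..<n} \<times> J n)" .
    moreover have "(\<lambda>i. case h i of Inl (i, j) \<Rightarrow> X n i j | Inr (i, j) \<Rightarrow> Y n i j) = (\<lambda>(p, k). z n p k)"
      by (auto simp: h_def z_def fun_eq_iff split: sum.splits)
    ultimately show "indep_vars (\<lambda>_. borel) (\<lambda>(p, k). z n p k) ({..<n} \<times> J n)" by simp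
  qed
  have e_lim: "(\<lambda>n. sqrt (real n / real (card (J n)))) \<longlonglongrightarrow> 0"
  proof -
    have "(\<lambda>n. sqrt (v n / (g n + 1))) \<longlonglongrightarrow> sqrt (0 / (\<gamma> + 1))"
      using \<gamma> by (intro tendsto_intros g v) auto
    moreover have "eventually (\<lambda>n. sqrt (v n / (g n + 1)) = sqrt (real n / real (card (J n)))) sequentially"
      using big by eventually_elim (simp add: v_def g_def cardJ divide_simps)
    ultimately show ?thesis by (simp add: Lim_transform_eventually)
  qed
  have tau_lim: "(\<lambda>n. (\<Sum>k\<in>J n. d n k ^ m) / real (card (J n))) \<longlonglongrightarrow> \<tau> m" for m
  proof -
    have "(\<lambda>n. (g n + (- r n) ^ m) / (g n + 1)) \<longlonglongrightarrow> \<tau> m"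
      unfolding \<tau>_def using \<gamma> by (intro tendsto_intros g r) auto
    moreover have "eventually (\<lambda>n. (g n + (- r n) ^ m) / (g n + 1) = (\<Sum>k\<in>J n. d n k ^ m) / real (card (J n))) sequentially"
      using big by eventually_elim (simp add: g_def cardJ sumJ divide_simps)
    ultimately show ?thesis by (rule Lim_transform_eventually)
  qed
  have AE1: "AE \<omega> in M. \<forall>k. (\<lambda>n. word_tr n (J n) (d n) (\<lambda>p j. z n p j \<omega>) (replicate k 1)) \<longlonglongrightarrow> limit_moment \<tau> (replicate k 1)"
    unfolding AE_all_countable by (intro allI AE_word_tr_tendsto[OF gm e_lim tau_lim])
  have AE2: "AE \<omega> in M. \<forall>n. det (gram n (n2 n) (\<lambda>i j. Y n i j \<omega>)) \<noteq> 0"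
    unfolding AE_all_countable
  proof
    fix n
    have "indep_vars (\<lambda>_. borel) (\<lambda>k. case k of Inl (i, j) \<Rightarrow> X n i j | Inr (i, j) \<Rightarrow> Y n i j) (Inr ` ({..<n} \<times> {..<n2 n}))"
      by (rule indep_vars_subset[OF ind]) auto
    from indep_vars_reindex[OF _ this]
    have "indep_vars (\<lambda>_. borel) (\<lambda>(i, j). Y n i j) ({..<n} \<times> {..<n2 n})" by simp
    then show "AE \<omega> in M. det (gram n (n2 n) (\<lambda>i j. Y n i j \<omega>)) \<noteq> 0"
      using n2 Y by (rule AE_det_gram_nonzero)
  qed
  from AE1 AE2 show ?thesis
  proof eventually_elim
    case (elim \<omega>)
    define lam where "lam n i = sorted_eigenvalues (fisher_mat n (n1 n) (n2 n) (\<lambda>i j. X n i j \<omega>) (\<lambda>i j. Y n i j \<omega>)) ! i" for n i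
    define mu where "mu n i = 2 * s n * (c n - real (n2 n) / (real (n1 n) * lam n i + real (n2 n)))" for n i
    have "\<exists>\<kappa>. (\<forall>k. word_tr n (J n) (d n) (\<lambda>p j. z n p j \<omega>) (replicate k 1) = (\<Sum>i<n. \<kappa> i ^ k) / real n) \<and>
      ecdf n (lam n) (real (n2 n) / real (n1 n) * r n) =
        ecdf n \<kappa> ((r n * real (n2 n) - real (n1 n)) / sqrt (real n * real (n1 n + n2 n))) \<and>
      (\<forall>i<n. 0 \<le> lam n i)" if n: "n > 0" for n
    proof -
      have pos: "n1 n > 0" "n2 n > 0" using n n1[of n] n2[of n] by linarith+
      have zz: "(\<lambda>p j. z n p j \<omega>) = (\<lambda>i c. case c of Inl j \<Rightarrow> X n i j \<omega> | Inr j \<Rightarrow> Y n i j \<omega>)"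
        by (auto simp: z_def fun_eq_iff split: sum.splits)
      show ?thesis unfolding zz J_def d_def lam_def
        by (rule fisher_eigenvalue_count[OF n pos, of "\<lambda>i j. Y n i j \<omega>" "r n" "\<lambda>i j. X n i j \<omega>"])
          (use elim(2) in auto)
    qed
    then obtain \<kappa> where \<kappa>: "\<And>n k. n > 0 \<Longrightarrow> word_tr n (J n) (d n) (\<lambda>p j. z n p j \<omega>) (replicate k 1) = (\<Sum>i<n. \<kappa> n i ^ k) / real n"
      "\<And>n. n > 0 \<Longrightarrow> ecdf n (lam n) (real (n2 n) / real (n1 n) * r n) =
        ecdf n (\<kappa> n) ((r n * real (n2 n) - real (n1 n)) / sqrt (real n * real (n1 n + n2 n)))"
      "\<And>n i. n > 0 \<Longrightarrow> i < n \<Longrightarrow> 0 \<le> lam n i"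
      by metis
    define y where "y n i = q * \<kappa> n i" for n i
    have q: "q > 0" using \<sigma> \<gamma> by (simp add: q_def)
    have mom: "(\<lambda>n. (\<Sum>i<n. y n i ^ k) / real n) \<longlonglongrightarrow> (\<sigma> / 2) ^ k * cheb_moment k 0" for k
    proof -
      have "(\<lambda>n. q ^ k * word_tr n (J n) (d n) (\<lambda>p j. z n p j \<omega>) (replicate k 1)) \<longlonglongrightarrow> q ^ k * limit_moment \<tau> (replicate k 1)"
        using elim(1) by (intro tendsto_mult_left) blast
      moreover have "q ^ k * limit_moment \<tau> (replicate k 1) = (\<sigma> / 2) ^ k * cheb_moment k 0"
      proof -
        have "q * sqrt \<gamma> = \<sigma> / 2" using \<gamma> by (simp add: q_def)
        then have "q ^ k * sqrt \<gamma> ^ k = (\<sigma> / 2) ^ k" by (metis power_mult_distrib)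
        then show ?thesis unfolding limit_moment_replicate[of \<tau>, OF \<tau>2] by (simp only: mult.assoc[symmetric])
      qed
      moreover have "eventually (\<lambda>n. q ^ k * word_tr n (J n) (d n) (\<lambda>p j. z n p j \<omega>) (replicate k 1) = (\<Sum>i<n. y n i ^ k) / real n) sequentially"
        using eventually_gt_at_top[of 0]
      proof eventually_elim
        case (elim n)
        show ?case unfolding \<kappa>(1)[OF elim] y_def by (simp add: power_mult_distrib sum_distrib_left)
      qed
      ultimately show ?thesis by (auto intro: Lim_transform_eventually)
    qed
    \<comment> \<open>The threshold \<open>x n\<close> varies with \<open>n\<close>; continuity of
      the semicircle distribution function absorbs this.\<close>
    have L: "(\<lambda>n. ecdf n (y n) (x n)) \<longlonglongrightarrow> cdf (semicircle \<sigma>) \<xi>"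
    proof (rule mono_tendsto_dense[where D = UNIV and F = "\<lambda>n. ecdf n (y n)" and X = x and G = "cdf (semicircle \<sigma>)"])
      show "(\<lambda>n. ecdf n (y n) a) \<longlonglongrightarrow> cdf (semicircle \<sigma>) a" for a
        by (rule ecdf_tendsto_semicircle[OF \<sigma> mom])
      show "\<exists>d\<in>UNIV. a < d \<and> d < b" if "a < b" for a b :: real using dense[OF that] by auto
    qed (auto intro: ecdf_mono isCont_cdf_semicircle \<sigma> x)
    have "eventually (\<lambda>n. ecdf n (y n) (x n) = ecdf n (mu n) \<xi>) sequentially"
      using big tpos
    proof eventually_elim
      case (elim n)
      have n: "n > 0" using elim by simp
      have pos: "real (n1 n) > 0" "real (n2 n) > 0" "s n > 0"
        using elim(1) by (auto simp: s_def)
      have "ecdf n (y n) (x n) = ecdf n (\<kappa> n) ((r n * real (n2 n) - real (n1 n)) / sqrt (real n * real (n1 n + n2 n)))"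
        unfolding ecdf_def y_def x_def mult_le_cancel_left_pos[OF q] ..
      also have "\<dots> = ecdf n (lam n) (real (n2 n) / real (n1 n) * r n)" using \<kappa>(2)[OF n] ..
      also have "\<dots> = ecdf n (mu n) \<xi>"
      proof -
        have "mu n i \<le> \<xi> \<longleftrightarrow> lam n i \<le> real (n2 n) / real (n1 n) * r n" if "i < n" for i
          unfolding mu_def r_def by (rule transformed_le_iff[OF \<kappa>(3)[OF n that] pos elim(2) t_def])
        then show ?thesis unfolding ecdf_def by (auto intro!: arg_cong2[where f = "(/)"] sum.cong)
      qed
      finally show ?case .
    qed
    with L have "(\<lambda>n. ecdf n (mu n) \<xi>) \<longlonglongrightarrow> cdf (semicircle \<sigma>) \<xi>" by (rule Lim_transform_eventually)
    then show ?case unfolding mu_def[abs_def] s_def c_def lam_def \<sigma>_def Let_def .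
  qed
qed

lemma f_gamma_eq_semicircle_density:
  "f_gamma \<gamma> = semicircle_density (4 * \<gamma> / (1 + \<gamma>) powr (3/2))"
  by (simp add: fun_eq_iff f_gamma_def semicircle_density_def Let_def)

theorem theorem4p2:
  fixes M :: "'w measure"
    and n1 n2 :: "nat \<Rightarrow> nat"
    and X Y :: "nat \<Rightarrow> nat \<Rightarrow> nat \<Rightarrow> 'w \<Rightarrow> real"
    and \<gamma> :: real
  assumes "prob_space M"
    and "\<And>n. n1 n \<ge> n" and "\<And>n. n2 n \<ge> n"
    and "\<And>n i j. i < n \<Longrightarrow> j < n1 n \<Longrightarrow> distributed M lborel (X n i j) std_normal_density"
    and "\<And>n i j. i < n \<Longrightarrow> j < n2 n \<Longrightarrow> distributed M lborel (Y n i j) std_normal_density"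
    and "\<And>n. prob_space.indep_vars M (\<lambda>_. borel)
               (\<lambda>k. case k of Inl (i, j) \<Rightarrow> X n i j | Inr (i, j) \<Rightarrow> Y n i j)
               (({..<n} \<times> {..<n1 n}) <+> ({..<n} \<times> {..<n2 n}))"
    and "(\<lambda>n. real n / real (n1 n)) \<longlonglongrightarrow> 0"
    and "(\<lambda>n. real n / real (n2 n)) \<longlonglongrightarrow> 0"
    and "\<gamma> > 0"
    and "(\<lambda>n. real (n1 n) / real (n2 n)) \<longlonglongrightarrow> \<gamma>"
    and "\<exists>\<nu>. 0 < \<nu> \<and> \<nu> < 1 \<and> (\<lambda>n. real (n1 n)) \<in> O(\<lambda>n. real n powr (1 + \<nu>))"
  shows "AE \<omega> in M. \<forall>\<xi>::real.
    (\<lambda>n. ecdf n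
        (\<lambda>i. let lam = sorted_eigenvalues
                        (fisher_mat n (n1 n) (n2 n) (\<lambda>i j. X n i j \<omega>) (\<lambda>i j. Y n i j \<omega>)) ! i
             in 2 * sqrt (real (n1 n) / real n - 1) *
                (real (n2 n - n) / real (n1 n + n2 n - 2 * n)
                 - real (n2 n) / (real (n1 n) * lam + real (n2 n))))
        \<xi>)
    \<longlonglongrightarrow> (\<integral>x. indicator {..\<xi>} x * f_gamma \<gamma> x \<partial>lborel)"
proof -
  define \<sigma> where "\<sigma> = 4 * \<gamma> / (1 + \<gamma>) powr (3/2)"
  have \<sigma>: "\<sigma> > 0" using assms(9) by (simp add: \<sigma>_def)
  define F where "F \<omega> n = ecdf n
        (\<lambda>i. let lam = sorted_eigenvalues
                        (fisher_mat n (n1 n) (n2 n) (\<lambda>i j. X n i j \<omega>) (\<lambda>i j. Y n i j \<omega>)) ! i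
             in 2 * sqrt (real (n1 n) / real n - 1) *
                (real (n2 n - n) / real (n1 n + n2 n - 2 * n)
                 - real (n2 n) / (real (n1 n) * lam + real (n2 n))))" for \<omega> n
  have "AE \<omega> in M. (\<lambda>n. F \<omega> n a) \<longlonglongrightarrow> cdf (semicircle \<sigma>) a" for a
    unfolding F_def \<sigma>_def by (rule fisher_ecdf_tendsto[OF assms(1-10)])
  \<comment> \<open>A countable union of null sets is null; monotonicity extends the convergence
    from rational to all arguments below.\<close>
  then have "AE \<omega> in M. \<forall>a\<in>\<rat>. (\<lambda>n. F \<omega> n a) \<longlonglongrightarrow> cdf (semicircle \<sigma>) a"
    by (intro AE_ball_countable' countable_rat) auto
  then have "AE \<omega> in M. \<forall>\<xi>. (\<lambda>n. F \<omega> n \<xi>) \<longlonglongrightarrow> cdf (semicircle \<sigma>) \<xi>"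
  proof eventually_elim
    case (elim \<omega>)
    show ?case
    proof
      fix \<xi>
      show "(\<lambda>n. F \<omega> n \<xi>) \<longlonglongrightarrow> cdf (semicircle \<sigma>) \<xi>"
      proof (rule mono_tendsto_dense[where D = "\<rat>" and F = "F \<omega>" and G = "cdf (semicircle \<sigma>)" and X = "\<lambda>_. \<xi>"])
        show "F \<omega> n a \<le> F \<omega> n b" if "a \<le> b" for n a b
          unfolding F_def by (rule ecdf_mono[OF that])
        show "\<exists>d\<in>\<rat>. a < d \<and> d < b" if "a < b" for a b :: real
          using Rats_dense_in_real[OF that] .
      qed (use elim isCont_cdf_semicircle[OF \<sigma>] in auto)
    qed
  qed
  moreover have "cdf (semicircle \<sigma>) \<xi> = (\<integral>x. indicator {..\<xi>} x * f_gamma \<gamma> x \<partial>lborel)" for \<xi>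
    unfolding f_gamma_eq_semicircle_density \<sigma>_def[symmetric] by (rule cdf_semicircle[OF \<sigma>])
  ultimately show ?thesis unfolding F_def by (simp only:)
qed

end
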